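(* Let $K$ be a compact connected metric space and $\mu$ a finite Borel measure on $K$ with $\mathrm{supp}\,\mu=K$. Let $S$ be a positive $C_0$-semigroup on $L_2(K,\mu)$ with self-adjoint generator $-A$. Suppose that $S_tL_2(K)\subset C(K)$ for all $t>0$. Define $S^c_t=S_t|_{C(K)}\colon C(K)\to C(K)$ for all $t>0$. Then the following are equivalent. (i) The semigroup $S^c=(S^c_t)_{t>0}$ is irreducible on $C(K)$. (ii) For all $x\in K$ there exist $t>0$ and $f\in C(K)$ such that $(S^c_tf)(x)\ne0$. (iii) There exist a $\delta>0$ and an eigenfunction $u_1\in L_2(K)$ of $A$ with eigenvalue $\min\sigma(A)$, with $u_1\ge0$ almost everywhere, such that $u_1(x)\ge\delta$ for all $x\in K$. (iv) For all $f\in C(K)$ with $f\ge0$ and $f\ne0$ it follows that $(S_tf)(x)>0$ for all $t>0$ and $x\in K$.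
   Context: $C(K)$ is regarded as a subspace of $L_2(K)=L_2(K,\mu)$ (injectively, since $\mathrm{supp}\,\mu=K$). A semigroup is positive if each operator maps nonnegative functions to nonnegative functions. An ideal of a Banach lattice $E$ is a subspace $I$ such that $u\in I$ implies $|u|\in I$, and $u\in I$, $v\in E$, $0\le v\le u$ imply $v\in I$; a semigroup on $E$ is irreducible if the only closed ideals invariant under all its operators are $\{0\}$ and $E$. (The closed ideals of $C(K)$ are the sets $\{f\in C(K):f|_B=0\}$ with $B\subset K$ closed.) In this setting $A$ is bounded below with compact resolvent, $\min\sigma(A)$ is an eigenvalue, and eigenfunctions have a (unique) continuous representative, with which they are identified in (iii). *)

theory Defs
  imports "HOL-Analysis.Analysis"
begin

text \<open>
  Scalars are real.  Elements of \<open>L\<^sub>2(K,\<mu>)\<close> are represented by square-integrable functions, with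
  equality \<open>\<mu>\<close>-almost everywhere playing the role of equality.  The space \<open>K\<close> is a type with compact
  universe, so that \<open>'a \<Rightarrow>\<^sub>C real\<close> consists of all continuous functions and is \<open>C(K)\<close> with the
  supremum norm.
\<close>

section \<open>The Hilbert space \<open>L\<^sub>2\<close>\<close>

definition L2 :: "'a measure \<Rightarrow> ('a \<Rightarrow> real) set" where
  "L2 \<mu> = {f. f \<in> borel_measurable \<mu> \<and> integrable \<mu> (\<lambda>x. (f x)\<^sup>2)}"

definition L2_inner :: "'a measure \<Rightarrow> ('a \<Rightarrow> real) \<Rightarrow> ('a \<Rightarrow> real) \<Rightarrow> real" where
  "L2_inner \<mu> f g = (\<integral>x. f x * g x \<partial>\<mu>)"

definition L2_norm :: "'a measure \<Rightarrow> ('a \<Rightarrow> real) \<Rightarrow> real" where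
  "L2_norm \<mu> f = sqrt (L2_inner \<mu> f f)"

text \<open>
  Compatibility with equality almost everywhere need not be required separately:
  it follows from linearity and the norm bound applied to \<open>f - g\<close>.
\<close>

definition L2_bounded_linear :: "'a measure \<Rightarrow> (('a \<Rightarrow> real) \<Rightarrow> ('a \<Rightarrow> real)) \<Rightarrow> bool" where
  "L2_bounded_linear \<mu> T \<longleftrightarrow>
     (\<forall>f\<in>L2 \<mu>. T f \<in> L2 \<mu>) \<and>
     (\<forall>f\<in>L2 \<mu>. \<forall>g\<in>L2 \<mu>. \<forall>a b. AE x in \<mu>. T (\<lambda>y. a * f y + b * g y) x = a * T f x + b * T g x) \<and>
     (\<exists>C. \<forall>f\<in>L2 \<mu>. L2_norm \<mu> (T f) \<le> C * L2_norm \<mu> f)"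

section \<open>Unbounded operators on \<open>L\<^sub>2\<close>, given by their graphs\<close>

text \<open>
  A graph is a set of pairs of representatives; the graphs below (generators, adjoints, self-adjoint
  operators) are closed under replacing either component by another representative.
\<close>

type_synonym 'a L2_graph = "(('a \<Rightarrow> real) \<times> ('a \<Rightarrow> real)) set"

definition L2_densely_defined :: "'a measure \<Rightarrow> 'a L2_graph \<Rightarrow> bool" where
  "L2_densely_defined \<mu> A \<longleftrightarrow>
     (\<forall>f\<in>L2 \<mu>. \<forall>\<epsilon>>0. \<exists>u\<in>Domain A. L2_norm \<mu> (\<lambda>x. f x - u x) < \<epsilon>)"

definition L2_adjoint :: "'a measure \<Rightarrow> 'a L2_graph \<Rightarrow> 'a L2_graph" where
  "L2_adjoint \<mu> A = {(f, g). f \<in> L2 \<mu> \<and> g \<in> L2 \<mu> \<and>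
     (\<forall>(u, v)\<in>A. L2_inner \<mu> v f = L2_inner \<mu> u g)}"

definition L2_selfadjoint :: "'a measure \<Rightarrow> 'a L2_graph \<Rightarrow> bool" where
  "L2_selfadjoint \<mu> A \<longleftrightarrow> A \<subseteq> L2 \<mu> \<times> L2 \<mu> \<and> L2_densely_defined \<mu> A \<and> L2_adjoint \<mu> A = A"

definition L2_resolvent_set :: "'a measure \<Rightarrow> 'a L2_graph \<Rightarrow> real set" where
  "L2_resolvent_set \<mu> A = {\<kappa>. \<exists>R. L2_bounded_linear \<mu> R \<and>
     (\<forall>g\<in>L2 \<mu>. \<exists>h. (R g, h) \<in> A \<and> (AE x in \<mu>. \<kappa> * R g x - h x = g x)) \<and>
     (\<forall>(f, h)\<in>A. AE x in \<mu>. R (\<lambda>y. \<kappa> * f y - h y) x = f x)}"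

definition L2_spectrum :: "'a measure \<Rightarrow> 'a L2_graph \<Rightarrow> real set" where
  "L2_spectrum \<mu> A = - L2_resolvent_set \<mu> A"

definition L2_eigenfunction :: "'a measure \<Rightarrow> 'a L2_graph \<Rightarrow> real \<Rightarrow> ('a \<Rightarrow> real) \<Rightarrow> bool" where
  "L2_eigenfunction \<mu> A \<kappa> u \<longleftrightarrow> (u, \<lambda>x. \<kappa> * u x) \<in> A \<and> \<not> (AE x in \<mu>. u x = 0)"

section \<open>Semigroups on \<open>L\<^sub>2\<close>\<close>

text \<open>Only the values \<open>S t\<close> for \<open>t > 0\<close> are relevant.\<close>

definition L2_C0_semigroup :: "'a measure \<Rightarrow> (real \<Rightarrow> ('a \<Rightarrow> real) \<Rightarrow> ('a \<Rightarrow> real)) \<Rightarrow> bool" where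
  "L2_C0_semigroup \<mu> S \<longleftrightarrow>
     (\<forall>t>0. L2_bounded_linear \<mu> (S t)) \<and>
     (\<forall>s>0. \<forall>t>0. \<forall>f\<in>L2 \<mu>. AE x in \<mu>. S (s + t) f x = S s (S t f) x) \<and>
     (\<forall>f\<in>L2 \<mu>. ((\<lambda>t. L2_norm \<mu> (\<lambda>x. S t f x - f x)) \<longlongrightarrow> 0) (at_right 0))"

definition L2_positive_semigroup :: "'a measure \<Rightarrow> (real \<Rightarrow> ('a \<Rightarrow> real) \<Rightarrow> ('a \<Rightarrow> real)) \<Rightarrow> bool" where
  "L2_positive_semigroup \<mu> S \<longleftrightarrow>
     (\<forall>t>0. \<forall>f\<in>L2 \<mu>. (AE x in \<mu>. f x \<ge> 0) \<longrightarrow> (AE x in \<mu>. S t f x \<ge> 0))"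

definition L2_generator :: "'a measure \<Rightarrow> (real \<Rightarrow> ('a \<Rightarrow> real) \<Rightarrow> ('a \<Rightarrow> real)) \<Rightarrow> 'a L2_graph" where
  "L2_generator \<mu> S = {(f, g). f \<in> L2 \<mu> \<and> g \<in> L2 \<mu> \<and>
     ((\<lambda>t. L2_norm \<mu> (\<lambda>x. (S t f x - f x) / t - g x)) \<longlongrightarrow> 0) (at_right 0)}"

section \<open>Continuous functions\<close>

definition full_support :: "'a::topological_space measure \<Rightarrow> bool" where
  "full_support \<mu> \<longleftrightarrow> (\<forall>U. open U \<and> U \<noteq> {} \<longrightarrow> emeasure \<mu> U > 0)"

text \<open>
  If \<open>\<mu>\<close> has full support, then a function has at most one continuous representative.
  The value is meaningful only when there is one.
\<close>

definition cont_rep :: "'a::topological_space measure \<Rightarrow> ('a \<Rightarrow> real) \<Rightarrow> ('a \<Rightarrow>\<^sub>C real)" where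
  "cont_rep \<mu> f = (THE g. AE x in \<mu>. apply_bcontfun g x = f x)"

definition C_part :: "'a::topological_space measure \<Rightarrow> (real \<Rightarrow> ('a \<Rightarrow> real) \<Rightarrow> ('a \<Rightarrow> real)) \<Rightarrow>
    real \<Rightarrow> ('a \<Rightarrow>\<^sub>C real) \<Rightarrow> ('a \<Rightarrow>\<^sub>C real)" where
  "C_part \<mu> S t f = cont_rep \<mu> (S t (apply_bcontfun f))"

definition C_ideal :: "('a::topological_space \<Rightarrow>\<^sub>C real) set \<Rightarrow> bool" where
  "C_ideal I \<longleftrightarrow> subspace I \<and>
     (\<forall>u\<in>I. \<forall>w. (\<forall>x. apply_bcontfun w x = \<bar>apply_bcontfun u x\<bar>) \<longrightarrow> w \<in> I) \<and>
     (\<forall>u\<in>I. \<forall>v. (\<forall>x. 0 \<le> apply_bcontfun v x \<and> apply_bcontfun v x \<le> apply_bcontfun u x) \<longrightarrow> v \<in> I)"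

definition C_irreducible :: "(real \<Rightarrow> ('a::topological_space \<Rightarrow>\<^sub>C real) \<Rightarrow> ('a \<Rightarrow>\<^sub>C real)) \<Rightarrow> bool" where
  "C_irreducible T \<longleftrightarrow>
     (\<forall>I. C_ideal I \<and> closed I \<and> (\<forall>t>0. T t ` I \<subseteq> I) \<longrightarrow> I = {0} \<or> I = UNIV)"

end

theory Submission
  imports Defs
begin

text \<open>
  Positivity and the mapping property give \<open>\<bar>S t f x\<bar> \<le> C \<parallel>f\<parallel>\<close>, so \<open>f \<mapsto> S t f x\<close> is the
  inner product with a nonnegative kernel function.

  (i) implies (iv): if \<open>f \<ge> 0\<close> and \<open>S t f x = 0\<close> for one \<open>t > 0\<close>, then this holds for all earlier
  times by positivity and symmetry, hence for all times by unique continuation. The functions \<open>g\<close>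
  with \<open>S t \<bar>g\<bar> x = 0\<close> for all \<open>t\<close> then form a nonzero invariant closed ideal. It is all of \<open>C(K)\<close>,
  so that \<open>S t f x = 0\<close> for all \<open>t\<close> and \<open>f\<close>. Then the functions vanishing at \<open>x\<close> form an invariant
  closed ideal, so \<open>K = {x}\<close> and \<open>S t = 0\<close>, which strong continuity excludes.

  (iv) implies (iii): after rescaling by the growth rate, the orbit of some kernel function converges
  to a nonzero nonnegative eigenfunction \<open>u\<close> for \<open>min \<sigma>(A)\<close>. As \<open>u\<close> is a multiple of \<open>S 1 u\<close>, it is
  strictly positive, and bounded below by compactness. (iii) implies (ii) since \<open>S 1 u\<close> is a
  nonzero multiple of \<open>u\<close>.

  (ii) implies (i): if the closed ideal of the functions vanishing on \<open>B\<close> is invariant, then by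
  symmetry \<open>S t 1\<^sub>B\<close> vanishes off \<open>B\<close>, while \<open>S t (1 - 1\<^sub>B)\<close> vanishes on \<open>B\<close>. At a boundary point
  of \<open>B\<close>, which exists by connectedness unless \<open>B\<close> is trivial, every \<open>S t f\<close> vanishes.
\<close>

section \<open>The space \<open>L\<^sub>2\<close>\<close>

text \<open>Point values make no sense for \<open>S t f\<close>, which is fixed only up to null
  sets, so the locale works with its continuous representative \<open>Q t f\<close>.
  Self-adjointness is given for the generator, whereas the arguments use symmetry of each
  \<open>Q t\<close>, mainly through \<open>(nm (Q (t / 2) f))\<^sup>2 = ip (Q t f) f\<close>. This
  identity carries a norm bound \<open>exp (\<omega> * t)\<close> to the times
  \<open>t / 2 ^ n\<close> without changing the rate, gives injectivity, and makes rescaled orbits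
  monotone; hence the dyadic times throughout. Unique continuation is quantitative: with step
  \<open>h = s / N\<close>, vanishing moments up to order \<open>N\<close> force the moment of order
  \<open>M * N\<close> down to order \<open>1 / sqrt N\<close>. The bottom of the spectrum is read
  off at time 1: the best \<open>\<kappa>\<close> in
  \<open>nm (Q 1 f) \<le> exp (- \<kappa>) * nm f\<close> puts everything below
  \<open>\<kappa>\<close> into the resolvent set. The obstacle is that a rescaled orbit may tend to
  0. If this happened for every kernel function, dominated convergence on the finite measure space
  would contradict the optimality of \<open>\<kappa>\<close>.\<close>

lemma L2_measurable [measurable_dest]: "f \<in> L2 M \<Longrightarrow> f \<in> borel_measurable M"
  by (simp add: L2_def)

lemma L2_square_integrable: "f \<in> L2 M \<Longrightarrow> integrable M (\<lambda>x. (f x)\<^sup>2)"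
  by (simp add: L2_def)

lemma L2_dominated:
  assumes "g \<in> L2 M" "f \<in> borel_measurable M" "AE x in M. \<bar>f x\<bar> \<le> \<bar>g x\<bar>"
  shows "f \<in> L2 M"
proof -
  have "integrable M (\<lambda>x. (f x)\<^sup>2)"
    using L2_square_integrable[OF assms(1)]
  proof (rule Bochner_Integration.integrable_bound)
    show "AE x in M. norm ((f x)\<^sup>2) \<le> norm ((g x)\<^sup>2)"
      using assms(3) by eventually_elim (simp add: abs_le_square_iff)
  qed (use assms(2) in measurable)
  with assms(2) show ?thesis by (simp add: L2_def)
qed

lemma L2_zero [simp]: "(\<lambda>x. 0) \<in> L2 M"
  by (simp add: L2_def)

lemma L2_mult [intro, simp]:
  assumes "f \<in> L2 M" shows "(\<lambda>x. c * f x) \<in> L2 M"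
  using assms by (auto simp: L2_def power_mult_distrib)

lemma L2_uminus [intro, simp]: "f \<in> L2 M \<Longrightarrow> (\<lambda>x. - f x) \<in> L2 M"
  using L2_mult[of f M "-1"] by simp

lemma L2_abs [intro, simp]: "f \<in> L2 M \<Longrightarrow> (\<lambda>x. \<bar>f x\<bar>) \<in> L2 M"
  by (auto intro!: L2_dominated[of f])

lemma L2_divide [intro, simp]: "f \<in> L2 M \<Longrightarrow> (\<lambda>x. f x / c) \<in> L2 M"
  using L2_mult[of f M "1/c"] by simp

lemma L2_mult_integrable:
  assumes "f \<in> L2 M" "g \<in> L2 M"
  shows "integrable M (\<lambda>x. f x * g x)"
proof (rule Bochner_Integration.integrable_bound)
  show "integrable M (\<lambda>x. (f x)\<^sup>2 + (g x)\<^sup>2)"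
    using assms by (auto simp: L2_def)
  have "\<bar>f x * g x\<bar> \<le> (f x)\<^sup>2 + (g x)\<^sup>2" for x
    using sum_squares_bound[of "f x" "g x"] sum_squares_bound[of "f x" "- g x"]
      zero_le_power2[of "f x"] zero_le_power2[of "g x"] by (simp add: abs_if)
  then show "AE x in M. norm (f x * g x) \<le> norm ((f x)\<^sup>2 + (g x)\<^sup>2)"
    by simp
qed (use assms in \<open>simp add: L2_measurable\<close>)

lemma L2_add [intro, simp]:
  assumes "f \<in> L2 M" "g \<in> L2 M" shows "(\<lambda>x. f x + g x) \<in> L2 M"
  using assms L2_mult_integrable[OF assms] by (auto simp: L2_def power2_sum mult.assoc)

lemma L2_diff [intro, simp]:
  assumes "f \<in> L2 M" "g \<in> L2 M" shows "(\<lambda>x. f x - g x) \<in> L2 M"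
  using L2_add[OF assms(1) L2_uminus[OF assms(2)]] by simp

lemma L2_min [intro, simp]:
  assumes "f \<in> L2 M" "g \<in> L2 M" shows "(\<lambda>x. min (f x) (g x)) \<in> L2 M"
proof -
  have "(\<lambda>x. min (f x) (g x)) = (\<lambda>x. (f x + g x - \<bar>f x - g x\<bar>) / 2)"
    by (auto simp: min_def)
  with assms show ?thesis by simp
qed

lemma L2_max [intro, simp]:
  assumes "f \<in> L2 M" "g \<in> L2 M" shows "(\<lambda>x. max (f x) (g x)) \<in> L2 M"
proof -
  have "(\<lambda>x. max (f x) (g x)) = (\<lambda>x. (f x + g x + \<bar>f x - g x\<bar>) / 2)"
    by (auto simp: max_def)
  with assms show ?thesis by simp
qed

lemma L2_sum [intro]: "(\<And>i. i \<in> I \<Longrightarrow> f i \<in> L2 M) \<Longrightarrow> (\<lambda>x. \<Sum>i\<in>I. f i x) \<in> L2 M"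
  by (induction I rule: infinite_finite_induct) auto

section \<open>Inner product, norm and convergence in \<open>L2\<close>\<close>

lemma L2_inner_add_left:
  "f \<in> L2 M \<Longrightarrow> g \<in> L2 M \<Longrightarrow> h \<in> L2 M \<Longrightarrow>
    L2_inner M (\<lambda>x. f x + g x) h = L2_inner M f h + L2_inner M g h"
  by (simp add: L2_inner_def distrib_right L2_mult_integrable)

lemma L2_inner_diff_left:
  "f \<in> L2 M \<Longrightarrow> g \<in> L2 M \<Longrightarrow> h \<in> L2 M \<Longrightarrow>
    L2_inner M (\<lambda>x. f x - g x) h = L2_inner M f h - L2_inner M g h"
  by (simp add: L2_inner_def left_diff_distrib L2_mult_integrable)

lemma L2_inner_commute: "L2_inner M f g = L2_inner M g f"
  by (simp add: L2_inner_def mult.commute)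

lemma L2_inner_add_right:
  "f \<in> L2 M \<Longrightarrow> g \<in> L2 M \<Longrightarrow> h \<in> L2 M \<Longrightarrow>
    L2_inner M h (\<lambda>x. f x + g x) = L2_inner M h f + L2_inner M h g"
  by (simp add: L2_inner_add_left L2_inner_commute[of M h])

lemma L2_inner_diff_right:
  "f \<in> L2 M \<Longrightarrow> g \<in> L2 M \<Longrightarrow> h \<in> L2 M \<Longrightarrow>
    L2_inner M h (\<lambda>x. f x - g x) = L2_inner M h f - L2_inner M h g"
  by (simp add: L2_inner_diff_left L2_inner_commute[of M h])

lemma L2_inner_mult_left [simp]: "L2_inner M (\<lambda>x. c * f x) g = c * L2_inner M f g"
  by (simp add: L2_inner_def mult.assoc)

lemma L2_inner_mult_right [simp]: "L2_inner M f (\<lambda>x. c * g x) = c * L2_inner M f g"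
  by (simp add: L2_inner_commute[of M f])

lemma L2_inner_divide_left [simp]: "L2_inner M (\<lambda>x. f x / c) g = L2_inner M f g / c"
  using L2_inner_mult_left[of M "1/c" f g] by simp

lemma L2_inner_divide_right [simp]: "L2_inner M f (\<lambda>x. g x / c) = L2_inner M f g / c"
  using L2_inner_mult_right[of M f "1/c" g] by simp

lemma L2_inner_zero_left [simp]: "L2_inner M (\<lambda>x. 0) g = 0"
  by (simp add: L2_inner_def)

lemma L2_inner_zero_right [simp]: "L2_inner M g (\<lambda>x. 0) = 0"
  by (simp add: L2_inner_def)

lemmas L2_inner_simps = L2_inner_add_left L2_inner_add_right L2_inner_diff_left L2_inner_diff_right

lemma L2_inner_cong_AE:
  assumes "f \<in> borel_measurable M" "f' \<in> borel_measurable M"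
    "g \<in> borel_measurable M" "g' \<in> borel_measurable M"
    "AE x in M. f x = f' x" "AE x in M. g x = g' x"
  shows "L2_inner M f g = L2_inner M f' g'"
  unfolding L2_inner_def using assms by (intro integral_cong_AE) auto

lemma L2_inner_nonneg:
  "(AE x in M. 0 \<le> f x) \<Longrightarrow> (AE x in M. 0 \<le> g x) \<Longrightarrow> 0 \<le> L2_inner M f g"
  unfolding L2_inner_def by (intro integral_nonneg_AE) auto

lemma L2_inner_mono:
  assumes "f \<in> L2 M" "f' \<in> L2 M" "g \<in> L2 M" "AE x in M. f x \<le> f' x" "AE x in M. 0 \<le> g x"
  shows "L2_inner M f g \<le> L2_inner M f' g"
proof -
  have "0 \<le> L2_inner M (\<lambda>x. f' x - f x) g"
    using assms by (intro L2_inner_nonneg) auto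
  with assms show ?thesis by (simp add: L2_inner_diff_left)
qed

lemma L2_inner_self_nonneg [simp]: "0 \<le> L2_inner M f f"
  by (simp add: L2_inner_def)

lemma L2_norm_nonneg [simp]: "0 \<le> L2_norm M f"
  by (simp add: L2_norm_def)

lemma L2_norm_sq: "(L2_norm M f)\<^sup>2 = L2_inner M f f"
  by (simp add: L2_norm_def)

lemma L2_norm_cong_AE:
  assumes "f \<in> borel_measurable M" "g \<in> borel_measurable M" "AE x in M. f x = g x"
  shows "L2_norm M f = L2_norm M g"
  unfolding L2_norm_def using L2_inner_cong_AE[of f M g f g] assms by simp

lemma L2_norm_mult: "L2_norm M (\<lambda>x. c * f x) = \<bar>c\<bar> * L2_norm M f"
  by (simp add: L2_norm_def real_sqrt_mult mult.assoc[symmetric])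

lemma L2_norm_divide: "L2_norm M (\<lambda>x. f x / c) = L2_norm M f / \<bar>c\<bar>"
  using L2_norm_mult[of M "1/c" f] by simp

lemma L2_norm_uminus [simp]: "L2_norm M (\<lambda>x. - f x) = L2_norm M f"
  by (simp add: L2_norm_def L2_inner_def)

lemma L2_norm_minus_commute: "L2_norm M (\<lambda>x. f x - g x) = L2_norm M (\<lambda>x. g x - f x)"
  using L2_norm_uminus[of M "\<lambda>x. f x - g x"] by simp

lemma L2_norm_zero [simp]: "L2_norm M (\<lambda>x. 0) = 0"
  by (simp add: L2_norm_def)

lemma L2_norm_abs [simp]: "L2_norm M (\<lambda>x. \<bar>f x\<bar>) = L2_norm M f"
  by (simp add: L2_norm_def L2_inner_def)

lemma L2_norm_eq_0_iff:
  assumes "f \<in> L2 M" shows "L2_norm M f = 0 \<longleftrightarrow> (AE x in M. f x = 0)"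
  using integral_nonneg_eq_0_iff_AE[of M "\<lambda>x. f x * f x"] L2_mult_integrable[OF assms assms]
  by (simp add: L2_norm_def L2_inner_def)

lemma L2_norm_mono:
  assumes "f \<in> borel_measurable M" "g \<in> L2 M" "AE x in M. \<bar>f x\<bar> \<le> \<bar>g x\<bar>"
  shows "L2_norm M f \<le> L2_norm M g"
proof -
  have f: "f \<in> L2 M" using L2_dominated assms by blast
  have "L2_inner M f f \<le> L2_inner M g g"
    unfolding L2_inner_def using L2_mult_integrable[OF f f] L2_mult_integrable[OF assms(2,2)]
  proof (rule integral_mono_AE)
    show "AE x in M. f x * f x \<le> g x * g x"
      using assms(3) by eventually_elim (metis abs_le_square_iff power2_eq_square)
  qed
  then show ?thesis by (simp add: L2_norm_def)
qed

lemma L2_Cauchy_Schwarz: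
  assumes f: "f \<in> L2 M" and g: "g \<in> L2 M"
  shows "\<bar>L2_inner M f g\<bar> \<le> L2_norm M f * L2_norm M g"
proof (cases "L2_norm M g = 0")
  case True
  then have "AE x in M. g x = 0" using g L2_norm_eq_0_iff by blast
  then have "L2_inner M f g = L2_inner M f (\<lambda>x. 0)"
    using f g by (intro L2_inner_cong_AE) (auto simp: L2_measurable)
  with True show ?thesis by simp
next
  case False
  define c where "c = L2_inner M f g / L2_inner M g g"
  have pos: "L2_inner M g g > 0"
    using False L2_inner_self_nonneg[of M g] by (simp add: L2_norm_def order_less_le)
  have "0 \<le> L2_inner M (\<lambda>x. f x - c * g x) (\<lambda>x. f x - c * g x)" by simp
  also have "\<dots> = L2_inner M f f - 2 * c * L2_inner M f g + c * c * L2_inner M g g"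
    using f g by (simp add: L2_inner_simps L2_inner_commute[of M g f] algebra_simps)
  also have "\<dots> = L2_inner M f f - (L2_inner M f g)\<^sup>2 / L2_inner M g g"
    using pos by (simp add: c_def field_simps power2_eq_square)
  finally have "(L2_inner M f g)\<^sup>2 \<le> L2_inner M f f * L2_inner M g g"
    using pos by (simp add: field_simps)
  also have "\<dots> = (L2_norm M f * L2_norm M g)\<^sup>2"
    by (simp add: power_mult_distrib L2_norm_sq)
  finally show ?thesis
    by (simp add: abs_le_square_iff[symmetric] abs_mult)
qed

lemma L2_norm_add_le:
  assumes f: "f \<in> L2 M" and g: "g \<in> L2 M"
  shows "L2_norm M (\<lambda>x. f x + g x) \<le> L2_norm M f + L2_norm M g"
proof (rule power2_le_imp_le)
  show "(L2_norm M (\<lambda>x. f x + g x))\<^sup>2 \<le> (L2_norm M f + L2_norm M g)\<^sup>2"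
    using f g L2_Cauchy_Schwarz[OF f g]
    by (simp add: L2_norm_sq power2_sum L2_inner_simps L2_inner_commute[of M g f])
qed simp

lemma L2_norm_diff_le:
  assumes f: "f \<in> L2 M" and g: "g \<in> L2 M"
  shows "L2_norm M (\<lambda>x. f x - g x) \<le> L2_norm M f + L2_norm M g"
  using L2_norm_add_le[OF f L2_uminus[OF g]] by simp

lemma L2_norm_triangle_sub:
  assumes "f \<in> L2 M" "g \<in> L2 M" "h \<in> L2 M"
  shows "L2_norm M (\<lambda>x. f x - h x) \<le> L2_norm M (\<lambda>x. f x - g x) + L2_norm M (\<lambda>x. g x - h x)"
  using L2_norm_add_le[of "\<lambda>x. f x - g x" M "\<lambda>x. g x - h x"] assms by simp

lemma L2_norm_diff_abs_le:
  assumes "f \<in> L2 M" "g \<in> L2 M"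
  shows "\<bar>L2_norm M f - L2_norm M g\<bar> \<le> L2_norm M (\<lambda>x. f x - g x)"
  using L2_norm_triangle_sub[of f M g "\<lambda>x. 0"] L2_norm_triangle_sub[of g M f "\<lambda>x. 0"] assms
    L2_norm_minus_commute[of M f g] by auto

lemma L2_norm_sum_le:
  assumes "\<And>i. i \<in> I \<Longrightarrow> f i \<in> L2 M"
  shows "L2_norm M (\<lambda>x. \<Sum>i\<in>I. f i x) \<le> (\<Sum>i\<in>I. L2_norm M (f i))"
  using assms
proof (induction I rule: infinite_finite_induct)
  case (insert i I)
  have "L2_norm M (\<lambda>x. f i x + (\<Sum>i\<in>I. f i x)) \<le> L2_norm M (f i) + L2_norm M (\<lambda>x. \<Sum>i\<in>I. f i x)"
    using insert.prems by (intro L2_norm_add_le L2_sum) auto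
  with insert show ?case by fastforce
qed auto

lemma tendsto_L2_norm:
  assumes "f \<in> L2 M" "\<And>n. F n \<in> L2 M" "((\<lambda>n. L2_norm M (\<lambda>x. F n x - f x)) \<longlongrightarrow> 0) X"
  shows "((\<lambda>n. L2_norm M (F n)) \<longlongrightarrow> L2_norm M f) X"
proof (rule LIM_zero_cancel, rule Lim_null_comparison[OF _ assms(3)])
  show "\<forall>\<^sub>F n in X. norm (L2_norm M (F n) - L2_norm M f) \<le> L2_norm M (\<lambda>x. F n x - f x)"
    using L2_norm_diff_abs_le[OF assms(2,1)] by simp
qed

lemma tendsto_L2_inner:
  assumes "f \<in> L2 M" "g \<in> L2 M" "\<And>n. F n \<in> L2 M"
    and "((\<lambda>n. L2_norm M (\<lambda>x. F n x - f x)) \<longlongrightarrow> 0) X"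
  shows "((\<lambda>n. L2_inner M (F n) g) \<longlongrightarrow> L2_inner M f g) X"
proof (rule LIM_zero_cancel, rule Lim_null_comparison)
  show "((\<lambda>n. L2_norm M (\<lambda>x. F n x - f x) * L2_norm M g) \<longlongrightarrow> 0) X"
    using tendsto_mult_right[OF assms(4)] by simp
  show "\<forall>\<^sub>F n in X. norm (L2_inner M (F n) g - L2_inner M f g)
      \<le> L2_norm M (\<lambda>x. F n x - f x) * L2_norm M g"
    using assms(1-3) by (auto intro!: always_eventually L2_Cauchy_Schwarz simp flip: L2_inner_diff_left)
qed

lemma L2_limit_nonneg:
  assumes "f \<in> L2 M" "\<And>n. F n \<in> L2 M" "\<And>n. AE x in M. 0 \<le> F n x"
    and "(\<lambda>n. L2_norm M (\<lambda>x. F n x - f x)) \<longlonglongrightarrow> 0"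
  shows "AE x in M. 0 \<le> f x"
proof -
  \<comment> \<open>Where \<open>F n x \<ge> 0\<close>, the negative part of \<open>f\<close> is at
    most the distance from \<open>F n x\<close> to \<open>f x\<close>.\<close>
  have "L2_norm M (\<lambda>x. min (f x) 0) \<le> L2_norm M (\<lambda>x. F n x - f x)" for n
    using assms(3)[of n] by (intro L2_norm_mono) (use assms(1,2) in \<open>auto simp: L2_measurable elim!: eventually_mono\<close>)
  then have "L2_norm M (\<lambda>x. min (f x) 0) \<le> 0"
    using assms(4) by (meson LIMSEQ_le_const)
  then have "AE x in M. min (f x) 0 = 0"
    using L2_norm_eq_0_iff[of "\<lambda>x. min (f x) 0" M] assms(1) L2_norm_nonneg[of M "\<lambda>x. min (f x) 0"] by simp
  then show ?thesis by eventually_elim (simp add: min_def split: if_splits)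
qed

lemma L2_norm_sq_integral: "(L2_norm M f)\<^sup>2 = (\<integral>x. (f x)\<^sup>2 \<partial>M)"
  unfolding L2_norm_sq by (simp add: L2_inner_def power2_eq_square)

section \<open>Finite measures: completeness and Riesz representation\<close>

lemma (in finite_measure) L2_const [simp]: "(\<lambda>x. c) \<in> L2 M"
  by (simp add: L2_def)

lemma (in finite_measure) L2_integrable: "f \<in> L2 M \<Longrightarrow> integrable M f"
  using L2_mult_integrable[of f M "\<lambda>x. 1"] by simp

lemma (in finite_measure) L2_integral_abs_le:
  assumes "f \<in> L2 M"
  shows "(\<integral>x. \<bar>f x\<bar> \<partial>M) \<le> L2_norm M f * L2_norm M (\<lambda>x. 1)"
  using L2_Cauchy_Schwarz[OF L2_abs[OF assms] L2_const[of 1]] by (simp add: L2_inner_def)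

lemma (in finite_measure) L2_norm_bounded_le:
  assumes "f \<in> borel_measurable M" "AE x in M. \<bar>f x\<bar> \<le> c" "0 \<le> c"
  shows "f \<in> L2 M" "L2_norm M f \<le> c * L2_norm M (\<lambda>x. 1)"
proof -
  have le: "AE x in M. \<bar>f x\<bar> \<le> \<bar>c\<bar>" using assms(2,3) by simp
  show "f \<in> L2 M" by (rule L2_dominated[OF L2_const assms(1) le])
  have "L2_norm M f \<le> L2_norm M (\<lambda>x. c)" by (rule L2_norm_mono[OF assms(1) L2_const le])
  also have "\<dots> = c * L2_norm M (\<lambda>x. 1)" using L2_norm_mult[of M c "\<lambda>x. 1"] assms(3) by simp
  finally show "L2_norm M f \<le> c * L2_norm M (\<lambda>x. 1)" .
qed

text \<open>On a finite measure space an \<open>L2\<close>-Cauchy sequence is Cauchy in the mean,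
  which yields a subsequence converging almost everywhere. Fatou's lemma along this subsequence
  bounds the \<open>L2\<close> distance of its limit from the whole sequence.\<close>

theorem (in finite_measure) L2_complete:
  assumes F: "\<And>n. F n \<in> L2 M"
    and Cauchy: "\<And>e. e > 0 \<Longrightarrow> \<exists>N. \<forall>m\<ge>N. \<forall>n\<ge>N. L2_norm M (\<lambda>x. F m x - F n x) < e"
  obtains f where "f \<in> L2 M" "(\<lambda>n. L2_norm M (\<lambda>x. F n x - f x)) \<longlonglongrightarrow> 0"
proof -
  \<comment> \<open>The summand 1 makes \<open>K\<close> positive, so that \<open>e / K\<close> is a
    legitimate tolerance.\<close>
  define K where "K = L2_norm M (\<lambda>x. 1) + 1"
  have K: "K > 0" "L2_norm M (\<lambda>x. 1) \<le> K"
    using L2_norm_nonneg[of M "\<lambda>x. 1"] by (auto simp: K_def intro: add_nonneg_pos)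
  have [measurable]: "F n \<in> borel_measurable M" for n using F by (rule L2_measurable)
  have "\<exists>N. \<forall>i\<ge>N. \<forall>j\<ge>N. (\<integral>x. norm (F i x - F j x) \<partial>M) < e" if "e > 0" for e
  proof -
    obtain N where N: "\<forall>i\<ge>N. \<forall>j\<ge>N. L2_norm M (\<lambda>x. F i x - F j x) < e / K"
      using Cauchy[of "e / K"] \<open>K > 0\<close> \<open>e > 0\<close> by auto
    have "(\<integral>x. norm (F i x - F j x) \<partial>M) < e" if "i \<ge> N" "j \<ge> N" for i j
    proof -
      have "(\<integral>x. \<bar>F i x - F j x\<bar> \<partial>M) \<le> L2_norm M (\<lambda>x. F i x - F j x) * K"
        using L2_integral_abs_le[OF L2_diff[OF F F], of i j] K
        by (meson L2_norm_nonneg mult_left_mono order_trans)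
      also have "\<dots> < e" using N that \<open>K > 0\<close> by (simp add: field_simps)
      finally show ?thesis by simp
    qed
    then show ?thesis by blast
  qed
  from cauchy_L1_AE_cauchy_subseq[OF L2_integrable[OF F] this]
  obtain r where r: "strict_mono r" "AE x in M. Cauchy (\<lambda>i. F (r i) x)" by blast
  define f where "f x = lim (\<lambda>i. F (r i) x)" for x
  have [measurable]: "f \<in> borel_measurable M" unfolding f_def by measurable
  have lim: "AE x in M. (\<lambda>i. F (r i) x) \<longlonglongrightarrow> f x"
    using r(2) by eventually_elim (simp add: f_def Cauchy_convergent_iff flip: convergent_LIMSEQ_iff)
  have *: "(\<lambda>x. F n x - f x) \<in> L2 M \<and> L2_norm M (\<lambda>x. F n x - f x) \<le> e"
    if "e > 0" and N: "\<forall>i\<ge>N. \<forall>j\<ge>N. L2_norm M (\<lambda>x. F i x - F j x) < e" "n \<ge> N" for e N n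
  proof -
    have le: "(\<integral>\<^sup>+x. ennreal ((F n x - F (r i) x)\<^sup>2) \<partial>M) \<le> ennreal (e\<^sup>2)" if "i \<ge> N" for i
    proof -
      have "r i \<ge> N" using that seq_suble[OF r(1), of i] by simp
      then have "L2_norm M (\<lambda>x. F n x - F (r i) x) \<le> e" using N by (simp add: less_imp_le)
      then have "(L2_norm M (\<lambda>x. F n x - F (r i) x))\<^sup>2 \<le> e\<^sup>2" by (intro power_mono) auto
      then show ?thesis
        by (subst nn_integral_eq_integral[OF L2_square_integrable[OF L2_diff[OF F F]]])
           (auto simp: L2_norm_sq_integral intro!: ennreal_leI)
    qed
    have "(\<integral>\<^sup>+x. ennreal ((F n x - f x)\<^sup>2) \<partial>M)
        = (\<integral>\<^sup>+x. liminf (\<lambda>i. ennreal ((F n x - F (r i) x)\<^sup>2)) \<partial>M)"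
    proof (rule nn_integral_cong_AE, use lim in eventually_elim)
      case (elim x)
      then have "(\<lambda>i. ennreal ((F n x - F (r i) x)\<^sup>2)) \<longlonglongrightarrow> ennreal ((F n x - f x)\<^sup>2)"
        by (intro tendsto_ennrealI tendsto_intros)
      then show ?case by (rule lim_imp_Liminf[OF sequentially_bot, symmetric])
    qed
    also have "\<dots> \<le> liminf (\<lambda>i. \<integral>\<^sup>+x. ennreal ((F n x - F (r i) x)\<^sup>2) \<partial>M)"
      by (intro nn_integral_liminf) measurable
    also have "\<dots> \<le> ennreal (e\<^sup>2)"
      using le by (intro Liminf_le) (auto simp: eventually_sequentially)
    finally have fin: "(\<integral>\<^sup>+x. ennreal ((F n x - f x)\<^sup>2) \<partial>M) \<le> ennreal (e\<^sup>2)" .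
    have int: "integrable M (\<lambda>x. (F n x - f x)\<^sup>2)"
      using fin by (intro integrableI_nonneg) (auto simp: le_less_trans)
    have "(\<integral>x. (F n x - f x)\<^sup>2 \<partial>M) \<le> e\<^sup>2"
      using fin unfolding nn_integral_eq_integral[OF int AE_I2[OF zero_le_power2]]
      by (subst (asm) ennreal_le_iff) auto
    then have "(L2_norm M (\<lambda>x. F n x - f x))\<^sup>2 \<le> e\<^sup>2"
      unfolding L2_norm_sq_integral .
    then have "L2_norm M (\<lambda>x. F n x - f x) \<le> e"
      by (rule power2_le_imp_le) (use that(1) in simp)
    with int show ?thesis by (simp add: L2_def)
  qed
  have "f \<in> L2 M"
  proof -
    obtain N where "\<forall>i\<ge>N. \<forall>j\<ge>N. L2_norm M (\<lambda>x. F i x - F j x) < 1"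
      using Cauchy[of 1] by auto
    then have "(\<lambda>x. F N x - f x) \<in> L2 M" using *[of 1 N N] by auto
    then have "(\<lambda>x. F N x - (F N x - f x)) \<in> L2 M" by (rule L2_diff[OF F])
    then show ?thesis by simp
  qed
  moreover have "(\<lambda>n. L2_norm M (\<lambda>x. F n x - f x)) \<longlonglongrightarrow> 0"
  proof (rule LIMSEQ_I)
    fix e :: real assume "e > 0"
    then obtain N where "\<forall>i\<ge>N. \<forall>j\<ge>N. L2_norm M (\<lambda>x. F i x - F j x) < e / 2"
      using Cauchy[of "e / 2"] by auto
    then have "L2_norm M (\<lambda>x. F n x - f x) \<le> e / 2" if "n \<ge> N" for n
      using *[of "e / 2" N n] \<open>e > 0\<close> that by auto
    then show "\<exists>N. \<forall>n\<ge>N. norm (L2_norm M (\<lambda>x. F n x - f x) - 0) < e"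
      using \<open>e > 0\<close> by (intro exI[of _ N]) (force intro: le_less_trans)
  qed
  ultimately show thesis by (rule that)
qed

text \<open>\<open>G\<close> is the graph of a bounded functional on a subspace, closed or not; the
  bound forces it to be single-valued. The graph form suits functionals on the range of an operator,
  where the value is known only through a preimage. The representer is the limit of a minimising
  sequence.\<close>

theorem (in finite_measure) L2_Riesz_representation:
  assumes zero: "((\<lambda>x. 0), 0) \<in> G"
    and sub: "\<And>v c. (v, c) \<in> G \<Longrightarrow> v \<in> L2 M"
    and lin: "\<And>v c w d a b. (v, c) \<in> G \<Longrightarrow> (w, d) \<in> G \<Longrightarrow> ((\<lambda>x. a * v x + b * w x), a * c + b * d) \<in> G"
    and bound: "\<And>v c. (v, c) \<in> G \<Longrightarrow> \<bar>c\<bar> \<le> C * L2_norm M v"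
  obtains w where "w \<in> L2 M" "\<And>v c. (v, c) \<in> G \<Longrightarrow> L2_inner M w v = c"
proof -
  \<comment> \<open>For a representer \<open>w\<close> this is the squared distance from
    \<open>v\<close> to \<open>w\<close> minus the squared norm of \<open>w\<close>, so minimising
    it drives \<open>v\<close> towards \<open>w\<close>.\<close>
  define J where "J = (\<lambda>(v, c). L2_inner M v v - 2 * c)"
  have J_ge: "- C\<^sup>2 \<le> J p" if "p \<in> G" for p
  proof (cases p)
    case (Pair v c)
    have "\<bar>c\<bar> \<le> C * L2_norm M v" using bound that Pair by simp
    moreover have "0 \<le> (L2_norm M v - C)\<^sup>2" by simp
    ultimately show ?thesis
      by (simp add: J_def Pair power2_diff L2_norm_sq algebra_simps abs_le_iff)
  qed
  define I where "I = (INF p\<in>G. J p)"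
  have bdd: "bdd_below (J ` G)" using J_ge by (intro bdd_belowI2)
  have I_le: "I \<le> J p" if "p \<in> G" for p
    unfolding I_def by (rule cINF_lower[OF bdd that])
  have "\<exists>p. p \<in> G \<and> J p < I + 1 / real (Suc n)" for n
  proof (rule ccontr)
    assume "\<not> ?thesis"
    then have "I + 1 / real (Suc n) \<le> J p" if "p \<in> G" for p using that by (meson not_less)
    then have "I + 1 / real (Suc n) \<le> I"
      using zero unfolding I_def by (intro cINF_greatest) auto
    then show False by (simp add: field_simps)
  qed
  then obtain p where p: "\<And>n. p n \<in> G" "\<And>n. J (p n) < I + 1 / real (Suc n)" by metis
  define v c where "v n = fst (p n)" and "c n = snd (p n)" for n
  have vc: "(v n, c n) \<in> G" for n using p by (simp add: v_def c_def)
  have Jvc: "J (v n, c n) < I + 1 / real (Suc n)" for n using p by (simp add: v_def c_def)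
  have vL: "v n \<in> L2 M" for n using vc sub by blast
  \<comment> \<open>Parallelogram identity: the midpoint of two near-minimisers also has value at
    least \<open>I\<close>, which leaves little room between them.\<close>
  have close: "L2_inner M (\<lambda>x. v m x - v n x) (\<lambda>x. v m x - v n x) \<le> 2 / real (Suc m) + 2 / real (Suc n)" for m n
  proof -
    have "((\<lambda>x. (1/2) * v m x + (1/2) * v n x), (1/2) * c m + (1/2) * c n) \<in> G"
      by (rule lin[OF vc vc])
    from I_le[OF this] obtain j where "I \<le> j"
      and j: "j = J (\<lambda>x. (1/2) * v m x + (1/2) * v n x, (1/2) * c m + (1/2) * c n)" by blast
    note this(1)
    moreover have "4 * j = L2_inner M (v m) (v m) + 2 * L2_inner M (v m) (v n)
        + L2_inner M (v n) (v n) - 4 * c m - 4 * c n"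
      using vL[of m] vL[of n] unfolding j
      by (simp add: J_def L2_inner_add_left L2_inner_add_right L2_inner_commute[of M "v n" "v m"] add_divide_distrib)
    moreover have "L2_inner M (\<lambda>x. v m x - v n x) (\<lambda>x. v m x - v n x)
        = L2_inner M (v m) (v m) - 2 * L2_inner M (v m) (v n) + L2_inner M (v n) (v n)"
      using vL[of m] vL[of n]
      by (simp add: L2_inner_diff_left L2_inner_diff_right L2_inner_commute[of M "v n" "v m"] add_divide_distrib)
    moreover have "2 / real (Suc k) = 2 * (1 / real (Suc k))" for k by simp
    ultimately show ?thesis
      using Jvc[of m] Jvc[of n] unfolding J_def by (simp only: prod.case)
  qed
  have Cauchy: "\<exists>N. \<forall>m\<ge>N. \<forall>n\<ge>N. L2_norm M (\<lambda>x. v m x - v n x) < e" if "e > 0" for e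
  proof -
    obtain N where N: "4 / e\<^sup>2 < real N" using reals_Archimedean2 by blast
    then have "0 < real N" using \<open>e > 0\<close> by (meson divide_nonneg_pos le_less_trans zero_le_numeral zero_less_power)
    have "L2_norm M (\<lambda>x. v m x - v n x) < e" if "m \<ge> N" "n \<ge> N" for m n
    proof (rule power2_less_imp_less)
      have "(L2_norm M (\<lambda>x. v m x - v n x))\<^sup>2 \<le> 2 / real (Suc m) + 2 / real (Suc n)"
        using close by (simp add: L2_norm_sq)
      also have "\<dots> \<le> 2 / real N + 2 / real N"
        using that \<open>0 < real N\<close> by (intro add_mono divide_left_mono) auto
      also have "\<dots> < e\<^sup>2" using N \<open>e > 0\<close> \<open>0 < real N\<close> by (simp add: field_simps)
      finally show "(L2_norm M (\<lambda>x. v m x - v n x))\<^sup>2 < e\<^sup>2" .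
    qed (use \<open>e > 0\<close> in simp)
    then show ?thesis by blast
  qed
  from L2_complete[OF vL Cauchy] obtain w
    where w: "w \<in> L2 M" "(\<lambda>n. L2_norm M (\<lambda>x. v n x - w x)) \<longlonglongrightarrow> 0" by blast
  have "L2_inner M w u = d" if ud: "(u, d) \<in> G" for u d
  proof -
    have uL: "u \<in> L2 M" using ud sub by blast
    define q where "q = L2_inner M u u"
    have "q \<ge> 0" by (simp add: q_def)
    \<comment> \<open>First variation: shifting the near-minimiser by \<open>s\<close> times
      \<open>(u, d)\<close> cannot bring \<open>J\<close> below \<open>I\<close>, and the defect
      \<open>1 / Suc n\<close> vanishes in the limit.\<close>
    have ineq: "0 \<le> 2 * s * (L2_inner M w u - d) + s * s * q" for s
    proof (rule LIMSEQ_le_const)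
      show "(\<lambda>n. 1 / real (Suc n) + (2 * s * (L2_inner M (v n) u - d) + s * s * q))
          \<longlonglongrightarrow> 2 * s * (L2_inner M w u - d) + s * s * q"
        using tendsto_add[OF LIMSEQ_Suc[OF lim_1_over_n]
            tendsto_add[OF tendsto_mult_left[OF tendsto_diff[OF tendsto_L2_inner[OF w(1) uL vL w(2)] tendsto_const]] tendsto_const]]
        by simp
      have "0 \<le> 1 / real (Suc n) + (2 * s * (L2_inner M (v n) u - d) + s * s * q)" for n
      proof -
        have "((\<lambda>x. 1 * v n x + s * u x), 1 * c n + s * d) \<in> G"
          by (rule lin[OF vc ud])
        from I_le[OF this] have "I \<le> J (v n, c n) + (2 * s * (L2_inner M (v n) u - d) + s * s * q)"
          using uL vL[of n] by (simp add: J_def L2_inner_add_left L2_inner_add_right q_def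
              L2_inner_commute[of M u "v n"] algebra_simps)
        then show ?thesis using Jvc[of n] by linarith
      qed
      then show "\<exists>N. \<forall>n\<ge>N. 0 \<le> 1 / real (Suc n) + (2 * s * (L2_inner M (v n) u - d) + s * s * q)" by blast
    qed
    define z where "z = L2_inner M w u - d"
    \<comment> \<open>The choice \<open>s = - z / (q + 1)\<close> is a near-optimal shift; the 1 in
      the denominator also covers \<open>q = 0\<close>.\<close>
    have "0 \<le> 2 * (- z / (q + 1)) * z + (- z / (q + 1)) * (- z / (q + 1)) * q"
      using ineq unfolding z_def by blast
    also have "\<dots> = - (z\<^sup>2 * (q + 2)) / (q + 1)\<^sup>2"
      using \<open>q \<ge> 0\<close> by (simp add: field_simps power2_eq_square add_nonneg_eq_0_iff)
    finally have "z\<^sup>2 * (q + 2) \<le> 0"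
      using \<open>q \<ge> 0\<close> by (simp add: field_simps zero_le_divide_iff)
    then have "z = 0" using \<open>q \<ge> 0\<close> by (simp add: mult_le_0_iff)
    then show ?thesis by (simp add: z_def)
  qed
  with w(1) show thesis using that by blast
qed

section \<open>Uniform boundedness for positive functionals\<close>

text \<open>A gliding hump: if the bound fails, the sum of suitably scaled nonnegative functions is a
  single nonnegative function on which the family is unbounded.\<close>

theorem (in finite_measure) L2_positive_uniform_bound:
  fixes p :: "'i \<Rightarrow> ('a \<Rightarrow> real) \<Rightarrow> real"
  assumes mono: "\<And>i f g. f \<in> L2 M \<Longrightarrow> g \<in> L2 M \<Longrightarrow> (AE x in M. 0 \<le> f x) \<Longrightarrow> (AE x in M. f x \<le> g x) \<Longrightarrow> p i f \<le> p i g"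
    and scale: "\<And>i f c. f \<in> L2 M \<Longrightarrow> 0 < c \<Longrightarrow> p i (\<lambda>x. c * f x) = c * p i f"
    and bounded: "\<And>f. f \<in> L2 M \<Longrightarrow> (AE x in M. 0 \<le> f x) \<Longrightarrow> \<exists>B. \<forall>i. p i f \<le> B"
  obtains C where "0 \<le> C" "\<And>i f. f \<in> L2 M \<Longrightarrow> (AE x in M. 0 \<le> f x) \<Longrightarrow> p i f \<le> C * L2_norm M f"
proof -
  have "\<exists>C\<ge>0. \<forall>i. \<forall>f\<in>L2 M. (AE x in M. 0 \<le> f x) \<longrightarrow> p i f \<le> C * L2_norm M f"
  proof (rule ccontr)
    assume contra: "\<not> ?thesis"
    have "\<exists>i f. f \<in> L2 M \<and> (AE x in M. 0 \<le> f x) \<and> L2_norm M f \<le> (1/2) ^ n \<and> 2 ^ n \<le> p i f" for n :: nat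
    proof -
      \<comment> \<open>Failure is used with the constant \<open>4 ^ n\<close>, so that after
        scaling the value to \<open>2 ^ n\<close> the norm is still at most \<open>(1/2) ^ n\<close>
        and the humps are summable.\<close>
      obtain i f where f: "f \<in> L2 M" "AE x in M. 0 \<le> f x" "p i f > 4 ^ n * L2_norm M f"
        using contra by (metis not_less zero_le_numeral zero_le_power)
      have "0 \<le> 4 ^ n * L2_norm M f" by simp
      then have pos: "p i f > 0" using f(3) by linarith
      define c where "c = 2 ^ n / p i f"
      have "c > 0" using pos by (simp add: c_def)
      show ?thesis
      proof (intro exI conjI)
        show "(\<lambda>x. c * f x) \<in> L2 M" using f(1) by simp
        show "AE x in M. 0 \<le> c * f x" using f(2) \<open>c > 0\<close> by auto
        have "L2_norm M f < p i f / 4 ^ n" using f(3) by (simp add: field_simps)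
        then have "c * L2_norm M f \<le> c * (p i f / 4 ^ n)" using \<open>c > 0\<close> by (intro mult_left_mono) auto
        also have "\<dots> = 2 ^ n / 4 ^ n" using pos by (simp add: c_def)
        also have "\<dots> = (1/2) ^ n" by (simp flip: power_divide)
        finally show "L2_norm M (\<lambda>x. c * f x) \<le> (1/2) ^ n" using \<open>c > 0\<close> by (simp add: L2_norm_mult)
        show "2 ^ n \<le> p i (\<lambda>x. c * f x)" using scale[OF f(1) \<open>c > 0\<close>] pos by (simp add: c_def)
      qed
    qed
    then obtain i f where f: "\<And>n. f n \<in> L2 M" "\<And>n. AE x in M. 0 \<le> f n x"
        "\<And>n::nat. L2_norm M (f n) \<le> (1/2) ^ n" "\<And>n. 2 ^ n \<le> p (i n) (f n)" by metis
    define s where "s m x = (\<Sum>k<m. f k x)" for m :: nat and x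
    have s: "s m \<in> L2 M" for m
      using L2_sum[of "{..<m}" f M] f(1) unfolding s_def by blast
    have tail: "L2_norm M (\<lambda>x. s n x - s m x) \<le> 2 * (1/2) ^ m" if "m \<le> n" for m n
    proof -
      have "(\<lambda>x. s n x - s m x) = (\<lambda>x. \<Sum>k\<in>{m..<n}. f k x)"
        using that by (auto simp: s_def sum_diff_nat_ivl[of 0 m n, symmetric] atLeast0LessThan)
      then have "L2_norm M (\<lambda>x. s n x - s m x) \<le> (\<Sum>k\<in>{m..<n}. L2_norm M (f k))"
        using L2_norm_sum_le[of "{m..<n}" f M] f(1) by simp
      also have "\<dots> \<le> (\<Sum>k\<in>{m..<n}. (1/2) ^ k)" by (intro sum_mono f(3))
      also have "\<dots> = 2 * (1/2) ^ m - 2 * (1/2) ^ n"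
        using that by (induction n rule: dec_induct) auto
      also have "\<dots> \<le> 2 * (1/2) ^ m" by simp
      finally show ?thesis .
    qed
    have "\<exists>N. \<forall>m\<ge>N. \<forall>n\<ge>N. L2_norm M (\<lambda>x. s m x - s n x) < e" if "e > 0" for e
    proof -
      obtain N where N: "(1/2) ^ N < e / 2" using real_arch_pow_inv[of "e/2" "1/2"] \<open>e > 0\<close> by auto
      have *: "L2_norm M (\<lambda>x. s n x - s m x) < e" if "N \<le> m" "m \<le> n" for m n
      proof -
        have "(1/2::real) ^ m \<le> (1/2) ^ N" using that by (intro power_decreasing) auto
        then show ?thesis using tail[OF that(2)] N by linarith
      qed
      have "L2_norm M (\<lambda>x. s m x - s n x) < e" if "N \<le> m" "N \<le> n" for m n
        using *[of m n] *[of n m] that L2_norm_minus_commute[of M "s n" "s m"] by (cases "m \<le> n") auto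
      then show ?thesis by blast
    qed
    from L2_complete[OF s this] obtain F
      where F: "F \<in> L2 M" "(\<lambda>n. L2_norm M (\<lambda>x. s n x - F x)) \<longlonglongrightarrow> 0" by blast
    \<comment> \<open>Every partial sum beyond index \<open>n\<close> dominates \<open>f n\<close>,
      and nonnegativity of the difference survives the \<open>L2\<close> limit.\<close>
    have ge: "AE x in M. f n x \<le> F x" for n
    proof -
      have "AE x in M. 0 \<le> F x - f n x"
      proof (rule L2_limit_nonneg[where F = "\<lambda>m x. s (m + Suc n) x - f n x"])
        show "AE x in M. 0 \<le> s (m + Suc n) x - f n x" for m
        proof -
          have "AE x in M. \<forall>k. 0 \<le> f k x" using f(2) by (simp add: AE_all_countable)
          then show ?thesis
          proof eventually_elim
            case (elim x)
            have "f n x \<le> (\<Sum>k<m + Suc n. f k x)"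
              using elim by (intro member_le_sum) auto
            then show ?case by (simp add: s_def)
          qed
        qed
        show "(\<lambda>m. L2_norm M (\<lambda>x. s (m + Suc n) x - f n x - (F x - f n x))) \<longlonglongrightarrow> 0"
          using LIMSEQ_ignore_initial_segment[OF F(2), of "Suc n"] by simp
      qed (use F f s in auto)
      then show ?thesis by simp
    qed
    have "AE x in M. 0 \<le> F x" using ge[of 0] f(2)[of 0] by eventually_elim simp
    with bounded F(1) obtain B where B: "\<And>i. p i F \<le> B" by metis
    obtain n where "B < 2 ^ n" using real_arch_pow[of 2 B] by auto
    also have "2 ^ n \<le> p (i n) (f n)" by (rule f(4))
    also have "\<dots> \<le> p (i n) F" by (rule mono[OF f(1) F(1) f(2) ge])
    also have "\<dots> \<le> B" by (rule B)
    finally show False by simp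
  qed
  then show thesis using that by blast
qed

section \<open>Quantitative unique continuation\<close>

fun chebyshev_orbit :: "(('a \<Rightarrow> real) \<Rightarrow> 'a \<Rightarrow> real) \<Rightarrow> ('a \<Rightarrow> real) \<Rightarrow> nat \<Rightarrow> 'a \<Rightarrow> real" where
  "chebyshev_orbit T f 0 = f"
| "chebyshev_orbit T f (Suc 0) = T f"
| "chebyshev_orbit T f (Suc (Suc k)) = (\<lambda>x. 2 * T (chebyshev_orbit T f (Suc k)) x - chebyshev_orbit T f k x)"

text \<open>The Chebyshev orbit is a discrete wave equation, so it has a conserved energy and stays
  bounded. Since the powers of the operator are averages of Chebyshev polynomials over a random
  walk, moments that vanish up to order \<open>N\<close> remain small up to orders well below \<open>N\<^sup>2\<close>.\<close>

theorem L2_moment_bound: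
  fixes T :: "('a \<Rightarrow> real) \<Rightarrow> 'a \<Rightarrow> real"
  assumes T: "\<And>f. f \<in> L2 M \<Longrightarrow> T f \<in> L2 M"
    and sym: "\<And>f g. f \<in> L2 M \<Longrightarrow> g \<in> L2 M \<Longrightarrow> L2_inner M (T f) g = L2_inner M f (T g)"
    and contr: "\<And>f. f \<in> L2 M \<Longrightarrow> L2_norm M (T f) \<le> \<rho> * L2_norm M f" and \<rho>: "0 \<le> \<rho>" "\<rho> < 1"
    and f: "f \<in> L2 M" and g: "g \<in> L2 M"
    and vanish: "\<And>j. j \<le> N \<Longrightarrow> L2_inner M ((T ^^ j) f) g = 0" and N: "N > 0"
  shows "\<bar>L2_inner M ((T ^^ m) f) g\<bar> \<le> L2_norm M f * L2_norm M g / sqrt (1 - \<rho>) * m / (real N)\<^sup>2"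
proof -
  let ?v = "chebyshev_orbit T f"
  have v: "?v k \<in> L2 M" for k
    by (induction k rule: induct_nat_012) (simp_all add: f T)
  have Tpow: "h \<in> L2 M \<Longrightarrow> (T ^^ m) h \<in> L2 M" for h m by (induction m) (auto intro: T)
  have Tpow_sym: "L2_inner M ((T ^^ m) h) h' = L2_inner M h ((T ^^ m) h')"
    if "h \<in> L2 M" "h' \<in> L2 M" for h h' m
    using that(2)
  proof (induction m arbitrary: h')
    case (Suc m)
    have "L2_inner M ((T ^^ Suc m) h) h' = L2_inner M ((T ^^ m) h) (T h')"
      using sym[OF Tpow[OF that(1)] Suc.prems] by simp
    also have "\<dots> = L2_inner M h ((T ^^ m) (T h'))" by (rule Suc.IH[OF T[OF Suc.prems]])
    finally show ?case by (simp only: funpow_Suc_right o_apply)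
  qed simp
  \<comment> \<open>For multiplication by \<open>cos \<theta>\<close> and \<open>f = 1\<close> the
    orbit is \<open>cos (k * \<theta>)\<close> and this expression is the constant
    \<open>(sin \<theta>)\<^sup>2\<close>.\<close>
  define E where "E k = (L2_norm M (?v k))\<^sup>2 + (L2_norm M (?v (Suc k)))\<^sup>2
      - 2 * L2_inner M (T (?v k)) (?v (Suc k))" for k
  have E_Suc: "E (Suc k) = E k" for k
  proof -
    define a b c where "a = ?v k" and "b = ?v (Suc k)" and "c = T b"
    have L: "a \<in> L2 M" "b \<in> L2 M" "c \<in> L2 M" using v T by (auto simp: a_def b_def c_def)
    have "?v (Suc (Suc k)) = (\<lambda>x. 2 * c x - a x)" by (simp add: a_def b_def c_def)
    then have "E (Suc k) = L2_inner M b b + L2_inner M (\<lambda>x. 2 * c x - a x) (\<lambda>x. 2 * c x - a x)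
        - 2 * L2_inner M c (\<lambda>x. 2 * c x - a x)"
      by (simp only: E_def L2_norm_sq flip: b_def c_def)
    also have "\<dots> = L2_inner M b b + L2_inner M a a - 2 * L2_inner M a c"
      using L by (simp add: L2_inner_diff_left L2_inner_diff_right L2_inner_commute[of M c a])
    also have "\<dots> = E k"
      using sym[OF L(1,2)] by (simp only: E_def L2_norm_sq flip: a_def b_def c_def)
    finally show ?thesis .
  qed
  have E_0: "E k \<le> (L2_norm M f)\<^sup>2" for k
  proof -
    have "E k = E 0" by (induction k) (auto simp: E_Suc)
    then show ?thesis by (simp add: E_def L2_norm_sq)
  qed
  \<comment> \<open>The strict contraction makes the energy coercive: the mixed term is at most
    \<open>\<rho>\<close> times the sum of the two squares.\<close>
  have E_ge: "(1 - \<rho>) * (L2_norm M (?v k))\<^sup>2 \<le> E k" for k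
  proof -
    let ?a = "L2_norm M (?v k)" and ?b = "L2_norm M (?v (Suc k))"
    have "L2_inner M (T (?v k)) (?v (Suc k)) \<le> L2_norm M (T (?v k)) * ?b"
      using L2_Cauchy_Schwarz[OF T[OF v[of k]] v[of "Suc k"]] by simp
    also have "\<dots> \<le> \<rho> * ?a * ?b" using contr[OF v] by (intro mult_right_mono) auto
    finally have 1: "L2_inner M (T (?v k)) (?v (Suc k)) \<le> \<rho> * (?a * ?b)" by (simp add: mult.assoc)
    have "\<rho> * (2 * (?a * ?b)) \<le> \<rho> * (?a\<^sup>2 + ?b\<^sup>2)"
      using sum_squares_bound[of ?a ?b] \<rho>(1) by (intro mult_left_mono) (auto simp: mult.assoc)
    moreover have "0 \<le> (1 - \<rho>) * ?b\<^sup>2" using \<rho> by simp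
    ultimately show ?thesis using 1 unfolding E_def by (simp add: algebra_simps)
  qed
  define K where "K = L2_norm M f * L2_norm M g / sqrt (1 - \<rho>)"
  have "K \<ge> 0" using \<rho> by (simp add: K_def)
  have v_bound: "L2_norm M (?v k) \<le> L2_norm M f / sqrt (1 - \<rho>)" for k
  proof (rule power2_le_imp_le)
    show "(L2_norm M (?v k))\<^sup>2 \<le> (L2_norm M f / sqrt (1 - \<rho>))\<^sup>2"
      using E_ge[of k] E_0[of k] \<rho> by (simp add: power_divide field_simps)
  qed (use \<rho> in simp)
  define W where "W m k = L2_inner M ((T ^^ m) (?v k)) g" for m k
  have W_0: "\<bar>W 0 k\<bar> \<le> K" for k
  proof -
    have "\<bar>W 0 k\<bar> \<le> L2_norm M (?v k) * L2_norm M g"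
      using L2_Cauchy_Schwarz[OF v g, of k] by (simp add: W_def)
    also have "\<dots> \<le> K" using v_bound[of k] mult_right_mono[OF v_bound[of k], of "L2_norm M g"]
      by (simp add: K_def)
    finally show ?thesis .
  qed
  have W_rec0: "W m (Suc 0) = W (Suc m) 0" for m
    by (simp add: W_def funpow_swap1)
  have W_rec: "W m (Suc (Suc k)) = 2 * W (Suc m) (Suc k) - W m k" for m k
    using v[of k] v[of "Suc k"] T[OF v[of "Suc k"]] Tpow[OF g, of m]
    by (simp add: W_def Tpow_sym g L2_inner_diff_left funpow_swap1 flip: sym)
  \<comment> \<open>The orbit element \<open>?v k\<close> is a polynomial of degree at most
    \<open>k\<close> in \<open>T\<close> applied to \<open>f\<close>, so only moments up to order
    \<open>m + k\<close> enter.\<close>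
  have W_vanish: "W m k = 0" if "m + k \<le> N" for m k
    using that
  proof (induction k arbitrary: m rule: less_induct)
    case (less k)
    show ?case
    proof (cases k)
      case 0
      then show ?thesis using less.prems vanish by (simp add: W_def)
    next
      case (Suc j)
      show ?thesis
      proof (cases j)
        case 0
        then show ?thesis using Suc less W_rec0[of m] by simp
      next
        case (Suc i)
        then have "k = Suc (Suc i)" using \<open>k = Suc j\<close> by simp
        then show ?thesis using less W_rec[of m i] by simp
      qed
    qed
  qed
  \<comment> \<open>Read backwards, \<open>W_rec\<close> says that \<open>W (Suc m)\<close> averages
    \<open>W m\<close> over the two neighbours of \<open>k\<close>, with reflection at 0. The bound
    is built for this walk: the neighbours' squares average to the square of \<open>k\<close> plus
    1. For \<open>m = 0\<close> it holds because \<open>W 0 k\<close> vanishes up to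
    \<open>N\<close> and is at most \<open>K\<close> beyond.\<close>
  have W_le: "\<bar>W m k\<bar> \<le> K * (real m + (real k)\<^sup>2) / (real N)\<^sup>2" for m k
  proof (induction m arbitrary: k)
    case 0
    show ?case
    proof (cases "k \<le> N")
      case True
      then show ?thesis using W_vanish[of 0 k] \<open>K \<ge> 0\<close> by simp
    next
      case False
      have "\<bar>W 0 k\<bar> * (real N)\<^sup>2 \<le> K * (real k)\<^sup>2"
        using W_0[of k] False \<open>K \<ge> 0\<close> by (intro mult_mono power_mono) auto
      then show ?thesis using N by (simp add: field_simps)
    qed
  next
    case (Suc m)
    show ?case
    proof (cases k)
      case 0
      then show ?thesis using Suc[of 1] W_rec0[of m] by (simp add: add.commute)
    next
      case (Suc j)
      have "W (Suc m) k = (W m (Suc (Suc j)) + W m j) / 2" using W_rec[of m j] Suc by simp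
      then have "\<bar>W (Suc m) k\<bar> \<le> (\<bar>W m (Suc (Suc j))\<bar> + \<bar>W m j\<bar>) / 2" by simp
      also have "\<dots> \<le> (K * (real m + (real (Suc (Suc j)))\<^sup>2) / (real N)\<^sup>2 + K * (real m + (real j)\<^sup>2) / (real N)\<^sup>2) / 2"
        by (intro divide_right_mono add_mono Suc.IH) simp
      also have "\<dots> = K * (real (Suc m) + (real k)\<^sup>2) / (real N)\<^sup>2"
        using N by (simp add: Suc field_simps power2_eq_square)
      finally show ?thesis .
    qed
  qed
  show ?thesis using W_le[of m 0] by (simp add: W_def K_def)
qed

lemma tendsto_L2_inner2:
  assumes "f \<in> L2 M" "g \<in> L2 M" "\<And>n. F n \<in> L2 M" "\<And>n. G n \<in> L2 M"
    and "((\<lambda>n. L2_norm M (\<lambda>x. F n x - f x)) \<longlongrightarrow> 0) X"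
    and "((\<lambda>n. L2_norm M (\<lambda>x. G n x - g x)) \<longlongrightarrow> 0) X"
  shows "((\<lambda>n. L2_inner M (F n) (G n)) \<longlongrightarrow> L2_inner M f g) X"
proof -
  have "((\<lambda>n. L2_inner M (\<lambda>x. F n x - f x) (G n)) \<longlongrightarrow> 0) X"
  proof (rule Lim_null_comparison)
    show "((\<lambda>n. L2_norm M (\<lambda>x. F n x - f x) * L2_norm M (G n)) \<longlongrightarrow> 0) X"
      using tendsto_mult[OF assms(5) tendsto_L2_norm[OF assms(2,4,6)]] by simp
    show "\<forall>\<^sub>F n in X. norm (L2_inner M (\<lambda>x. F n x - f x) (G n)) \<le> L2_norm M (\<lambda>x. F n x - f x) * L2_norm M (G n)"
      using assms(1-4) by (auto intro!: always_eventually L2_Cauchy_Schwarz)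
  qed
  from tendsto_add[OF this tendsto_L2_inner[OF assms(2,1,4,6)]] show ?thesis
    using assms(1-4) by (simp add: L2_inner_diff_left L2_inner_commute[of M f])
qed

section \<open>Self-adjoint positive semigroups with values in the continuous functions\<close>

locale selfadjoint_C_semigroup = finite_measure \<mu>
  for \<mu> :: "'a::metric_space measure" +
  fixes S :: "real \<Rightarrow> ('a \<Rightarrow> real) \<Rightarrow> ('a \<Rightarrow> real)" and A :: "'a L2_graph"
  assumes compact_space: "compact (UNIV :: 'a set)"
    and sets_eq_borel: "sets \<mu> = sets borel"
    and full_support: "full_support \<mu>"
    and C0_semigroup: "L2_C0_semigroup \<mu> S"
    and positive_semigroup: "L2_positive_semigroup \<mu> S"
    and generator: "L2_generator \<mu> S = {(f, \<lambda>x. - g x) | f g. (f, g) \<in> A}"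
    and selfadjoint: "L2_selfadjoint \<mu> A"
    and continuous_values: "\<forall>t>0. \<forall>f\<in>L2 \<mu>. \<exists>g :: 'a \<Rightarrow>\<^sub>C real. AE x in \<mu>. apply_bcontfun g x = S t f x"
begin

abbreviation ip :: "('a \<Rightarrow> real) \<Rightarrow> ('a \<Rightarrow> real) \<Rightarrow> real" where "ip \<equiv> L2_inner \<mu>"
abbreviation nm :: "('a \<Rightarrow> real) \<Rightarrow> real" where "nm \<equiv> L2_norm \<mu>"

text \<open>The values are plain functions instead of elements of the type of bounded continuous
  functions, so that \<open>Q\<close> can be iterated and applied to any square-integrable
  function.\<close>

definition Q :: "real \<Rightarrow> ('a \<Rightarrow> real) \<Rightarrow> 'a \<Rightarrow> real" where
  "Q t f = apply_bcontfun (cont_rep \<mu> (S t f))"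

subsection \<open>Continuous representatives\<close>

lemma measurable_continuous: "continuous_on UNIV f \<Longrightarrow> f \<in> borel_measurable \<mu>"
  for f :: "'a \<Rightarrow> real"
  using borel_measurable_continuous_onI measurable_cong_sets[OF sets_eq_borel refl] by blast

text \<open>The set where the inequality fails is open and null, hence empty by full
  support.\<close>

lemma continuous_AE_le:
  fixes f g :: "'a \<Rightarrow> real"
  assumes "continuous_on UNIV f" "continuous_on UNIV g" "AE x in \<mu>. f x \<le> g x"
  shows "f x \<le> g x"
proof (rule ccontr)
  assume "\<not> f x \<le> g x"
  let ?U = "{x. g x < f x}"
  have "open ?U" using assms(1,2) by (intro open_Collect_less)
  moreover have "x \<in> ?U" using \<open>\<not> f x \<le> g x\<close> by simp
  ultimately have "emeasure \<mu> ?U > 0" using full_support by (auto simp: full_support_def)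
  moreover have "?U \<in> sets \<mu>" using \<open>open ?U\<close> by (simp add: sets_eq_borel)
  moreover have "AE x in \<mu>. x \<notin> ?U" using assms(3) by eventually_elim simp
  ultimately show False using AE_iff_measurable[of ?U \<mu> "\<lambda>x. x \<notin> ?U"]
    by (simp add: sets_eq_imp_space_eq[OF sets_eq_borel])
qed

lemma continuous_AE_eq:
  fixes f g :: "'a \<Rightarrow> real"
  assumes "continuous_on UNIV f" "continuous_on UNIV g" "AE x in \<mu>. f x = g x"
  shows "f = g"
proof
  fix x show "f x = g x"
  proof (rule antisym)
    show "f x \<le> g x" using assms(3) by (intro continuous_AE_le assms) (auto elim: eventually_mono)
    show "g x \<le> f x" using assms(3) by (intro continuous_AE_le assms) (auto elim: eventually_mono)
  qed
qed

lemma cont_rep_eqI: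
  assumes "AE x in \<mu>. apply_bcontfun g x = f x"
  shows "cont_rep \<mu> f = g"
  unfolding cont_rep_def
proof (rule the_equality)
  fix h assume "AE x in \<mu>. apply_bcontfun h x = f x"
  then have "AE x in \<mu>. apply_bcontfun h x = apply_bcontfun g x"
    using assms by eventually_elim simp
  then show "h = g"
    using continuous_AE_eq[of "apply_bcontfun h" "apply_bcontfun g"] by (auto simp: apply_bcontfun_inject)
qed (rule assms)

lemma continuous_bounded:
  fixes f :: "'a \<Rightarrow> real"
  assumes "continuous_on UNIV f"
  obtains B where "0 \<le> B" "\<And>x. \<bar>f x\<bar> \<le> B"
proof -
  have "bounded (range f)"
    using compact_continuous_image[OF assms compact_space] by (rule compact_imp_bounded)
  then obtain B where "\<And>x. \<bar>f x\<bar> \<le> B" by (auto simp: bounded_iff)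
  moreover from this[of undefined] have "0 \<le> B" by linarith
  ultimately show thesis using that by blast
qed

lemma continuous_bcontfun:
  fixes f :: "'a \<Rightarrow> real"
  assumes "continuous_on UNIV f"
  obtains F :: "'a \<Rightarrow>\<^sub>C real" where "apply_bcontfun F = f"
proof -
  have "bounded (range f)"
    using compact_continuous_image[OF assms compact_space] by (rule compact_imp_bounded)
  with assms have "f \<in> bcontfun" by (simp add: bcontfun_def)
  then show thesis using that Bcontfun_inverse by blast
qed

lemma continuous_L2:
  fixes f :: "'a \<Rightarrow> real"
  assumes "continuous_on UNIV f" shows "f \<in> L2 \<mu>"
proof -
  obtain B where "0 \<le> B" "\<And>x. \<bar>f x\<bar> \<le> B" using continuous_bounded[OF assms] by blast
  then show ?thesis using measurable_continuous[OF assms] by (intro L2_norm_bounded_le(1)[of f B]) auto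
qed

lemma bcontfun_L2 [simp]: "apply_bcontfun F \<in> L2 \<mu>"
  by (rule continuous_L2) simp

lemma Q_continuous [simp]: "continuous_on X (Q t f)"
  by (simp add: Q_def)

lemma Q_L2 [simp]: "Q t f \<in> L2 \<mu>"
  by (rule continuous_L2) simp

lemma S_L2: "0 < t \<Longrightarrow> f \<in> L2 \<mu> \<Longrightarrow> S t f \<in> L2 \<mu>"
  using C0_semigroup by (simp add: L2_C0_semigroup_def L2_bounded_linear_def)

lemma Q_AE:
  assumes "0 < t" "f \<in> L2 \<mu>" shows "AE x in \<mu>. Q t f x = S t f x"
proof -
  obtain g :: "'a \<Rightarrow>\<^sub>C real" where g: "AE x in \<mu>. apply_bcontfun g x = S t f x"
    using continuous_values assms by blast
  then show ?thesis unfolding Q_def cont_rep_eqI[OF g] .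
qed

lemma Q_eqI:
  assumes "0 < t" "f \<in> L2 \<mu>" "continuous_on UNIV h" "AE x in \<mu>. h x = S t f x"
  shows "Q t f = h"
proof (rule continuous_AE_eq)
  show "AE x in \<mu>. Q t f x = h x" using Q_AE[OF assms(1,2)] assms(4) by eventually_elim simp
qed (use assms in auto)

lemma Q_lincomb:
  assumes "0 < t" "f \<in> L2 \<mu>" "g \<in> L2 \<mu>"
  shows "Q t (\<lambda>x. a * f x + b * g x) = (\<lambda>x. a * Q t f x + b * Q t g x)"
proof (rule Q_eqI)
  have "AE x in \<mu>. S t (\<lambda>x. a * f x + b * g x) x = a * S t f x + b * S t g x"
    using C0_semigroup assms by (simp add: L2_C0_semigroup_def L2_bounded_linear_def)
  then show "AE x in \<mu>. a * Q t f x + b * Q t g x = S t (\<lambda>x. a * f x + b * g x) x"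
    using Q_AE[OF assms(1,2)] Q_AE[OF assms(1,3)] by eventually_elim simp
qed (use assms in \<open>auto intro!: continuous_intros\<close>)

lemma Q_add: "0 < t \<Longrightarrow> f \<in> L2 \<mu> \<Longrightarrow> g \<in> L2 \<mu> \<Longrightarrow> Q t (\<lambda>x. f x + g x) = (\<lambda>x. Q t f x + Q t g x)"
  using Q_lincomb[of t f g 1 1] by simp

lemma Q_diff: "0 < t \<Longrightarrow> f \<in> L2 \<mu> \<Longrightarrow> g \<in> L2 \<mu> \<Longrightarrow> Q t (\<lambda>x. f x - g x) = (\<lambda>x. Q t f x - Q t g x)"
  using Q_lincomb[of t f g 1 "-1"] by simp

lemma Q_mult: "0 < t \<Longrightarrow> f \<in> L2 \<mu> \<Longrightarrow> Q t (\<lambda>x. c * f x) = (\<lambda>x. c * Q t f x)"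
  using Q_lincomb[of t f f c 0] by simp

lemma Q_divide: "0 < t \<Longrightarrow> f \<in> L2 \<mu> \<Longrightarrow> Q t (\<lambda>x. f x / c) = (\<lambda>x. Q t f x / c)"
  using Q_mult[of t f "1/c"] by simp

lemma Q_uminus: "0 < t \<Longrightarrow> f \<in> L2 \<mu> \<Longrightarrow> Q t (\<lambda>x. - f x) = (\<lambda>x. - Q t f x)"
  using Q_mult[of t f "-1"] by simp

lemma Q_zero: "0 < t \<Longrightarrow> Q t (\<lambda>x. 0) = (\<lambda>x. 0)"
  using Q_mult[of t "\<lambda>x. 0" 0] by simp

lemma Q_norm_bound:
  assumes "0 < t"
  obtains C where "0 \<le> C" "\<And>f. f \<in> L2 \<mu> \<Longrightarrow> nm (Q t f) \<le> C * nm f"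
proof -
  obtain C where C: "\<And>f. f \<in> L2 \<mu> \<Longrightarrow> nm (S t f) \<le> C * nm f"
  proof -
    have "L2_bounded_linear \<mu> (S t)" using C0_semigroup assms by (simp add: L2_C0_semigroup_def)
    then have "\<exists>C. \<forall>f\<in>L2 \<mu>. nm (S t f) \<le> C * nm f" by (simp add: L2_bounded_linear_def)
    then show thesis using that by blast
  qed
  have "nm (Q t f) \<le> \<bar>C\<bar> * nm f" if "f \<in> L2 \<mu>" for f
  proof -
    have "nm (Q t f) = nm (S t f)"
      using Q_AE[OF assms that] S_L2[OF assms that] by (intro L2_norm_cong_AE) (auto simp: L2_measurable)
    also have "\<dots> \<le> \<bar>C\<bar> * nm f"
      using C[OF that] by (rule order_trans) (intro mult_right_mono, auto)
    finally show ?thesis .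
  qed
  then show thesis using that[of "\<bar>C\<bar>"] by simp
qed

lemma Q_mono:
  assumes "0 < t" "f \<in> L2 \<mu>" "g \<in> L2 \<mu>" "AE x in \<mu>. f x \<le> g x"
  shows "Q t f x \<le> Q t g x"
proof (rule continuous_AE_le)
  have "AE x in \<mu>. 0 \<le> S t (\<lambda>x. g x - f x) x"
    using positive_semigroup assms by (simp add: L2_positive_semigroup_def)
  moreover have "AE x in \<mu>. Q t (\<lambda>x. g x - f x) x = S t (\<lambda>x. g x - f x) x"
    using assms by (intro Q_AE) auto
  ultimately show "AE x in \<mu>. Q t f x \<le> Q t g x"
    by eventually_elim (use assms in \<open>simp add: Q_diff\<close>)
qed simp_all

lemma Q_nonneg: "0 < t \<Longrightarrow> f \<in> L2 \<mu> \<Longrightarrow> AE x in \<mu>. 0 \<le> f x \<Longrightarrow> 0 \<le> Q t f x"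
  using Q_mono[of t "\<lambda>x. 0" f x] by (simp add: Q_zero)

lemma Q_cong_AE:
  assumes "0 < t" "f \<in> L2 \<mu>" "g \<in> L2 \<mu>" "AE x in \<mu>. f x = g x"
  shows "Q t f = Q t g"
proof
  fix x show "Q t f x = Q t g x"
  proof (rule antisym)
    show "Q t f x \<le> Q t g x" using assms(4) by (intro Q_mono assms) (auto elim: eventually_mono)
    show "Q t g x \<le> Q t f x" using assms(4) by (intro Q_mono assms) (auto elim: eventually_mono)
  qed
qed

lemma Q_abs_le:
  assumes "0 < t" "f \<in> L2 \<mu>" shows "\<bar>Q t f x\<bar> \<le> Q t (\<lambda>x. \<bar>f x\<bar>) x"
  using Q_mono[of t f "\<lambda>x. \<bar>f x\<bar>" x] Q_mono[of t "\<lambda>x. - f x" "\<lambda>x. \<bar>f x\<bar>" x] assms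
  by (simp add: Q_uminus)

lemma Q_semigroup:
  assumes "0 < s" "0 < t" "f \<in> L2 \<mu>" shows "Q (s + t) f = Q s (Q t f)"
proof (rule Q_eqI)
  have "Q s (Q t f) = Q s (S t f)"
    using assms by (intro Q_cong_AE Q_AE) (auto simp: S_L2)
  moreover have "AE x in \<mu>. Q s (S t f) x = S s (S t f) x"
    using assms by (intro Q_AE) (auto simp: S_L2)
  moreover have "AE x in \<mu>. S (s + t) f x = S s (S t f) x"
    using C0_semigroup assms by (simp add: L2_C0_semigroup_def)
  ultimately show "AE x in \<mu>. Q s (Q t f) x = S (s + t) f x"
    by auto
qed (use assms in auto)

lemma Q_commute: "0 < s \<Longrightarrow> 0 < t \<Longrightarrow> f \<in> L2 \<mu> \<Longrightarrow> Q s (Q t f) = Q t (Q s f)"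
  by (metis Q_semigroup add.commute)

text \<open>The points of the space index a family of positive functionals; for each fixed
  \<open>f\<close> they are bounded because \<open>Q t f\<close> is continuous on a compact space.
  The gliding hump makes this uniform.\<close>

lemma Q_sup_bound:
  assumes "0 < t"
  obtains C where "0 \<le> C" "\<And>f x. f \<in> L2 \<mu> \<Longrightarrow> \<bar>Q t f x\<bar> \<le> C * nm f"
proof -
  have mono: "Q t f x \<le> Q t g x"
    if "f \<in> L2 \<mu>" "g \<in> L2 \<mu>" "AE x in \<mu>. f x \<le> g x" for f g x
    using Q_mono assms that by blast
  have bdd: "\<exists>B. \<forall>x. Q t f x \<le> B" for f
  proof -
    obtain B where "\<And>x. \<bar>Q t f x\<bar> \<le> B" using continuous_bounded[OF Q_continuous] by blast
    then show ?thesis using abs_le_D1 by blast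
  qed
  have scale: "Q t (\<lambda>x. c * f x) x = c * Q t f x" if "f \<in> L2 \<mu>" for c f x
    using Q_mult[OF assms that] by simp
  obtain C where C: "0 \<le> C" "\<And>x f. f \<in> L2 \<mu> \<Longrightarrow> (AE x in \<mu>. 0 \<le> f x) \<Longrightarrow> Q t f x \<le> C * nm f"
    by (rule L2_positive_uniform_bound[of "\<lambda>x f. Q t f x", OF mono scale bdd that])
  have "\<bar>Q t f x\<bar> \<le> C * nm f" if "f \<in> L2 \<mu>" for f x
    using Q_abs_le[OF assms that, of x] C(2)[of "\<lambda>x. \<bar>f x\<bar>" x] that by simp
  with C(1) show thesis using that by blast
qed

lemma Q_tendsto:
  assumes "f \<in> L2 \<mu>" shows "((\<lambda>t. nm (\<lambda>x. Q t f x - f x)) \<longlongrightarrow> 0) (at_right 0)"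
proof -
  have "((\<lambda>t. nm (\<lambda>x. S t f x - f x)) \<longlongrightarrow> 0) (at_right 0)"
    using C0_semigroup assms by (simp add: L2_C0_semigroup_def)
  moreover have "\<forall>\<^sub>F t in at_right 0. nm (\<lambda>x. S t f x - f x) = nm (\<lambda>x. Q t f x - f x)"
    using eventually_at_right_less
  proof eventually_elim
    case (elim t)
    then show ?case using Q_AE[OF elim assms] S_L2[OF elim assms] assms
      by (intro L2_norm_cong_AE) (auto simp: L2_measurable)
  qed
  ultimately show ?thesis by (rule Lim_transform_eventually)
qed

section \<open>The graph \<open>A\<close> as the negative derivative of the semigroup at time
  0\<close>

lemma A_L2: "(f, g) \<in> A \<Longrightarrow> f \<in> L2 \<mu> \<and> g \<in> L2 \<mu>"
  using selfadjoint by (auto simp: L2_selfadjoint_def)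

lemma A_tendsto:
  assumes "(f, g) \<in> A"
  shows "((\<lambda>t. nm (\<lambda>x. (Q t f x - f x) / t + g x)) \<longlongrightarrow> 0) (at_right 0)"
proof -
  have L: "f \<in> L2 \<mu>" "g \<in> L2 \<mu>" using A_L2 assms by auto
  have "(f, \<lambda>x. - g x) \<in> L2_generator \<mu> S" using generator assms by blast
  then have "((\<lambda>t. nm (\<lambda>x. (S t f x - f x) / t + g x)) \<longlongrightarrow> 0) (at_right 0)"
    by (simp add: L2_generator_def)
  moreover have "\<forall>\<^sub>F t in at_right 0. nm (\<lambda>x. (S t f x - f x) / t + g x) = nm (\<lambda>x. (Q t f x - f x) / t + g x)"
    using eventually_at_right_less
  proof eventually_elim
    case (elim t)
    then show ?case using Q_AE[OF elim L(1)] S_L2[OF elim L(1)] L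
      by (intro L2_norm_cong_AE) (auto simp: L2_measurable)
  qed
  ultimately show ?thesis by (rule Lim_transform_eventually)
qed

lemma A_I:
  assumes L: "f \<in> L2 \<mu>" "g \<in> L2 \<mu>"
    and "((\<lambda>t. nm (\<lambda>x. (Q t f x - f x) / t + g x)) \<longlongrightarrow> 0) (at_right 0)"
  shows "(f, g) \<in> A"
proof -
  have "\<forall>\<^sub>F t in at_right 0. nm (\<lambda>x. (Q t f x - f x) / t + g x) = nm (\<lambda>x. (S t f x - f x) / t + g x)"
    using eventually_at_right_less
  proof eventually_elim
    case (elim t)
    then show ?case using Q_AE[OF elim L(1)] S_L2[OF elim L(1)] L
      by (intro L2_norm_cong_AE) (auto simp: L2_measurable)
  qed
  with assms(3) have "((\<lambda>t. nm (\<lambda>x. (S t f x - f x) / t + g x)) \<longlongrightarrow> 0) (at_right 0)"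
    by (rule Lim_transform_eventually)
  then have "(f, \<lambda>x. - g x) \<in> L2_generator \<mu> S" using L by (simp add: L2_generator_def)
  then obtain g' where g': "(f, g') \<in> A" "(\<lambda>x. - g x) = (\<lambda>x. - g' x)" using generator by auto
  have "g' x = g x" for x using fun_cong[OF g'(2), of x] by simp
  then have "g' = g" by blast
  with g' show ?thesis by simp
qed

lemma A_symmetric: "(f, f') \<in> A \<Longrightarrow> (g, g') \<in> A \<Longrightarrow> ip f' g = ip f g'"
  using selfadjoint unfolding L2_selfadjoint_def L2_adjoint_def by blast

text \<open>The bounded operator \<open>Q a\<close> commutes with the difference quotients and can
  be pulled out of their limit.\<close>

lemma Q_domain:
  assumes "(f, g) \<in> A" "0 < a" shows "(Q a f, Q a g) \<in> A"
proof (rule A_I)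
  have L: "f \<in> L2 \<mu>" "g \<in> L2 \<mu>" using A_L2 assms by auto
  obtain C where C: "0 \<le> C" "\<And>f. f \<in> L2 \<mu> \<Longrightarrow> nm (Q a f) \<le> C * nm f"
    using Q_norm_bound assms(2) by blast
  have "((\<lambda>t. C * nm (\<lambda>x. (Q t f x - f x) / t + g x)) \<longlongrightarrow> 0) (at_right 0)"
    using tendsto_mult_left[OF A_tendsto[OF assms(1)], of C] by simp
  then show "((\<lambda>t. nm (\<lambda>x. (Q t (Q a f) x - Q a f x) / t + Q a g x)) \<longlongrightarrow> 0) (at_right 0)"
  proof (rule Lim_null_comparison[rotated])
    show "\<forall>\<^sub>F t in at_right 0. norm (nm (\<lambda>x. (Q t (Q a f) x - Q a f x) / t + Q a g x))
        \<le> C * nm (\<lambda>x. (Q t f x - f x) / t + g x)"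
      using eventually_at_right_less
    proof eventually_elim
      case (elim t)
      have "Q a (\<lambda>x. (Q t f x - f x) / t + g x) = (\<lambda>x. (Q t (Q a f) x - Q a f x) / t + Q a g x)"
        using assms(2) L elim by (simp add: Q_add Q_divide Q_diff Q_commute[of t a])
      moreover have "nm (Q a (\<lambda>x. (Q t f x - f x) / t + g x)) \<le> C * nm (\<lambda>x. (Q t f x - f x) / t + g x)"
        using L by (intro C(2)) auto
      ultimately show ?case by simp
    qed
  qed
qed simp_all


subsection \<open>Symmetry of the semigroup\<close>

text \<open>Strong continuity bounds each orbit along a sequence of times tending to 0, and the
  gliding hump turns this into an operator bound. The functionals here are norms of images, which is
  why the uniform bound is stated for monotone, positively homogeneous functionals.\<close>

lemma Q_locally_bounded:
  obtains \<delta> C where "0 < \<delta>" "0 \<le> C" "\<And>r f. 0 < r \<Longrightarrow> r < \<delta> \<Longrightarrow> f \<in> L2 \<mu> \<Longrightarrow> nm (Q r f) \<le> C * nm f"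
proof -
  \<comment> \<open>One number \<open>n\<close> plays the role of the bound and fixes the time
    range, so that failure for all \<open>n\<close> produces times tending to 0.\<close>
  have "\<exists>n::nat. \<forall>r f. 0 < r \<and> r < 1 / real (Suc n) \<and> f \<in> L2 \<mu> \<longrightarrow> nm (Q r f) \<le> real n * nm f"
  proof (rule ccontr)
    assume "\<not> ?thesis"
    then have "\<forall>n::nat. \<exists>r f. 0 < r \<and> r < 1 / real (Suc n) \<and> f \<in> L2 \<mu> \<and> nm (Q r f) > real n * nm f"
      by (meson not_less)
    then obtain r f where r: "\<And>n::nat. 0 < r n" "\<And>n. r n < 1 / real (Suc n)"
      and f: "\<And>n. f n \<in> L2 \<mu>" "\<And>n. nm (Q (r n) (f n)) > real n * nm (f n)"
      by metis
    have "r \<longlonglongrightarrow> 0"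
    proof (rule tendsto_sandwich[OF _ _ tendsto_const])
      show "(\<lambda>n. 1 / real (Suc n)) \<longlonglongrightarrow> 0" using LIMSEQ_Suc[OF lim_1_over_n] by simp
    qed (use r in \<open>auto intro!: always_eventually less_imp_le\<close>)
    then have r0: "filterlim r (at_right 0) sequentially"
      using r(1) by (simp add: filterlim_at less_imp_neq[symmetric])
    have mono: "nm (Q (r n) f) \<le> nm (Q (r n) g)"
      if "f \<in> L2 \<mu>" "g \<in> L2 \<mu>" "AE x in \<mu>. 0 \<le> f x" "AE x in \<mu>. f x \<le> g x" for n f g
    proof (rule L2_norm_mono)
      show "AE x in \<mu>. \<bar>Q (r n) f x\<bar> \<le> \<bar>Q (r n) g x\<bar>"
        using Q_nonneg[OF r(1) that(1,3), of n] Q_mono[OF r(1) that(1,2,4), of n]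
        by (intro AE_I2) (smt (verit))
    qed (auto simp: L2_measurable)
    have bdd: "\<exists>B. \<forall>n. nm (Q (r n) f) \<le> B" if "f \<in> L2 \<mu>" for f
    proof -
      have "(\<lambda>n. nm (\<lambda>x. Q (r n) f x - f x)) \<longlonglongrightarrow> 0"
        using filterlim_compose[OF Q_tendsto[OF that] r0] by simp
      from tendsto_L2_norm[OF that _ this] have "Bseq (\<lambda>n. nm (Q (r n) f))"
        by (intro convergent_imp_Bseq convergentI) simp
      then show ?thesis by (auto simp: Bseq_def)
    qed
    have scale: "nm (Q (r n) (\<lambda>x. c * f x)) = c * nm (Q (r n) f)" if "f \<in> L2 \<mu>" "0 < c" for n c f
      using Q_mult[OF r(1) that(1), of n c] that(2) by (simp add: L2_norm_mult)
    obtain C where C: "0 \<le> C" "\<And>n f. f \<in> L2 \<mu> \<Longrightarrow> (AE x in \<mu>. 0 \<le> f x) \<Longrightarrow> nm (Q (r n) f) \<le> C * nm f"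
      by (rule L2_positive_uniform_bound[of "\<lambda>n f. nm (Q (r n) f)", OF mono scale bdd that])
    obtain n where "C \<le> real n" using real_arch_simple by blast
    have "nm (Q (r n) (f n)) \<le> nm (Q (r n) (\<lambda>x. \<bar>f n x\<bar>))"
      by (intro L2_norm_mono AE_I2 order_trans[OF Q_abs_le[OF r(1) f(1)] abs_ge_self])
         (auto simp: L2_measurable)
    also have "\<dots> \<le> C * nm (f n)" using C(2)[of "\<lambda>x. \<bar>f n x\<bar>" n] f(1) by simp
    also have "\<dots> \<le> real n * nm (f n)" using \<open>C \<le> real n\<close> by (intro mult_right_mono) auto
    finally show False using f(2)[of n] by simp
  qed
  then obtain n :: nat where n: "\<And>r f. 0 < r \<Longrightarrow> r < 1 / real (Suc n) \<Longrightarrow> f \<in> L2 \<mu> \<Longrightarrow> nm (Q r f) \<le> real n * nm f"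
    by blast
  show thesis by (rule that[OF _ _ n]) auto
qed

text \<open>With \<open>h = t / n\<close>, the difference of the two sides telescopes into \<open>n\<close> terms; each is \<open>o(h)\<close>
  by the symmetry of the generator.\<close>

lemma Q_symmetric_domain:
  assumes fA: "(f, f') \<in> A" and gA: "(g, g') \<in> A"
    and bound: "0 \<le> C" "\<And>r f. 0 < r \<Longrightarrow> r < \<delta> \<Longrightarrow> f \<in> L2 \<mu> \<Longrightarrow> nm (Q r f) \<le> C * nm f"
    and t: "0 < t" "0 < \<epsilon>" "t + \<epsilon> < \<delta>"
  shows "ip (Q (\<epsilon> + t) f) (Q \<epsilon> g) = ip (Q \<epsilon> f) (Q (\<epsilon> + t) g)"
proof -
  have L: "f \<in> L2 \<mu>" "f' \<in> L2 \<mu>" "g \<in> L2 \<mu>" "g' \<in> L2 \<mu>" using A_L2 fA gA by auto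
  define e where "e h x = (Q h f x - f x) / h + f' x" for h x
  define e' where "e' h x = (Q h g x - g x) / h + g' x" for h x
  have eL: "e h \<in> L2 \<mu>" "e' h \<in> L2 \<mu>" for h
    unfolding e_def[abs_def] e'_def[abs_def] using L by simp_all
  define B where "B h = C * C * (nm (e h) * nm g + nm f * nm (e' h))" for h
  \<comment> \<open>\<open>e h\<close> and \<open>e' h\<close> are the errors of the difference
    quotients. The leading terms cancel because \<open>A\<close> is symmetric on
    \<open>Q a f\<close> and \<open>Q b g\<close>; only the errors remain, and \<open>B h\<close>
    tends to 0.\<close>
  have step: "\<bar>ip (Q (a + h) f) (Q b g) - ip (Q a f) (Q (b + h) g)\<bar> \<le> h * B h"
    if "0 < h" "0 < a" "a < \<delta>" "0 < b" "b < \<delta>" for a b h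
  proof -
    have Qf: "Q (a + h) f = (\<lambda>x. Q a f x + h * (Q a (e h) x - Q a f' x))"
    proof -
      have "Q h f = (\<lambda>x. f x + h * (e h x - f' x))" using that by (auto simp: e_def)
      then have "Q (a + h) f = Q a (\<lambda>x. f x + h * (e h x - f' x))"
        using that L by (simp add: Q_semigroup)
      then show ?thesis using that L eL by (simp add: Q_add Q_mult Q_diff)
    qed
    have Qg: "Q (b + h) g = (\<lambda>x. Q b g x + h * (Q b (e' h) x - Q b g' x))"
    proof -
      have "Q h g = (\<lambda>x. g x + h * (e' h x - g' x))" using that by (auto simp: e'_def)
      then have "Q (b + h) g = Q b (\<lambda>x. g x + h * (e' h x - g' x))"
        using that L by (simp add: Q_semigroup)
      then show ?thesis using that L eL by (simp add: Q_add Q_mult Q_diff)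
    qed
    have "ip (Q a f') (Q b g) = ip (Q a f) (Q b g')"
      using Q_domain[OF fA \<open>0 < a\<close>] Q_domain[OF gA \<open>0 < b\<close>] by (rule A_symmetric)
    then have "ip (Q (a + h) f) (Q b g) - ip (Q a f) (Q (b + h) g)
        = h * (ip (Q a (e h)) (Q b g) - ip (Q a f) (Q b (e' h)))"
      unfolding Qf Qg by (simp add: L2_inner_simps algebra_simps)
    moreover have "\<bar>ip (Q a (e h)) (Q b g)\<bar> \<le> (C * nm (e h)) * (C * nm g)"
      using that bound L eL
      by (intro order_trans[OF L2_Cauchy_Schwarz] mult_mono) (auto simp: bound mult_nonneg_nonneg)
    moreover have "\<bar>ip (Q a f) (Q b (e' h))\<bar> \<le> (C * nm f) * (C * nm (e' h))"
      using that bound L eL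
      by (intro order_trans[OF L2_Cauchy_Schwarz] mult_mono) (auto simp: bound mult_nonneg_nonneg)
    ultimately have "\<bar>ip (Q (a + h) f) (Q b g) - ip (Q a f) (Q (b + h) g)\<bar>
        \<le> h * ((C * nm (e h)) * (C * nm g) + (C * nm f) * (C * nm (e' h)))"
      using \<open>0 < h\<close> by (simp add: abs_mult)
    also have "\<dots> = h * B h" by (simp add: B_def algebra_simps)
    finally show ?thesis .
  qed
  let ?D = "ip (Q (\<epsilon> + t) f) (Q \<epsilon> g) - ip (Q \<epsilon> f) (Q (\<epsilon> + t) g)"
  have le: "\<bar>?D\<bar> \<le> t * B (t / real (Suc n))" for n
  proof -
    define h where "h = t / real (Suc n)"
    have h: "h > 0" "real (Suc n) * h = t" using t by (auto simp: h_def)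
    \<comment> \<open>At stage \<open>j\<close> the time \<open>j * h\<close> has moved from the
      right factor to the left. The offset \<open>\<epsilon>\<close> keeps every time positive,
      since nothing is known about \<open>S 0\<close>.\<close>
    define \<phi> where "\<phi> j = ip (Q (\<epsilon> + real j * h) f) (Q (\<epsilon> + (t - real j * h)) g)" for j
    have jh: "real j * h \<le> t" if "j \<le> Suc n" for j
      using h that by (metis mult_right_mono of_nat_le_iff less_imp_le)
    have inc: "\<bar>\<phi> (Suc j) - \<phi> j\<bar> \<le> h * B h" if "j < Suc n" for j
    proof -
      have *: "real (Suc j) * h \<le> t" using jh[of "Suc j"] that by simp
      have **: "0 \<le> real j * h" using h by simp
      have eq: "real (Suc j) * h = real j * h + h" by (simp add: algebra_simps)
      define a b where "a = \<epsilon> + real j * h" and "b = \<epsilon> + (t - real (Suc j) * h)"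
      have "a + h = \<epsilon> + real (Suc j) * h" "b + h = \<epsilon> + (t - real j * h)"
        unfolding a_def b_def eq by simp_all
      moreover have "0 < a" "a < \<delta>" "0 < b" "b < \<delta>"
        using eq h(1) t * ** unfolding a_def b_def by linarith+
      ultimately show ?thesis
        using step[of h a b] h(1) by (simp only: \<phi>_def) (simp only: a_def b_def)
    qed
    have "?D = \<phi> (Suc n) - \<phi> 0" using h by (simp add: \<phi>_def)
    also have "\<dots> = (\<Sum>j<Suc n. \<phi> (Suc j) - \<phi> j)" by (simp add: sum_lessThan_telescope)
    finally have "\<bar>?D\<bar> \<le> (\<Sum>j<Suc n. \<bar>\<phi> (Suc j) - \<phi> j\<bar>)" by (simp only: sum_abs)
    also have "\<dots> \<le> (\<Sum>j<Suc n. h * B h)" using inc by (intro sum_mono) auto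
    also have "\<dots> = t * B h" using h(2) by (simp add: mult.assoc[symmetric])
    finally show ?thesis by (simp only: h_def)
  qed
  have h0: "filterlim (\<lambda>n. t / real (Suc n)) (at_right 0) sequentially"
    unfolding filterlim_at
  proof
    show "(\<lambda>n. t / real (Suc n)) \<longlonglongrightarrow> 0"
      using tendsto_mult_left[OF LIMSEQ_Suc[OF lim_1_over_n], of t] by simp
  qed (use t in auto)
  have "(\<lambda>n. t * B (t / real (Suc n))) \<longlonglongrightarrow> t * (C * C * (0 * nm g + nm f * 0))"
    unfolding B_def e_def e'_def
    using filterlim_compose[OF A_tendsto[OF fA] h0] filterlim_compose[OF A_tendsto[OF gA] h0]
    by (intro tendsto_intros) auto
  then have "\<bar>?D\<bar> \<le> t * (C * C * (0 * nm g + nm f * 0))"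
    by (rule LIMSEQ_le_const) (use le in blast)
  then show ?thesis by simp
qed

text \<open>The domain version sheds its restrictions in turn: the offset tends to 0 by strong
  continuity, density of the domain together with the local bound covers all functions, and doubling
  covers long times.\<close>

theorem Q_symmetric:
  assumes "0 < t" "f \<in> L2 \<mu>" "g \<in> L2 \<mu>"
  shows "ip (Q t f) g = ip f (Q t g)"
proof -
  obtain \<delta> C where \<delta>: "0 < \<delta>" and C: "0 \<le> C"
      "\<And>r f. 0 < r \<Longrightarrow> r < \<delta> \<Longrightarrow> f \<in> L2 \<mu> \<Longrightarrow> nm (Q r f) \<le> C * nm f"
    using Q_locally_bounded by blast
  have dom: "ip (Q t f) g = ip f (Q t g)"
    if "(f, f') \<in> A" "(g, g') \<in> A" "0 < t" "t < \<delta>" for t f f' g g'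
  proof -
    have L: "f \<in> L2 \<mu>" "g \<in> L2 \<mu>" using A_L2 that by auto
    have ev: "\<forall>\<^sub>F \<epsilon> in at_right 0. 0 < \<epsilon> \<and> \<epsilon> < \<delta> - t"
      using that by (intro eventually_at_rightI[of 0 "\<delta> - t"]) auto
    have eq: "\<forall>\<^sub>F \<epsilon> in at_right 0. ip (Q \<epsilon> (Q t f)) (Q \<epsilon> g) = ip (Q \<epsilon> f) (Q \<epsilon> (Q t g))"
      using ev
    proof eventually_elim
      case (elim \<epsilon>)
      then show ?case
        using Q_symmetric_domain[where \<delta> = \<delta> and C = C and \<epsilon> = \<epsilon>, OF that(1,2) C that(3)] that(3) L by (simp add: Q_semigroup)
    qed
    have 1: "((\<lambda>\<epsilon>. ip (Q \<epsilon> (Q t f)) (Q \<epsilon> g)) \<longlongrightarrow> ip (Q t f) g) (at_right 0)"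
      using L by (intro tendsto_L2_inner2 Q_tendsto) auto
    have "((\<lambda>\<epsilon>. ip (Q \<epsilon> f) (Q \<epsilon> (Q t g))) \<longlongrightarrow> ip f (Q t g)) (at_right 0)"
      using L by (intro tendsto_L2_inner2 Q_tendsto) auto
    then show ?thesis
      using tendsto_unique[OF _ 1] Lim_transform_eventually[OF _ eventually_mono[OF eq sym]] by force
  qed
  have approx: "\<exists>F F'. (\<forall>n::nat. (F n, F' n) \<in> A) \<and> (\<lambda>n. nm (\<lambda>x. F n x - f x)) \<longlonglongrightarrow> 0"
    if "f \<in> L2 \<mu>" for f
  proof -
    have "\<exists>u u'. (u, u') \<in> A \<and> nm (\<lambda>x. f x - u x) < 1 / real (Suc n)" for n
    proof -
      have "1 / real (Suc n) > 0" by simp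
      then show ?thesis
        using selfadjoint that unfolding L2_selfadjoint_def L2_densely_defined_def by blast
    qed
    then obtain F F' where F: "\<And>n. (F n, F' n) \<in> A" "\<And>n. nm (\<lambda>x. f x - F n x) < 1 / real (Suc n)"
      by metis
    have "(\<lambda>n. nm (\<lambda>x. F n x - f x)) \<longlonglongrightarrow> 0"
    proof (rule tendsto_sandwich[OF _ _ tendsto_const])
      show "(\<lambda>n. 1 / real (Suc n)) \<longlonglongrightarrow> 0" using LIMSEQ_Suc[OF lim_1_over_n] by simp
      show "\<forall>\<^sub>F n in sequentially. nm (\<lambda>x. F n x - f x) \<le> 1 / real (Suc n)"
        using F(2) by (auto intro!: always_eventually less_imp_le simp: L2_norm_minus_commute[of _ _ f])
    qed simp
    with F(1) show ?thesis by blast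
  qed
  have small: "ip (Q t f) g = ip f (Q t g)"
    if t: "0 < t" "t < \<delta>" and L: "f \<in> L2 \<mu>" "g \<in> L2 \<mu>" for t f g
  proof -
    have Q_lim: "(\<lambda>n. nm (\<lambda>x. Q t (F n) x - Q t f x)) \<longlonglongrightarrow> 0"
      if "(\<lambda>n. nm (\<lambda>x. F n x - f x)) \<longlonglongrightarrow> 0" "\<And>n. F n \<in> L2 \<mu>" "f \<in> L2 \<mu>" for F :: "nat \<Rightarrow> _" and f
    proof (rule Lim_null_comparison)
      show "(\<lambda>n. C * nm (\<lambda>x. F n x - f x)) \<longlonglongrightarrow> 0" using tendsto_mult_left[OF that(1), of C] by simp
      show "\<forall>\<^sub>F n in sequentially. norm (nm (\<lambda>x. Q t (F n) x - Q t f x)) \<le> C * nm (\<lambda>x. F n x - f x)"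
        using C(2)[OF t] that t by (intro always_eventually) (simp flip: Q_diff)
    qed
    obtain F F' where F: "\<And>n::nat. (F n, F' n) \<in> A" "(\<lambda>n. nm (\<lambda>x. F n x - f x)) \<longlonglongrightarrow> 0"
      using approx[OF L(1)] by blast
    obtain G G' where G: "\<And>n::nat. (G n, G' n) \<in> A" "(\<lambda>n. nm (\<lambda>x. G n x - g x)) \<longlonglongrightarrow> 0"
      using approx[OF L(2)] by blast
    have FL: "F n \<in> L2 \<mu>" "G n \<in> L2 \<mu>" for n using A_L2 F G by auto
    have "(\<lambda>n. ip (Q t (F n)) (G n)) \<longlonglongrightarrow> ip (Q t f) g"
      by (rule tendsto_L2_inner2[OF _ L(2) _ FL(2) Q_lim[OF F(2) FL(1) L(1)] G(2)]) auto
    moreover have "(\<lambda>n. ip (F n) (Q t (G n))) \<longlonglongrightarrow> ip f (Q t g)"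
      by (rule tendsto_L2_inner2[OF L(1) _ FL(1) _ F(2) Q_lim[OF G(2) FL(2) L(2)]]) auto
    moreover have "(\<lambda>n. ip (Q t (F n)) (G n)) = (\<lambda>n. ip (F n) (Q t (G n)))"
      using dom[OF F(1) G(1) t] by simp
    ultimately show ?thesis using LIMSEQ_unique by metis
  qed
  \<comment> \<open>Symmetry at \<open>s\<close> gives symmetry at \<open>s + s\<close> by moving
    one factor at a time, so it climbs back from this short time to \<open>t\<close>.\<close>
  obtain n where n: "t / 2 ^ n < \<delta>"
    using real_arch_pow_inv[of "\<delta> / t" "1/2"] \<open>0 < t\<close> \<delta> by (auto simp: field_simps power_divide)
  have "ip (Q (t / 2 ^ n * 2 ^ k) f) g = ip f (Q (t / 2 ^ n * 2 ^ k) g)"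
    if "f \<in> L2 \<mu>" "g \<in> L2 \<mu>" for k f g
    using that
  proof (induction k arbitrary: f g)
    case 0
    then show ?case using small n \<open>0 < t\<close> by simp
  next
    case (Suc k)
    define s where "s = t / 2 ^ n * 2 ^ k"
    have "s > 0" using \<open>0 < t\<close> by (simp add: s_def)
    have eq: "t / 2 ^ n * 2 ^ Suc k = s + s" by (simp add: s_def)
    show ?case
      using Suc.IH[of "Q s f" g, folded s_def] Suc.IH[of f "Q s g", folded s_def] Suc.prems
      unfolding eq by (simp only: Q_semigroup[OF \<open>s > 0\<close> \<open>s > 0\<close>] Q_L2)
  qed
  from this[of f g n] assms show ?thesis by simp
qed


subsection \<open>Consequences of symmetry\<close>

lemma Q_half_norm_sq:
  assumes "0 < t" "f \<in> L2 \<mu>"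
  shows "(nm (Q (t / 2) f))\<^sup>2 = ip (Q t f) f"
proof -
  have "Q t f = Q (t / 2) (Q (t / 2) f)" using Q_semigroup[of "t/2" "t/2" f] assms by simp
  then show ?thesis using Q_symmetric[of "t/2" "Q (t/2) f" f] assms by (simp add: L2_norm_sq)
qed

text \<open>Submultiplicativity only carries bounds to longer times. Here symmetry and
  Cauchy-Schwarz carry one to the half time, with the same rate and no extra constant.\<close>

lemma Q_half_norm_bound:
  assumes "0 < t" "\<And>f. f \<in> L2 \<mu> \<Longrightarrow> nm (Q t f) \<le> exp (\<omega> * t) * nm f" "f \<in> L2 \<mu>"
  shows "nm (Q (t / 2) f) \<le> exp (\<omega> * (t / 2)) * nm f"
proof (rule power2_le_imp_le)
  have "(nm (Q (t / 2) f))\<^sup>2 \<le> nm (Q t f) * nm f"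
    unfolding Q_half_norm_sq[OF assms(1,3)] using L2_Cauchy_Schwarz[of "Q t f" \<mu> f] assms(3) by simp
  also have "\<dots> \<le> exp (\<omega> * t) * nm f * nm f" using assms by (intro mult_right_mono) auto
  also have "\<dots> = (exp (\<omega> * (t / 2)) * nm f)\<^sup>2"
    by (simp add: power2_eq_square flip: exp_add)
  finally show "(nm (Q (t / 2) f))\<^sup>2 \<le> (exp (\<omega> * (t / 2)) * nm f)\<^sup>2" .
qed simp

lemma Q_dyadic_norm_bound:
  assumes "0 < t" "\<And>f. f \<in> L2 \<mu> \<Longrightarrow> nm (Q t f) \<le> exp (\<omega> * t) * nm f" "f \<in> L2 \<mu>"
  shows "nm (Q (t / 2 ^ n) f) \<le> exp (\<omega> * (t / 2 ^ n)) * nm f"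
  using assms(3)
proof (induction n arbitrary: f)
  case (Suc n)
  have eq: "t / 2 ^ Suc n = t / 2 ^ n / 2" by simp
  show ?case unfolding eq using Suc assms(1) by (intro Q_half_norm_bound) auto
qed (use assms in simp)

lemma Q_exp_norm_bound:
  assumes "0 < t"
  obtains \<omega> where "\<And>f. f \<in> L2 \<mu> \<Longrightarrow> nm (Q t f) \<le> exp (\<omega> * t) * nm f"
proof -
  obtain C where C: "0 \<le> C" "\<And>f. f \<in> L2 \<mu> \<Longrightarrow> nm (Q t f) \<le> C * nm f"
    using Q_norm_bound[OF assms] by blast
  have "nm (Q t f) \<le> exp ((C / t) * t) * nm f" if "f \<in> L2 \<mu>" for f
  proof -
    \<comment> \<open>Absorbing the constant as \<open>C \<le> exp C\<close> also covers
      \<open>C = 0\<close>, where a logarithm would not do.\<close>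
    have "C \<le> exp C" using exp_ge_add_one_self[of C] by linarith
    then have "C * nm f \<le> exp C * nm f" by (intro mult_right_mono) auto
    then show ?thesis using C(2)[OF that] assms by simp
  qed
  then show thesis using that by blast
qed

lemma filterlim_dyadic: "0 < t \<Longrightarrow> filterlim (\<lambda>n. t / 2 ^ n) (at_right (0::real)) sequentially"
  by (auto simp: filterlim_at intro!: LIMSEQ_divide_realpow_zero)

text \<open>By \<open>Q_half_norm_sq\<close> the zero descends to all times
  \<open>t / 2 ^ n\<close>; strong continuity carries it to \<open>f\<close>.\<close>

lemma Q_injective:
  assumes "0 < t" "f \<in> L2 \<mu>" "nm (Q t f) = 0"
  shows "nm f = 0"
proof -
  have zero: "nm (Q (t / 2 ^ n) f) = 0" for n
  proof (induction n)
    case (Suc n)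
    have "\<bar>ip (Q (t / 2 ^ n) f) f\<bar> \<le> nm (Q (t / 2 ^ n) f) * nm f"
      using assms by (intro L2_Cauchy_Schwarz) auto
    then have "(nm (Q (t / 2 ^ n / 2) f))\<^sup>2 = 0"
      using Suc assms by (subst Q_half_norm_sq) auto
    moreover have "t / 2 ^ Suc n = t / 2 ^ n / 2" by simp
    ultimately show ?case by (simp only: power_eq_0_iff)
  qed (use assms in simp)
  have "(\<lambda>n. nm (\<lambda>x. Q (t / 2 ^ n) f x - f x)) \<longlonglongrightarrow> 0"
    by (rule filterlim_compose[OF Q_tendsto[OF assms(2)] filterlim_dyadic[OF assms(1)]])
  from tendsto_L2_norm[OF assms(2) _ this] show ?thesis
    using zero LIMSEQ_unique[OF _ tendsto_const] by simp
qed

lemma kernel: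
  assumes "0 < t"
  obtains k where "k \<in> L2 \<mu>" "\<And>f. f \<in> L2 \<mu> \<Longrightarrow> ip k f = Q t f x" "AE y in \<mu>. 0 \<le> k y"
proof -
  let ?G = "{(f, Q t f x) | f. f \<in> L2 \<mu>}"
  obtain C where C: "\<And>f. f \<in> L2 \<mu> \<Longrightarrow> \<bar>Q t f x\<bar> \<le> C * nm f"
    using Q_sup_bound[OF assms] by metis
  obtain k where k: "k \<in> L2 \<mu>" "\<And>v c. (v, c) \<in> ?G \<Longrightarrow> ip k v = c"
  proof (rule L2_Riesz_representation[of ?G C])
    show "((\<lambda>x. 0), 0) \<in> ?G" using Q_zero[OF assms] by force
    show "((\<lambda>x. a * v x + b * w x), a * c + b * d) \<in> ?G"
      if "(v, c) \<in> ?G" "(w, d) \<in> ?G" for v c w d a b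
      using that Q_lincomb[OF assms, of v w a b] by auto
  qed (use C in auto)
  then have kQ: "ip k f = Q t f x" if "f \<in> L2 \<mu>" for f using that by blast
  \<comment> \<open>Testing \<open>k\<close> against its own negative part gives
    \<open>- ip n n\<close>, while positivity of \<open>Q t\<close> makes the same number
    nonnegative.\<close>
  define n where "n y = max (- k y) 0" for y
  have n: "n \<in> L2 \<mu>" unfolding n_def[abs_def] using k(1) by simp
  have "0 \<le> ip k n" unfolding kQ[OF n] using assms n by (intro Q_nonneg) (auto simp: n_def)
  also have "ip k n = - ip n n"
    unfolding L2_inner_def by (subst integral_minus[symmetric], intro Bochner_Integration.integral_cong) (auto simp: n_def max_def)
  finally have "nm n = 0" using L2_inner_self_nonneg[of \<mu> n] by (simp add: L2_norm_def)
  then have "AE y in \<mu>. n y = 0" using L2_norm_eq_0_iff[OF n] by simp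
  then have "AE y in \<mu>. 0 \<le> k y" by eventually_elim (simp add: n_def max_def split: if_splits)
  with k(1) kQ show thesis using that by blast
qed

text \<open>For small \<open>h\<close>, the moments of a rescaled \<open>Q h\<close> are the values
  of \<open>ip (Q r f) g\<close> at multiples of \<open>h\<close>. Those with
  \<open>r \<le> s\<close> vanish, and \<open>L2_moment_bound\<close> estimates the one at time
  \<open>t\<close>. The bound is of order \<open>1 / sqrt N\<close> as the grid is refined.\<close>

theorem unique_continuation:
  assumes f: "f \<in> L2 \<mu>" and g: "g \<in> L2 \<mu>" and s: "0 < s"
    and zero: "ip f g = 0" "\<And>r. 0 < r \<Longrightarrow> r \<le> s \<Longrightarrow> ip (Q r f) g = 0" and t: "0 < t"
  shows "ip (Q t f) g = 0"
proof -
  obtain M :: nat where M: "t / s \<le> real M" using real_arch_simple by blast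
  have "t / s > 0" using s t by simp
  with M have M0: "M > 0" by (cases M) auto
  \<comment> \<open>The interval is shortened so that \<open>t\<close> is an exact multiple of it
    and therefore a grid point for every \<open>N\<close>.\<close>
  define s' where "s' = t / real M"
  have s': "0 < s'" "s' \<le> s" "real M * s' = t"
    using M M0 s t by (auto simp: s'_def field_simps)
  obtain \<omega> where \<omega>: "\<And>f. f \<in> L2 \<mu> \<Longrightarrow> nm (Q s' f) \<le> exp (\<omega> * s') * nm f"
    using Q_exp_norm_bound[OF s'(1)] by blast
  \<comment> \<open>The extra 1 turns the rescaled step into a strict contraction with ratio
    \<open>exp (- 1 / N)\<close>.\<close>
  define \<alpha> where "\<alpha> = \<omega> * s' + 1"
  have le: "exp (- \<alpha> * real M) * \<bar>ip (Q t f) g\<bar> \<le> nm f * nm g * real M * sqrt (2 / 2 ^ n)" for n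
  proof -
    \<comment> \<open>Powers of 2 are chosen because the norm bound with unchanged rate is available
      at dyadic fractions of \<open>s'\<close>.\<close>
    define N :: nat where "N = 2 ^ n"
    have N: "N > 0" "real N \<ge> 1" by (auto simp: N_def)
    define h where "h = s' / real N"
    have h: "0 < h" using s' N by (simp add: h_def)
    define c where "c = exp (- \<alpha> / real N)"
    define T where "T f = (\<lambda>x. c * Q h f x)" for f
    define \<rho> where "\<rho> = exp (- 1 / real N)"
    have T_pow: "(T ^^ Suc j) u = (\<lambda>x. c ^ Suc j * Q (real (Suc j) * h) u x)" if "u \<in> L2 \<mu>" for j u
    proof (induction j)
      case (Suc j)
      have "(T ^^ Suc (Suc j)) u = T (\<lambda>x. c ^ Suc j * Q (real (Suc j) * h) u x)"
        using Suc by simp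
      also have "\<dots> = (\<lambda>x. c ^ Suc (Suc j) * Q h (Q (real (Suc j) * h) u) x)"
        using h by (simp add: T_def Q_mult mult.assoc)
      also have "Q h (Q (real (Suc j) * h) u) = Q (real (Suc (Suc j)) * h) u"
      proof -
        have "h + real (Suc j) * h = real (Suc (Suc j)) * h" by (simp add: algebra_simps)
        moreover have "0 < real (Suc j) * h" using h by simp
        ultimately show ?thesis using Q_semigroup[OF h _ that, of "real (Suc j) * h"] by simp
      qed
      finally show ?case .
    qed (simp add: T_def)
    have contr: "nm (T u) \<le> \<rho> * nm u" if "u \<in> L2 \<mu>" for u
    proof -
      have "nm (T u) = c * nm (Q h u)" by (simp add: T_def L2_norm_mult c_def)
      also have "\<dots> \<le> c * (exp (\<omega> * h) * nm u)"
        using Q_dyadic_norm_bound[OF s'(1) \<omega> that, of n]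
        by (intro mult_left_mono) (auto simp: h_def N_def c_def)
      also have "\<dots> = \<rho> * nm u"
      proof -
        have "c * exp (\<omega> * h) = exp (- \<alpha> / real N + \<omega> * h)" by (simp add: c_def flip: exp_add)
        also have "- \<alpha> / real N + \<omega> * h = - 1 / real N"
          using N by (simp add: \<alpha>_def h_def field_simps)
        finally show ?thesis by (simp add: \<rho>_def flip: mult.assoc)
      qed
      finally show ?thesis .
    qed
    \<comment> \<open>A gap \<open>1 - \<rho>\<close> of order \<open>1 / N\<close> costs a factor
      of order \<open>sqrt N\<close>. The ratio of \<open>M * N\<close> to the square of
      \<open>N\<close> more than compensates for it.\<close>
    have "\<rho> * (1 + 1 / real N) \<le> \<rho> * exp (1 / real N)"
      by (intro mult_left_mono exp_ge_add_one_self) (auto simp: \<rho>_def)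
    then have "\<rho> * (1 + 1 / real N) \<le> 1" by (simp add: \<rho>_def flip: exp_add)
    then have "\<rho> \<le> real N / (real N + 1)" using N by (simp add: field_simps)
    also have "\<dots> \<le> 1 - 1 / (2 * real N)" using N by (simp add: field_simps)
    finally have gap: "1 / (2 * real N) \<le> 1 - \<rho>" by simp
    have "0 < 1 / (2 * real N)" using N by simp
    with gap have \<rho>1: "\<rho> < 1" by linarith
    have "1 / sqrt (1 - \<rho>) \<le> 1 / sqrt (1 / (2 * real N))"
      using gap N by (intro divide_left_mono) (auto intro!: mult_pos_pos simp: \<rho>1)
    then have inv: "1 / sqrt (1 - \<rho>) \<le> sqrt (2 * real N)"
      by (simp add: real_sqrt_divide real_sqrt_mult)
    have bound: "\<bar>ip ((T ^^ (M * N)) f) g\<bar> \<le> nm f * nm g / sqrt (1 - \<rho>) * real (M * N) / (real N)\<^sup>2"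
    proof (rule L2_moment_bound[OF _ _ contr _ \<rho>1 f g _ N(1)])
      show "ip (T u) v = ip u (T v)" if "u \<in> L2 \<mu>" "v \<in> L2 \<mu>" for u v
        using Q_symmetric[OF h that] by (simp add: T_def)
      show "ip ((T ^^ j) f) g = 0" if "j \<le> N" for j
      proof (cases j)
        case (Suc i)
        have "real (Suc i) * h \<le> real N * h" using that Suc h by (intro mult_right_mono) auto
        also have "\<dots> = s'" using N by (simp add: h_def)
        finally have "ip (Q (real (Suc i) * h) f) g = 0" using s' h by (intro zero(2)) auto
        then show ?thesis unfolding Suc T_pow[OF f] by simp
      qed (simp add: zero)
    qed (auto simp: T_def \<rho>_def)
    have "M * N > 0" using M0 N by simp
    then obtain i where i: "M * N = Suc i" by (cases "M * N") auto
    have "real (M * N) * h = t" using s' N by (simp add: h_def)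
    moreover have "c ^ (M * N) = exp (- \<alpha> * real M)"
    proof -
      have "c ^ (M * N) = exp (real (M * N) * (- \<alpha> / real N))" unfolding c_def by (rule exp_of_nat_mult[symmetric])
      also have "real (M * N) * (- \<alpha> / real N) = - \<alpha> * real M" using N by simp
      finally show ?thesis .
    qed
    ultimately have "(T ^^ (M * N)) f = (\<lambda>x. exp (- \<alpha> * real M) * Q t f x)"
      using T_pow[OF f, of i] i by simp
    then have "exp (- \<alpha> * real M) * \<bar>ip (Q t f) g\<bar> = \<bar>ip ((T ^^ (M * N)) f) g\<bar>"
      by (simp add: abs_mult)
    also have "\<dots> \<le> nm f * nm g * (1 / sqrt (1 - \<rho>)) * (real (M * N) / (real N)\<^sup>2)"
      using bound by simp
    also have "\<dots> \<le> nm f * nm g * sqrt (2 * real N) * (real (M * N) / (real N)\<^sup>2)"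
      using inv by (intro mult_right_mono mult_left_mono) auto
    also have "\<dots> = nm f * nm g * real M * sqrt (2 / real N)"
      using N by (simp add: real_sqrt_mult real_sqrt_divide power2_eq_square field_simps)
    finally show ?thesis by (simp add: N_def)
  qed
  have "(\<lambda>n. nm f * nm g * real M * sqrt (2 / 2 ^ n)) \<longlonglongrightarrow> nm f * nm g * real M * sqrt 0"
    by (intro tendsto_intros LIMSEQ_divide_realpow_zero) simp
  then have "exp (- \<alpha> * real M) * \<bar>ip (Q t f) g\<bar> \<le> nm f * nm g * real M * sqrt 0"
    by (rule LIMSEQ_le_const) (use le in blast)
  then show ?thesis by (simp add: mult_le_0_iff)
qed

subsection \<open>Propagation of zeros\<close>

lemma inner_zero_earlier:
  assumes f: "f \<in> L2 \<mu>" "AE x in \<mu>. 0 \<le> f x" and k: "k \<in> L2 \<mu>" "AE x in \<mu>. 0 \<le> k x"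
    and r: "0 < r" "r \<le> t" and zero: "ip k (Q t f) = 0"
  shows "ip k (Q r f) = 0"
proof (cases "r = t")
  case False
  define d where "d = t - r"
  have d: "d > 0" using r False by (simp add: d_def)
  \<comment> \<open>This minimum lies below both \<open>k\<close> and \<open>Q r f\<close>, so
    \<open>ip (Q d h) h\<close> is at most \<open>ip k (Q t f) = 0\<close>. Injectivity gives
    \<open>h = 0\<close>: the two functions have disjoint supports up to null sets.\<close>
  define h where "h x = min (k x) (Q r f x)" for x
  have h: "h \<in> L2 \<mu>" unfolding h_def[abs_def] using k by simp
  have Qf: "0 \<le> Q r f x" for x using Q_nonneg[OF r(1) f] .
  have h0: "AE x in \<mu>. 0 \<le> h x" using k(2) by eventually_elim (simp add: h_def Qf)
  have "(nm (Q (d / 2) h))\<^sup>2 = ip (Q d h) h" using d h by (rule Q_half_norm_sq)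
  also have "\<dots> \<le> ip (Q d (Q r f)) h"
    by (rule L2_inner_mono[OF Q_L2 Q_L2 h _ h0]) (intro AE_I2 Q_mono[OF d h], auto simp: h_def)
  also have "\<dots> = ip h (Q d (Q r f))" by (rule L2_inner_commute)
  also have "\<dots> \<le> ip k (Q d (Q r f))"
    by (rule L2_inner_mono[OF h k(1) Q_L2]) (use Q_nonneg[OF d] Qf in \<open>auto simp: h_def\<close>)
  also have "\<dots> = ip k (Q t f)"
    using Q_semigroup[OF d r(1) f(1)] by (simp add: d_def)
  finally have "nm (Q (d / 2) h) = 0" using zero by simp
  then have "nm h = 0" using Q_injective[of "d / 2" h] d h by simp
  then have "AE x in \<mu>. h x = 0" using L2_norm_eq_0_iff[OF h] by simp
  then have "AE x in \<mu>. k x * Q r f x = 0"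
    by eventually_elim (auto simp: h_def min_def split: if_splits)
  then show ?thesis unfolding L2_inner_def by (rule integral_eq_zero_AE)
qed (use zero in simp)

theorem Q_zero_propagates:
  assumes f: "f \<in> L2 \<mu>" "AE x in \<mu>. 0 \<le> f x" and t0: "0 < t0" and zero: "Q t0 f x = 0" and t: "0 < t"
  shows "Q t f x = 0"
proof -
  \<comment> \<open>The time \<open>a\<close> is spent on turning evaluation at \<open>x\<close>
    into the inner product with a kernel; the remaining times \<open>t - a\<close> and
    \<open>t0 - a\<close> stay positive.\<close>
  define a where "a = min t t0 / 2"
  have a: "0 < a" "a < t" "a < t0" using t t0 by (auto simp: a_def)
  obtain k where k: "k \<in> L2 \<mu>" "\<And>f. f \<in> L2 \<mu> \<Longrightarrow> ip k f = Q a f x" "AE y in \<mu>. 0 \<le> k y"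
    using kernel[OF a(1)] by blast
  have kQ: "ip k (Q r f) = Q (a + r) f x" if "0 < r" for r
    using k(2)[OF Q_L2] Q_semigroup[OF a(1) that f(1)] by simp
  have "ip k (Q (t0 - a) f) = 0" using kQ[of "t0 - a"] a zero by simp
  then have early: "ip (Q r f) k = 0" if "0 < r" "r \<le> t0 - a" for r
    using inner_zero_earlier[OF f k(1,3) that] L2_inner_commute[of \<mu> "Q r f" k] by simp
  have "ip f k = 0"
  proof (rule tendsto_unique)
    show "((\<lambda>r. ip (Q r f) k) \<longlongrightarrow> ip f k) (at_right 0)"
      using f k by (intro tendsto_L2_inner Q_tendsto) auto
    have "\<forall>\<^sub>F r in at_right 0. 0 = ip (Q r f) k"
      using a early by (intro eventually_at_rightI[of 0 "t0 - a"]) (auto simp: early)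
    then show "((\<lambda>r. ip (Q r f) k) \<longlongrightarrow> 0) (at_right 0)"
      by (rule Lim_transform_eventually[OF tendsto_const])
  qed simp
  have "ip (Q (t - a) f) k = 0"
    by (rule unique_continuation[OF f(1) k(1) _ \<open>ip f k = 0\<close> early]) (use a in simp_all)
  then show ?thesis using kQ[of "t - a"] a L2_inner_commute[of \<mu> "Q (t - a) f" k] by simp
qed


subsection \<open>Irreducibility\<close>

lemma C_part_apply: "apply_bcontfun (C_part \<mu> S t F) = Q t (apply_bcontfun F)"
  by (simp add: C_part_def Q_def)

lemma continuous_bcontfun_functional:
  fixes \<phi> :: "('a \<Rightarrow>\<^sub>C real) \<Rightarrow> real"
  assumes "\<And>F G. \<bar>\<phi> F - \<phi> G\<bar> \<le> C * dist F G"
  shows "continuous_on X \<phi>"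
proof -
  have "\<bar>C\<bar>-lipschitz_on X \<phi>"
  proof (rule lipschitz_onI)
    fix F G
    have "dist (\<phi> F) (\<phi> G) \<le> C * dist F G" using assms by (simp add: dist_real_def)
    also have "\<dots> \<le> \<bar>C\<bar> * dist F G" by (intro mult_right_mono) auto
    finally show "dist (\<phi> F) (\<phi> G) \<le> \<bar>C\<bar> * dist F G" .
  qed simp
  then show ?thesis by (rule lipschitz_on_continuous_on)
qed

lemma abs_apply_bcontfun_diff_le: "\<bar>apply_bcontfun F x - apply_bcontfun G x\<bar> \<le> dist F G"
  for F G :: "'a \<Rightarrow>\<^sub>C real"
  using dist_bounded[of F x G] by (simp add: dist_real_def)

lemma Q_vanishes_if_one:
  assumes "0 < t" "Q t (\<lambda>x. 1) x = 0" "continuous_on UNIV f"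
  shows "Q t f x = 0"
proof -
  obtain B where B: "0 \<le> B" "\<And>x. \<bar>f x\<bar> \<le> B" using continuous_bounded[OF assms(3)] by blast
  have f: "f \<in> L2 \<mu>" using assms(3) by (rule continuous_L2)
  have "\<bar>Q t f x\<bar> \<le> Q t (\<lambda>x. \<bar>f x\<bar>) x" by (rule Q_abs_le[OF assms(1) f])
  also have "\<dots> \<le> Q t (\<lambda>x. B * 1) x" using f B by (intro Q_mono[OF assms(1)]) auto
  also have "\<dots> = 0" using assms(2) by (simp only: Q_mult[OF assms(1) L2_const] mult_zero_right)
  finally show ?thesis by simp
qed

lemma one_not_null: "nm (\<lambda>x. 1) \<noteq> 0"
proof
  assume "nm (\<lambda>x. 1) = 0"
  then have "AE x in \<mu>. (1::real) = 0" using L2_norm_eq_0_iff[of "\<lambda>x. 1" \<mu>] by simp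
  then have "(\<lambda>x::'a. 1::real) = (\<lambda>x. 0)" by (intro continuous_AE_eq) auto
  then show False by (simp add: fun_eq_iff)
qed

lemma irreducible_imp_nondegenerate:
  assumes irr: "C_irreducible (C_part \<mu> S)"
  shows "\<exists>t>0. \<exists>F. apply_bcontfun (C_part \<mu> S t F) x \<noteq> 0"
proof (rule ccontr)
  assume "\<not> ?thesis"
  then have zero: "apply_bcontfun (C_part \<mu> S t F) x = 0" if "0 < t" for t F using that by blast
  define I where "I = {F :: 'a \<Rightarrow>\<^sub>C real. apply_bcontfun F x = 0}"
  have "continuous_on UNIV (\<lambda>F :: 'a \<Rightarrow>\<^sub>C real. apply_bcontfun F x)"
    using abs_apply_bcontfun_diff_le by (intro continuous_bcontfun_functional[of _ 1]) simp
  then have "closed I" unfolding I_def by (intro closed_Collect_eq continuous_on_const)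
  moreover have "C_ideal I" unfolding C_ideal_def
  proof (intro conjI ballI allI impI)
    show "subspace I"
      by (auto simp: subspace_def I_def zero_bcontfun.rep_eq plus_bcontfun.rep_eq scaleR_bcontfun.rep_eq)
  next
    fix u v assume "u \<in> I" "\<forall>x. 0 \<le> apply_bcontfun v x \<and> apply_bcontfun v x \<le> apply_bcontfun u x"
    then show "v \<in> I" unfolding I_def by (metis antisym mem_Collect_eq)
  qed (auto simp: I_def)
  moreover have "\<forall>t>0. C_part \<mu> S t ` I \<subseteq> I" using zero by (auto simp: I_def)
  ultimately have "I = {0} \<or> I = UNIV" using irr unfolding C_irreducible_def by blast
  then show False
  proof
    assume "I = UNIV"
    then have "const_bcontfun 1 \<in> I" by simp
    then show False by (simp add: I_def const_bcontfun.rep_eq)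
  next
    assume I0: "I = {0}"
    \<comment> \<open>The distance to \<open>x\<close> belongs to \<open>I\<close> and vanishes only
      at \<open>x\<close>, so \<open>I = {0}\<close> leaves no other point.\<close>
    obtain D :: "'a \<Rightarrow>\<^sub>C real" where D: "apply_bcontfun D = (\<lambda>y. dist y x)"
      by (rule continuous_bcontfun[of "\<lambda>y. dist y x"]) (auto intro!: continuous_intros)
    then have "D \<in> I" by (simp add: I_def)
    then have "D = 0" using I0 by simp
    then have single: "y = x" for y using fun_cong[OF D, of y] by (simp add: zero_bcontfun.rep_eq)
    have "Q 1 (\<lambda>y. 1) x = 0" using zero[of 1 "const_bcontfun 1"] by (simp add: C_part_apply const_bcontfun.rep_eq)
    then have "Q 1 (\<lambda>y. 1) = (\<lambda>y. 0)" using single by (metis ext)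
    then show False using Q_injective[of 1 "\<lambda>y. 1"] one_not_null by simp
  qed
qed

theorem irreducible_imp_strictly_positive:
  assumes irr: "C_irreducible (C_part \<mu> S)"
    and F: "\<And>y. 0 \<le> apply_bcontfun F y" "F \<noteq> 0" and t: "0 < t"
  shows "0 < apply_bcontfun (C_part \<mu> S t F) x"
proof (rule ccontr)
  assume "\<not> ?thesis"
  moreover have "0 \<le> Q t (apply_bcontfun F) x" using F by (intro Q_nonneg[OF t]) auto
  ultimately have "Q t (apply_bcontfun F) x = 0" by (simp add: C_part_apply)
  then have zero: "Q r (apply_bcontfun F) x = 0" if "0 < r" for r
    using F(1) by (intro Q_zero_propagates[OF bcontfun_L2 _ t _ that]) simp_all
  let ?abs = "\<lambda>G :: 'a \<Rightarrow>\<^sub>C real. \<lambda>y. \<bar>apply_bcontfun G y\<bar>"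
  \<comment> \<open>Requiring the zero at all times makes \<open>J\<close> invariant: the condition
    at \<open>r\<close> for the image under time \<open>s\<close> is dominated by the condition at
    \<open>r + s\<close>.\<close>
  define J where "J = {G :: 'a \<Rightarrow>\<^sub>C real. \<forall>r>0. Q r (?abs G) x = 0}"
  have J_dominated: "v \<in> J" if u: "u \<in> J" and le: "\<And>y. \<bar>apply_bcontfun v y\<bar> \<le> \<bar>apply_bcontfun u y\<bar>" for u v
  proof -
    have "Q r (?abs v) x = 0" if "0 < r" for r
    proof (rule antisym)
      have "Q r (?abs v) x \<le> Q r (?abs u) x" using le by (intro Q_mono that) auto
      then show "Q r (?abs v) x \<le> 0" using u that by (simp add: J_def)
      show "0 \<le> Q r (?abs v) x" using that by (intro Q_nonneg) auto
    qed
    then show ?thesis by (simp add: J_def)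
  qed
  have "closed J"
  proof -
    have cont: "continuous_on UNIV (\<lambda>G. Q r (?abs G) x)" if "0 < r" for r
    proof (rule continuous_bcontfun_functional)
      fix G H
      have "\<bar>Q r (?abs G) x - Q r (?abs H) x\<bar> = \<bar>Q r (\<lambda>y. ?abs G y - ?abs H y) x\<bar>"
        by (simp add: Q_diff that)
      also have "\<dots> \<le> Q r (\<lambda>y. \<bar>?abs G y - ?abs H y\<bar>) x" by (intro Q_abs_le that) simp
      also have "\<dots> \<le> Q r (\<lambda>y. dist G H * 1) x"
        using abs_apply_bcontfun_diff_le
        by (intro Q_mono that AE_I2) (auto intro: order_trans[OF abs_triangle_ineq3])
      also have "\<dots> = Q r (\<lambda>y. 1) x * dist G H" 
        using fun_cong[OF Q_mult[OF that L2_const[of 1], of "dist G H"], of x] by (simp add: mult.commute)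
      finally show "\<bar>Q r (?abs G) x - Q r (?abs H) x\<bar> \<le> Q r (\<lambda>y. 1) x * dist G H" .
    qed
    have "J = (\<Inter>r\<in>{0<..}. {G. Q r (?abs G) x = 0})" by (auto simp: J_def)
    then show ?thesis using cont by (auto intro!: closed_INT closed_Collect_eq continuous_on_const)
  qed
  moreover have "C_ideal J" unfolding C_ideal_def
  proof (intro conjI ballI allI impI)
    show "subspace J" unfolding subspace_def
    proof (intro conjI ballI allI)
      show "0 \<in> J" by (simp add: J_def zero_bcontfun.rep_eq Q_zero)
      fix u assume u: "u \<in> J"
      show "c *\<^sub>R u \<in> J" for c
        using u by (simp add: J_def scaleR_bcontfun.rep_eq abs_mult Q_mult)
      fix v assume v: "v \<in> J"
      have "Q r (?abs (u + v)) x = 0" if "0 < r" for r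
      proof (rule antisym)
        have "Q r (?abs (u + v)) x \<le> Q r (\<lambda>y. ?abs u y + ?abs v y) x"
          by (intro Q_mono that) (auto simp: plus_bcontfun.rep_eq intro: abs_triangle_ineq)
        also have "\<dots> = 0" using u v that by (simp add: J_def Q_add)
        finally show "Q r (?abs (u + v)) x \<le> 0" .
        show "0 \<le> Q r (?abs (u + v)) x" using that by (intro Q_nonneg) auto
      qed
      then show "u + v \<in> J" by (simp add: J_def)
    qed
  next
    fix u w assume "u \<in> J" "\<forall>x. apply_bcontfun w x = \<bar>apply_bcontfun u x\<bar>"
    then show "w \<in> J" using J_dominated[of u w] by simp
  next
    fix u v assume "u \<in> J" "\<forall>x. 0 \<le> apply_bcontfun v x \<and> apply_bcontfun v x \<le> apply_bcontfun u x"
    then show "v \<in> J" using J_dominated[of u v] by (simp add: order_trans[OF _ abs_ge_self])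
  qed
  moreover have "\<forall>s>0. C_part \<mu> S s ` J \<subseteq> J"
  proof (intro allI impI subsetI)
    fix s G' assume s: "0 < (s::real)" and "G' \<in> C_part \<mu> S s ` J"
    then obtain G where G: "G \<in> J" "G' = C_part \<mu> S s G" by blast
    have "Q r (?abs G') x = 0" if "0 < r" for r
    proof (rule antisym)
      have "Q r (?abs G') x \<le> Q r (Q s (?abs G)) x"
        using Q_abs_le[OF s bcontfun_L2, of G] by (intro Q_mono that) (auto simp: G(2) C_part_apply)
      also have "\<dots> = Q (r + s) (?abs G) x" using that s by (simp add: Q_semigroup)
      also have "\<dots> = 0" using G(1) that s by (simp add: J_def)
      finally show "Q r (?abs G') x \<le> 0" .
      show "0 \<le> Q r (?abs G') x" using that by (intro Q_nonneg) auto
    qed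
    then show "G' \<in> J" by (simp add: J_def)
  qed
  moreover have "J \<noteq> {0}"
  proof -
    have "?abs F = apply_bcontfun F" using F(1) by simp
    then have "F \<in> J" using zero by (simp add: J_def)
    then show ?thesis using F(2) by blast
  qed
  ultimately have "J = UNIV" using irr unfolding C_irreducible_def by blast
  then have "const_bcontfun 1 \<in> J" by simp
  then have one: "Q r (\<lambda>y. 1) x = 0" if "0 < r" for r using that by (simp add: J_def const_bcontfun.rep_eq)
  obtain r G where "0 < r" "apply_bcontfun (C_part \<mu> S r G) x \<noteq> 0"
    using irreducible_imp_nondegenerate[OF irr] by blast
  then show False using Q_vanishes_if_one[OF _ one] by (simp add: C_part_apply)
qed

text \<open>This is the substantial half of the description of closed ideals by zero sets. For
  \<open>P \<ge> 0\<close>, cutting off at height \<open>\<epsilon>\<close> leaves a function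
  supported in a compact set off the common zeros, where finitely many ideal elements suffice to
  dominate it; the cut-off functions approximate \<open>P\<close>.\<close>

lemma C_ideal_eq_vanishing:
  fixes I :: "('a \<Rightarrow>\<^sub>C real) set"
  assumes I: "C_ideal I" "closed I"
    and F: "\<And>x. (\<And>u. u \<in> I \<Longrightarrow> apply_bcontfun u x = 0) \<Longrightarrow> apply_bcontfun F x = 0"
  shows "F \<in> I"
proof -
  have sub: "subspace I" using I(1) by (simp add: C_ideal_def)
  have I_abs: "w \<in> I" if "u \<in> I" "\<And>x. apply_bcontfun w x = \<bar>apply_bcontfun u x\<bar>" for u w
    using I(1) that unfolding C_ideal_def by blast
  have I_le: "v \<in> I" if "u \<in> I" "\<And>x. 0 \<le> apply_bcontfun v x" "\<And>x. apply_bcontfun v x \<le> apply_bcontfun u x" for u v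
    using I(1) that unfolding C_ideal_def by blast
  have nonneg: "P \<in> I"
    if P: "\<And>x. 0 \<le> apply_bcontfun P x"
      "\<And>x. (\<And>u. u \<in> I \<Longrightarrow> apply_bcontfun u x = 0) \<Longrightarrow> apply_bcontfun P x = 0"
    for P :: "'a \<Rightarrow>\<^sub>C real"
  proof -
    have "\<exists>H\<in>I. dist H P < e" if "e > 0" for e
    proof -
      define \<epsilon> where "\<epsilon> = e / 2"
      have "\<epsilon> > 0" using that by (simp add: \<epsilon>_def)
      define K where "K = {x. \<epsilon> \<le> apply_bcontfun P x}"
      have "closed K" unfolding K_def by (intro closed_Collect_le continuous_intros) auto
      then have K: "compact K" using compact_space by (metis compact_Int_closed inf_top_left)
      obtain H :: "'a \<Rightarrow>\<^sub>C real" where H: "apply_bcontfun H = (\<lambda>x. max (apply_bcontfun P x - \<epsilon>) 0)"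
        by (rule continuous_bcontfun[of "\<lambda>x. max (apply_bcontfun P x - \<epsilon>) 0"])
           (auto intro!: continuous_intros)
      have "K \<subseteq> (\<Union>u\<in>I. {x. apply_bcontfun u x \<noteq> 0})"
      proof
        fix x assume "x \<in> K"
        then have "apply_bcontfun P x \<noteq> 0" using \<open>\<epsilon> > 0\<close> by (auto simp: K_def)
        then show "x \<in> (\<Union>u\<in>I. {x. apply_bcontfun u x \<noteq> 0})" using P(2)[of x] by blast
      qed
      moreover have "open {x. apply_bcontfun u x \<noteq> 0}" for u :: "'a \<Rightarrow>\<^sub>C real"
        by (intro open_Collect_neq continuous_intros) auto
      ultimately obtain D where D: "D \<subseteq> I" "finite D" "K \<subseteq> (\<Union>u\<in>D. {x. apply_bcontfun u x \<noteq> 0})"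
        using compactE_image[OF K, of I "\<lambda>u. {x. apply_bcontfun u x \<noteq> 0}"] by metis
      have "\<exists>w. w \<in> I \<and> apply_bcontfun w = (\<lambda>x. \<bar>apply_bcontfun u x\<bar>)" if "u \<in> I" for u
      proof -
        obtain w :: "'a \<Rightarrow>\<^sub>C real" where w: "apply_bcontfun w = (\<lambda>x. \<bar>apply_bcontfun u x\<bar>)"
          by (rule continuous_bcontfun[of "\<lambda>x. \<bar>apply_bcontfun u x\<bar>"]) (auto intro!: continuous_intros)
        then show ?thesis using I_abs[OF that, of w] w by auto
      qed
      then obtain a where a: "\<And>u. u \<in> I \<Longrightarrow> a u \<in> I"
          "\<And>u. u \<in> I \<Longrightarrow> apply_bcontfun (a u) = (\<lambda>x. \<bar>apply_bcontfun u x\<bar>)" by metis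
      \<comment> \<open>Absolute values prevent cancellation, so \<open>g\<close> is positive on
        \<open>K\<close> and, by compactness, bounded below there.\<close>
      define g where "g = (\<Sum>u\<in>D. a u)"
      have "g \<in> I" unfolding g_def using D a sub by (intro subspace_sum) auto
      have g_apply: "apply_bcontfun g x = (\<Sum>u\<in>D. \<bar>apply_bcontfun u x\<bar>)" for x
      proof -
        have "apply_bcontfun (\<Sum>u\<in>D. a u) x = (\<Sum>u\<in>D. apply_bcontfun (a u) x)"
          by (induction D rule: infinite_finite_induct) (auto simp: zero_bcontfun.rep_eq plus_bcontfun.rep_eq)
        then show ?thesis unfolding g_def using D(1) a(2) by (auto intro!: sum.cong)
      qed
      have g_pos: "0 < apply_bcontfun g x" if x: "x \<in> K" for x
      proof -
        obtain u where "u \<in> D" "apply_bcontfun u x \<noteq> 0" using D(3) x by blast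
        then show ?thesis unfolding g_apply using D(2) by (intro sum_pos2[of _ u]) auto
      qed
      have "\<exists>d>0. \<forall>x\<in>K. d \<le> apply_bcontfun g x"
      proof (cases "K = {}")
        case True
        then show ?thesis by (auto intro: exI[of _ 1])
      next
        case False
        then obtain z where "z \<in> K" "\<forall>x\<in>K. apply_bcontfun g z \<le> apply_bcontfun g x"
          using continuous_attains_inf[OF K, of "apply_bcontfun g"] by auto
        then show ?thesis using g_pos by blast
      qed
      then obtain d where d: "d > 0" "\<And>x. x \<in> K \<Longrightarrow> d \<le> apply_bcontfun g x" by blast
      obtain B where B: "0 \<le> B" "\<And>x. \<bar>apply_bcontfun P x\<bar> \<le> B"
        using continuous_bounded[of "apply_bcontfun P"] by auto
      have "H \<in> I"
      proof (rule I_le)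
        show "(B / d) *\<^sub>R g \<in> I" using \<open>g \<in> I\<close> sub by (rule subspace_scale[rotated])
        show "0 \<le> apply_bcontfun H x" for x by (simp add: H)
        show "apply_bcontfun H x \<le> apply_bcontfun ((B / d) *\<^sub>R g) x" for x
        proof (cases "x \<in> K")
          case True
          have "apply_bcontfun H x \<le> B" using B(1) B(2)[of x] \<open>\<epsilon> > 0\<close> by (simp add: H)
          also have "\<dots> = B / d * d" using d(1) by simp
          also have "\<dots> \<le> B / d * apply_bcontfun g x" using B(1) d True by (intro mult_left_mono) auto
          finally show ?thesis by (simp add: scaleR_bcontfun.rep_eq)
        next
          case False
          then have "apply_bcontfun H x = 0" by (simp add: H K_def)
          moreover have "0 \<le> apply_bcontfun g x" unfolding g_apply by (intro sum_nonneg) simp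
          ultimately show ?thesis using B(1) d(1) by (simp add: scaleR_bcontfun.rep_eq)
        qed
      qed
      moreover have "dist H P \<le> \<epsilon>"
        by (rule dist_bound) (use P(1) \<open>\<epsilon> > 0\<close> in \<open>auto simp: H dist_real_def max_def\<close>)
      ultimately show ?thesis using \<open>e > 0\<close> by (intro bexI[of _ H]) (auto simp: \<epsilon>_def)
    qed
    then have "P \<in> closure I" by (simp add: closure_approachable)
    then show ?thesis using I(2) by simp
  qed
  obtain P :: "'a \<Rightarrow>\<^sub>C real" where P: "apply_bcontfun P = (\<lambda>x. max (apply_bcontfun F x) 0)"
    by (rule continuous_bcontfun[of "\<lambda>x. max (apply_bcontfun F x) 0"]) (auto intro!: continuous_intros)
  obtain N :: "'a \<Rightarrow>\<^sub>C real" where N: "apply_bcontfun N = (\<lambda>x. max (- apply_bcontfun F x) 0)"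
    by (rule continuous_bcontfun[of "\<lambda>x. max (- apply_bcontfun F x) 0"]) (auto intro!: continuous_intros)
  have "P \<in> I" using F by (intro nonneg) (simp_all add: P)
  moreover have "N \<in> I" using F by (intro nonneg) (simp_all add: N)
  moreover have "F = P - N" by (rule bcontfun_eqI) (simp add: P N minus_bcontfun.rep_eq)
  ultimately show ?thesis using sub by (simp add: subspace_diff)
qed

theorem nondegenerate_imp_irreducible:
  assumes conn: "connected (UNIV :: 'a set)"
    and nondeg: "\<And>x. \<exists>t>0. \<exists>F. apply_bcontfun (C_part \<mu> S t F) x \<noteq> 0"
  shows "C_irreducible (C_part \<mu> S)"
  unfolding C_irreducible_def
proof (intro allI impI, elim conjE)
  fix I :: "('a \<Rightarrow>\<^sub>C real) set"
  assume I: "C_ideal I" "closed I" and inv: "\<forall>t>0. C_part \<mu> S t ` I \<subseteq> I"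
  define B where "B = {x. \<forall>u\<in>I. apply_bcontfun u x = 0}"
  have I_iff: "F \<in> I \<longleftrightarrow> (\<forall>x\<in>B. apply_bcontfun F x = 0)" for F
    using C_ideal_eq_vanishing[OF I, of F] by (auto simp: B_def)
  have "closed B"
  proof -
    have "B = (\<Inter>u\<in>I. {x. apply_bcontfun u x = 0})" by (auto simp: B_def)
    then show ?thesis by (auto intro!: closed_INT closed_Collect_eq continuous_intros)
  qed
  show "I = {0} \<or> I = UNIV"
  proof (cases "B = {} \<or> B = UNIV")
    case True
    then show ?thesis
    proof
      assume "B = {}"
      then show ?thesis using I_iff by blast
    next
      assume "B = UNIV"
      then have "F \<in> I \<longleftrightarrow> F = 0" for F
        using I_iff[of F] by (auto simp: zero_bcontfun.rep_eq intro: bcontfun_eqI)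
      then show ?thesis by blast
    qed
  next
    case False
    then have "\<not> open B" using conn \<open>closed B\<close> by (auto simp: connected_clopen)
    then have "\<not> closed (- B)" by (simp add: open_closed)
    then obtain x where x: "x \<in> B" "x \<in> closure (- B)"
      using closure_subset closure_closed by (metis ComplI closure_eq subsetI subset_antisym)
    obtain t G where t: "0 < t" "apply_bcontfun (C_part \<mu> S t G) x \<noteq> 0" using nondeg by blast
    obtain d :: "'a \<Rightarrow>\<^sub>C real" where d: "apply_bcontfun d = (\<lambda>y. infdist y B)"
      by (rule continuous_bcontfun[of "\<lambda>y. infdist y B"]) (auto intro!: continuous_intros)
    \<comment> \<open>Nonemptiness of \<open>B\<close> matters: \<open>infdist\<close> to the empty
      set is 0 by default.\<close>
    have d0: "infdist y B = 0 \<longleftrightarrow> y \<in> B" for y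
      using in_closed_iff_infdist_zero[OF \<open>closed B\<close>] False by auto
    have "d \<in> I" unfolding I_iff by (simp add: d)
    then have Qd: "Q t (\<lambda>y. infdist y B) y = 0" if "y \<in> B" for y
    proof -
      have "C_part \<mu> S t d \<in> I" using inv t(1) \<open>d \<in> I\<close> by blast
      then show ?thesis using that by (simp add: I_iff C_part_apply d)
    qed
    have dL: "(\<lambda>y. infdist y B) \<in> L2 \<mu>" using bcontfun_L2[of d] by (simp add: d)
    define b where "b y = (if y \<in> B then 1 else 0 :: real)" for y
    have "B \<in> sets \<mu>" using \<open>closed B\<close> by (simp add: sets_eq_borel)
    then have [measurable]: "b \<in> borel_measurable \<mu>" unfolding b_def[abs_def] by measurable
    have b: "b \<in> L2 \<mu>" by (rule L2_norm_bounded_le(1)[of _ 1]) (auto simp: b_def)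
    \<comment> \<open>By symmetry \<open>Q t b\<close> is orthogonal to the distance function, which
      is positive off \<open>B\<close>. So it vanishes off \<open>B\<close>, and by continuity also
      at \<open>x\<close>, a limit of such points.\<close>
    have 1: "Q t b x = 0"
    proof -
      have "ip (Q t (\<lambda>y. infdist y B)) b = 0"
        unfolding L2_inner_def by (rule integral_eq_zero_AE) (auto simp: b_def Qd)
      then have "ip (\<lambda>y. infdist y B) (Q t b) = 0" using Q_symmetric[OF t(1) dL b] by simp
      moreover have "0 \<le> infdist y B * Q t b y" for y
        using Q_nonneg[OF t(1) b] by (intro mult_nonneg_nonneg) (auto simp: b_def infdist_nonneg)
      ultimately have "AE y in \<mu>. infdist y B * Q t b y = 0"
        using integral_nonneg_eq_0_iff_AE[OF L2_mult_integrable[OF dL Q_L2, of t b]] by (simp add: L2_inner_def)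
      then have "(\<lambda>y. infdist y B * Q t b y) = (\<lambda>y. 0)"
        by (intro continuous_AE_eq) (auto intro!: continuous_intros)
      then have "infdist y B * Q t b y = 0" for y by (rule fun_cong)
      then have "Q t b y = 0" if "y \<in> - B" for y using that d0[of y] by auto
      then have "- B \<subseteq> {y. Q t b y = 0}" by blast
      moreover have "closed {y. Q t b y = 0}" by (intro closed_Collect_eq continuous_on_const Q_continuous)
      ultimately show ?thesis using closure_minimal x(2) by blast
    qed
    \<comment> \<open>The kernel at \<open>x\<close> annihilates the distance function, hence is
      null off \<open>B\<close>, which is where \<open>1 - b\<close> lives.\<close>
    have 2: "Q t (\<lambda>y. 1 - b y) x = 0"
    proof -
      obtain k where k: "k \<in> L2 \<mu>" "\<And>f. f \<in> L2 \<mu> \<Longrightarrow> ip k f = Q t f x" "AE y in \<mu>. 0 \<le> k y"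
        using kernel[OF t(1)] by blast
      have "ip k (\<lambda>y. infdist y B) = 0" using k(2)[OF dL] Qd x(1) by simp
      moreover have "AE y in \<mu>. 0 \<le> k y * infdist y B"
        using k(3) by eventually_elim (simp add: infdist_nonneg)
      ultimately have "AE y in \<mu>. k y * infdist y B = 0"
        using integral_nonneg_eq_0_iff_AE[OF L2_mult_integrable[OF k(1) dL]] by (simp add: L2_inner_def)
      then have "AE y in \<mu>. k y * (1 - b y) = 0"
        by eventually_elim (auto simp: b_def d0)
      then have "ip k (\<lambda>y. 1 - b y) = 0" unfolding L2_inner_def by (rule integral_eq_zero_AE)
      then show ?thesis using k(2) b by simp
    qed
    have "Q t (\<lambda>y. 1) x = 0" using 1 2 Q_diff[OF t(1) L2_const b, of 1] by (simp add: fun_eq_iff)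
    then show ?thesis using t Q_vanishes_if_one[OF t(1)] by (simp add: C_part_apply)
  qed
qed


subsection \<open>The bottom of the spectrum\<close>

text \<open>Linearity is read off from the adjoint, whose defining condition is linear and which
  equals \<open>A\<close>.\<close>

lemma A_lincomb:
  assumes "(f, f') \<in> A" "(g, g') \<in> A"
  shows "((\<lambda>x. a * f x + b * g x), (\<lambda>x. a * f' x + b * g' x)) \<in> A"
proof -
  have L: "f \<in> L2 \<mu>" "f' \<in> L2 \<mu>" "g \<in> L2 \<mu>" "g' \<in> L2 \<mu>" using A_L2 assms by auto
  have "((\<lambda>x. a * f x + b * g x), (\<lambda>x. a * f' x + b * g' x)) \<in> L2_adjoint \<mu> A"
    unfolding L2_adjoint_def
  proof (clarify, intro conjI ballI, goal_cases)
    case (3 p)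
    obtain u v where p: "p = (u, v)" by (cases p)
    then have "u \<in> L2 \<mu>" "v \<in> L2 \<mu>" "ip v f = ip u f'" "ip v g = ip u g'"
      using 3 A_L2 A_symmetric assms by auto
    then show ?case using L by (simp add: p L2_inner_add_right)
  qed (use L in simp_all)
  then show ?thesis using selfadjoint by (simp add: L2_selfadjoint_def)
qed

lemma A_adjointI:
  assumes "f \<in> L2 \<mu>" "g \<in> L2 \<mu>" "\<And>u v. (u, v) \<in> A \<Longrightarrow> ip v f = ip u g"
  shows "(f, g) \<in> A"
proof -
  have "(f, g) \<in> L2_adjoint \<mu> A" using assms by (auto simp: L2_adjoint_def)
  then show ?thesis using selfadjoint by (simp add: L2_selfadjoint_def)
qed

lemma tendsto_dyadic_difference_quotient:
  "(\<lambda>n. (exp (a * (1 / 2 ^ n)) - 1) / (1 / 2 ^ n)) \<longlonglongrightarrow> (a::real)"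
proof -
  have "((\<lambda>h. exp (a * h)) has_real_derivative a) (at 0)"
    by (auto intro!: derivative_eq_intros)
  then have "((\<lambda>h. (exp (a * h) - 1) / h) \<longlongrightarrow> a) (at 0)" by (simp add: DERIV_def)
  then have "((\<lambda>h. (exp (a * h) - 1) / h) \<longlongrightarrow> a) (at_right 0)" by (rule tendsto_within_subset) simp
  from filterlim_compose[OF this filterlim_dyadic[of 1]] show ?thesis by simp
qed

text \<open>The bound at time 1 descends to dyadic times \<open>h\<close> as
  \<open>ip (Q h f) f \<le> exp (- \<kappa> * h) * (nm f)\<^sup>2\<close>; comparing difference
  quotients at 0 gives the claim.\<close>

lemma A_coercive:
  assumes bound: "\<And>f. f \<in> L2 \<mu> \<Longrightarrow> nm (Q 1 f) \<le> exp (- \<kappa>) * nm f" and f: "(f, f') \<in> A"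
  shows "\<kappa> * (nm f)\<^sup>2 \<le> ip f' f"
proof -
  have L: "f \<in> L2 \<mu>" "f' \<in> L2 \<mu>" using A_L2 f by auto
  let ?h = "\<lambda>n::nat. 1 / 2 ^ n :: real"
  have "(\<lambda>n. ip (\<lambda>x. (Q (?h n) f x - f x) / ?h n + f' x) f) \<longlonglongrightarrow> ip (\<lambda>x. 0) f"
  proof (rule tendsto_L2_inner)
    show "(\<lambda>n. nm (\<lambda>x. (Q (?h n) f x - f x) / ?h n + f' x - 0)) \<longlonglongrightarrow> 0"
      using filterlim_compose[OF A_tendsto[OF f] filterlim_dyadic[of 1]] by simp
  qed (intro L2_zero L L2_add L2_divide L2_diff Q_L2)+
  then have lhs: "(\<lambda>n. ip (\<lambda>x. (Q (?h n) f x - f x) / ?h n + f' x) f) \<longlonglongrightarrow> 0" by simp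
  have rhs: "(\<lambda>n. (exp (- \<kappa> * ?h n) - 1) / ?h n * (nm f)\<^sup>2 + ip f' f) \<longlonglongrightarrow> - \<kappa> * (nm f)\<^sup>2 + ip f' f"
    by (intro tendsto_intros tendsto_dyadic_difference_quotient)
  have "ip (\<lambda>x. (Q (?h n) f x - f x) / ?h n + f' x) f
      \<le> (exp (- \<kappa> * ?h n) - 1) / ?h n * (nm f)\<^sup>2 + ip f' f" for n
  proof -
    have "ip (Q (?h n) f) f \<le> nm (Q (?h n) f) * nm f" using L2_Cauchy_Schwarz[OF Q_L2 L(1), of "?h n" f] by simp
    also have "\<dots> \<le> exp (- \<kappa> * ?h n) * nm f * nm f"
      using Q_dyadic_norm_bound[of 1 "- \<kappa>" f n] bound L by (intro mult_right_mono) auto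
    finally have "ip (Q (?h n) f) f \<le> exp (- \<kappa> * ?h n) * (nm f)\<^sup>2" by (simp add: power2_eq_square)
    then have "(ip (Q (?h n) f) f - (nm f)\<^sup>2) / ?h n \<le> (exp (- \<kappa> * ?h n) * (nm f)\<^sup>2 - (nm f)\<^sup>2) / ?h n"
      by (intro divide_right_mono) auto
    then show ?thesis
      using L by (simp only: L2_inner_add_left L2_inner_diff_left L2_inner_divide_left L2_diff L2_divide Q_L2
          L2_norm_sq left_diff_distrib diff_divide_distrib times_divide_eq_left mult_1_left)
  qed
  then have "0 \<le> - \<kappa> * (nm f)\<^sup>2 + ip f' f" using LIMSEQ_le[OF lhs rhs] by blast
  then show ?thesis by simp
qed

lemma A_lower_bound:
  assumes bound: "\<And>f. f \<in> L2 \<mu> \<Longrightarrow> nm (Q 1 f) \<le> exp (- \<kappa>) * nm f" and f: "(f, f') \<in> A"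
  shows "(\<kappa> - \<nu>) * nm f \<le> nm (\<lambda>x. f' x - \<nu> * f x)"
proof (cases "nm f = 0")
  case False
  have L: "f \<in> L2 \<mu>" "f' \<in> L2 \<mu>" using A_L2 f by auto
  have "((\<kappa> - \<nu>) * nm f) * nm f \<le> ip (\<lambda>x. f' x - \<nu> * f x) f"
    using A_coercive[OF bound f] L by (simp add: L2_inner_diff_left algebra_simps L2_norm_sq[symmetric] power2_eq_square)
  also have "\<dots> \<le> nm (\<lambda>x. f' x - \<nu> * f x) * nm f"
    using L2_Cauchy_Schwarz[of "\<lambda>x. f' x - \<nu> * f x" \<mu> f] L by simp
  finally show ?thesis
    by (rule mult_right_le_imp_le) (use False L2_norm_nonneg[of \<mu> f] in linarith)
qed simp

text \<open>By the lower bound, \<open>f' - \<nu> * f\<close> determines \<open>f\<close> stably, so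
  \<open>- ip g f\<close> is a bounded functional of it. Its representer \<open>w\<close> satisfies
  the adjoint relation, and self-adjointness places it in the domain as the solution of
  \<open>\<nu> * w - h = g\<close>.\<close>

lemma below_in_resolvent_set:
  assumes bound: "\<And>f. f \<in> L2 \<mu> \<Longrightarrow> nm (Q 1 f) \<le> exp (- \<kappa>) * nm f" and \<nu>: "\<nu> < \<kappa>"
  shows "\<nu> \<in> L2_resolvent_set \<mu> A"
proof -
  have lower: "(\<kappa> - \<nu>) * nm f \<le> nm (\<lambda>x. f' x - \<nu> * f x)" if "(f, f') \<in> A" for f f'
    using bound that by (rule A_lower_bound)
  have unique: "AE x in \<mu>. z x = 0" if "(z, z') \<in> A" "\<And>x. z' x = \<nu> * z x" for z z'
  proof -
    have "(\<kappa> - \<nu>) * nm z \<le> 0" using lower[OF that(1)] that(2) by simp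
    then have "nm z = 0" using \<nu> L2_norm_nonneg[of \<mu> z] by (simp add: mult_le_0_iff)
    then show ?thesis using L2_norm_eq_0_iff A_L2 that(1) by blast
  qed
  have "\<exists>w. (w, \<lambda>x. \<nu> * w x - g x) \<in> A" if g: "g \<in> L2 \<mu>" for g
  proof -
    let ?G = "{((\<lambda>x. v' x - \<nu> * v x), - ip g v) | v v'. (v, v') \<in> A}"
    have lin: "((\<lambda>x. a * v x + b * w x), a * c + b * d) \<in> ?G"
      if vc: "(v, c) \<in> ?G" and wd: "(w, d) \<in> ?G" for v c w d a b
    proof -
      obtain f f' where f: "(f, f') \<in> A" "v = (\<lambda>x. f' x - \<nu> * f x)" "c = - ip g f" using vc by auto
      obtain k k' where k: "(k, k') \<in> A" "w = (\<lambda>x. k' x - \<nu> * k x)" "d = - ip g k" using wd by auto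
      have L: "f \<in> L2 \<mu>" "k \<in> L2 \<mu>" using A_L2 f k by auto
      have "a * c + b * d = - ip g (\<lambda>x. a * f x + b * k x)"
        using g L by (simp add: f k L2_inner_add_right)
      moreover have "(\<lambda>x. a * v x + b * w x) = (\<lambda>x. (a * f' x + b * k' x) - \<nu> * (a * f x + b * k x))"
        by (simp add: f k algebra_simps)
      ultimately show ?thesis
        unfolding mem_Collect_eq using A_lincomb[OF f(1) k(1), of a b]
        by (intro exI[of _ "\<lambda>x. a * f x + b * k x"] exI[of _ "\<lambda>x. a * f' x + b * k' x"] conjI) (simp_all only:)
    qed
    obtain w where w: "w \<in> L2 \<mu>" "\<And>v c. (v, c) \<in> ?G \<Longrightarrow> ip w v = c"
    proof (rule L2_Riesz_representation[of ?G "nm g / (\<kappa> - \<nu>)", OF _ _ lin])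
      have "((\<lambda>x. 0), (\<lambda>x. 0)) \<in> A" by (rule A_adjointI) auto
      then show "((\<lambda>x. 0), 0) \<in> ?G"
        unfolding mem_Collect_eq by (intro exI[of _ "\<lambda>x. 0"]) simp
      show "v \<in> L2 \<mu>" if "(v, c) \<in> ?G" for v c
        using that A_L2 by auto
      show "\<bar>c\<bar> \<le> nm g / (\<kappa> - \<nu>) * nm v" if vc: "(v, c) \<in> ?G" for v c
      proof -
        obtain f f' where f: "(f, f') \<in> A" "v = (\<lambda>x. f' x - \<nu> * f x)" "c = - ip g f" using vc by auto
        have "\<bar>c\<bar> \<le> nm g * nm f" using L2_Cauchy_Schwarz[OF g, of f] A_L2[OF f(1)] by (simp add: f)
        also have "\<dots> \<le> nm g * (nm v / (\<kappa> - \<nu>))"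
          using lower[OF f(1)] \<nu> by (intro mult_left_mono) (auto simp: f field_simps)
        finally show ?thesis by simp
      qed
      fix w assume "w \<in> L2 \<mu>" "\<And>v c. (v, c) \<in> ?G \<Longrightarrow> ip w v = c"
      then show thesis by (rule that)
    qed
    have "(w, \<lambda>x. \<nu> * w x - g x) \<in> A"
    proof (rule A_adjointI)
      fix u v assume uv: "(u, v) \<in> A"
      then have "ip w (\<lambda>x. v x - \<nu> * u x) = - ip g u" by (intro w(2)) auto
      then show "ip v w = ip u (\<lambda>x. \<nu> * w x - g x)"
        using w(1) g A_L2[OF uv] L2_inner_commute[of \<mu> w v] L2_inner_commute[of \<mu> w u] L2_inner_commute[of \<mu> g u]
        by (simp add: L2_inner_diff_right)
    qed (use w g in auto)
    then show ?thesis by blast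
  qed
  then obtain R where R: "\<And>g. g \<in> L2 \<mu> \<Longrightarrow> (R g, \<lambda>x. \<nu> * R g x - g x) \<in> A" by metis
  have "L2_bounded_linear \<mu> R" unfolding L2_bounded_linear_def
  proof (intro conjI ballI allI)
    show "R f \<in> L2 \<mu>" if "f \<in> L2 \<mu>" for f using A_L2 R that by blast
    show "AE x in \<mu>. R (\<lambda>y. a * f y + b * g y) x = a * R f x + b * R g x"
      if fg: "f \<in> L2 \<mu>" "g \<in> L2 \<mu>" for f g a b
    proof -
      have "(\<lambda>y. a * f y + b * g y) \<in> L2 \<mu>" using fg by simp
      from A_lincomb[OF R[OF this] A_lincomb[OF R[OF fg(1)] R[OF fg(2)], of a b], of 1 "-1"]
      have "AE x in \<mu>. 1 * R (\<lambda>y. a * f y + b * g y) x + - 1 * (a * R f x + b * R g x) = 0"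
        by (rule unique) (simp add: algebra_simps)
      then show ?thesis by eventually_elim simp
    qed
    have "nm (R f) \<le> 1 / (\<kappa> - \<nu>) * nm f" if "f \<in> L2 \<mu>" for f
      using lower[OF R[OF that]] \<nu> by (simp add: field_simps)
    then show "\<exists>C. \<forall>f\<in>L2 \<mu>. nm (R f) \<le> C * nm f" by blast
  qed
  moreover have "\<exists>h. (R g, h) \<in> A \<and> (AE x in \<mu>. \<nu> * R g x - h x = g x)" if "g \<in> L2 \<mu>" for g
    using R[OF that] by (intro exI[of _ "\<lambda>x. \<nu> * R g x - g x"]) auto
  moreover have "AE x in \<mu>. R (\<lambda>y. \<nu> * f y - h y) x = f x" if fh: "(f, h) \<in> A" for f h
  proof -
    have "(\<lambda>y. \<nu> * f y - h y) \<in> L2 \<mu>" using A_L2[OF fh] by simp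
    from A_lincomb[OF R[OF this] fh, of 1 "-1"]
    have "AE x in \<mu>. 1 * R (\<lambda>y. \<nu> * f y - h y) x + - 1 * f x = 0"
      by (rule unique) (simp add: algebra_simps)
    then show ?thesis by eventually_elim simp
  qed
  ultimately show ?thesis unfolding L2_resolvent_set_def by blast
qed

section \<open>Eigenfunctions of \<open>A\<close> and of \<open>Q 1\<close>\<close>

lemma eigenvalue_in_spectrum:
  assumes "L2_eigenfunction \<mu> A \<kappa> u"
  shows "\<kappa> \<in> L2_spectrum \<mu> A"
proof (rule ccontr)
  have u: "(u, \<lambda>x. \<kappa> * u x) \<in> A" "\<not> (AE x in \<mu>. u x = 0)"
    using assms by (auto simp: L2_eigenfunction_def)
  assume "\<kappa> \<notin> L2_spectrum \<mu> A"
  then obtain R where R: "L2_bounded_linear \<mu> R" "\<forall>(f, h)\<in>A. AE x in \<mu>. R (\<lambda>y. \<kappa> * f y - h y) x = f x"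
    by (auto simp: L2_spectrum_def L2_resolvent_set_def)
  have "AE x in \<mu>. R (\<lambda>y. 0) x = u x" using bspec[OF R(2) u(1)] by simp
  moreover have "AE x in \<mu>. R (\<lambda>y. 0 * u y + 0 * u y) x = 0 * R u x + 0 * R u x"
    using R(1) A_L2[OF u(1)] unfolding L2_bounded_linear_def by blast
  ultimately have "AE x in \<mu>. u x = 0" by (auto elim: eventually_elim2)
  with u(2) show False by simp
qed

text \<open>The error \<open>Q h u - exp (- \<kappa> h) u\<close> is \<open>o(h)\<close> and at most doubles, up to a factor with bounded
  product, when \<open>h\<close> is doubled.\<close>

lemma eigenfunction_Q:
  assumes u: "(u, \<lambda>x. \<kappa> * u x) \<in> A"
  shows "AE x in \<mu>. Q 1 u x = exp (- \<kappa>) * u x"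
proof -
  have L: "u \<in> L2 \<mu>" using A_L2 u by blast
  let ?h = "\<lambda>n::nat. 1 / 2 ^ n :: real"
  define d where "d h = nm (\<lambda>x. Q h u x - exp (- \<kappa> * h) * u x)" for h
  obtain \<omega> where \<omega>: "\<And>f. f \<in> L2 \<mu> \<Longrightarrow> nm (Q 1 f) \<le> exp (\<omega> * 1) * nm f"
    using Q_exp_norm_bound[of 1] by auto
  \<comment> \<open>One nonnegative rate dominating both \<open>\<omega>\<close> and
    \<open>- \<kappa>\<close> bounds the norm of \<open>Q h\<close> and the scalar factor at
    once.\<close>
  define \<theta> where "\<theta> = \<bar>\<omega>\<bar> + \<bar>\<kappa>\<bar>"
  have \<theta>: "\<omega> \<le> \<theta>" "- \<kappa> \<le> \<theta>" by (auto simp: \<theta>_def)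
  have double: "d (?h n) \<le> 2 * exp (\<theta> * ?h (Suc n)) * d (?h (Suc n))" for n
  proof -
    define h where "h = ?h (Suc n)"
    have h: "h > 0" "?h n = h + h" by (auto simp: h_def)
    define e where "e x = Q h u x - exp (- \<kappa> * h) * u x" for x
    have e: "e \<in> L2 \<mu>" unfolding e_def[abs_def] using L by simp
    have E: "exp (- \<kappa> * (h + h)) = exp (- \<kappa> * h) * exp (- \<kappa> * h)" unfolding distrib_left exp_add ..
    have Q2: "Q (h + h) u = Q h (Q h u)" using h(1) L by (intro Q_semigroup)
    have "Q h e = (\<lambda>x. Q h (Q h u) x - exp (- \<kappa> * h) * Q h u x)"
      unfolding e_def[abs_def] using h L by (simp add: Q_diff Q_mult)
    then have "(\<lambda>x. Q (h + h) u x - exp (- \<kappa> * (h + h)) * u x) = (\<lambda>x. Q h e x + exp (- \<kappa> * h) * e x)"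
      unfolding Q2 E by (simp add: e_def algebra_simps)
    then have "d (h + h) = nm (\<lambda>x. Q h e x + exp (- \<kappa> * h) * e x)" by (simp add: d_def)
    also have "\<dots> \<le> nm (Q h e) + exp (- \<kappa> * h) * nm e"
      using L2_norm_add_le[of "Q h e" \<mu> "\<lambda>x. exp (- \<kappa> * h) * e x"] e by (simp add: L2_norm_mult)
    also have "\<dots> \<le> exp (\<theta> * h) * nm e + exp (\<theta> * h) * nm e"
    proof (intro add_mono mult_right_mono)
      have "nm (Q h e) \<le> exp (\<omega> * h) * nm e"
        using Q_dyadic_norm_bound[of 1 \<omega> e "Suc n"] \<omega> e by (simp add: h_def)
      also have "\<dots> \<le> exp (\<theta> * h) * nm e" using \<theta> h by (intro mult_right_mono) auto
      finally show "nm (Q h e) \<le> exp (\<theta> * h) * nm e" .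
      have "- \<kappa> * h \<le> \<theta> * h" using \<theta>(2) h(1) by (intro mult_right_mono) auto
      then show "exp (- \<kappa> * h) \<le> exp (\<theta> * h)" by simp
    qed simp
    finally have "d (h + h) \<le> 2 * exp (\<theta> * h) * nm e" unfolding mult_2 distrib_right .
    moreover have "nm e = d h" by (simp only: d_def e_def[abs_def])
    ultimately show ?thesis unfolding h(2) h_def[symmetric] by (simp only:)
  qed
  \<comment> \<open>The factors \<open>exp (\<theta> / 2 ^ j)\<close> for \<open>j\<close> from 1 to
    \<open>n\<close> multiply to an exponential bounded in \<open>n\<close>, while
    \<open>2 ^ n * d (?h n)\<close> is a difference quotient and tends to 0.\<close>
  have bound: "d 1 \<le> 2 ^ n * exp (\<theta> * (1 - ?h n)) * d (?h n)" for n
  proof (induction n)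
    case (Suc n)
    have "2 ^ n * exp (\<theta> * (1 - ?h n)) * d (?h n)
        \<le> 2 ^ n * exp (\<theta> * (1 - ?h n)) * (2 * exp (\<theta> * ?h (Suc n)) * d (?h (Suc n)))"
      by (intro mult_left_mono double) simp
    also have "\<dots> = 2 ^ Suc n * (exp (\<theta> * (1 - ?h n)) * exp (\<theta> * ?h (Suc n))) * d (?h (Suc n))"
      by simp
    also have "exp (\<theta> * (1 - ?h n)) * exp (\<theta> * ?h (Suc n)) = exp (\<theta> * (1 - ?h (Suc n)))"
      unfolding exp_add[symmetric] by (simp add: field_simps)
    finally show ?case using Suc by linarith
  qed simp
  have le: "d 1 \<le> exp \<theta> * (nm (\<lambda>x. (Q (?h n) u x - u x) / ?h n + \<kappa> * u x)
      + \<bar>(exp (- \<kappa> * ?h n) - 1) / ?h n + \<kappa>\<bar> * nm u)" for n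
  proof -
    have "\<theta> * (1 - ?h n) \<le> \<theta> * 1" by (intro mult_left_mono) (auto simp: \<theta>_def)
    then have "2 ^ n * exp (\<theta> * (1 - ?h n)) * d (?h n) \<le> 2 ^ n * exp \<theta> * d (?h n)"
      by (intro mult_right_mono mult_left_mono) (auto simp: d_def)
    also have "\<dots> = exp \<theta> * nm (\<lambda>x. (Q (?h n) u x - exp (- \<kappa> * ?h n) * u x) / ?h n)"
      by (simp only: L2_norm_divide d_def) simp
    also have "(\<lambda>x. (Q (?h n) u x - exp (- \<kappa> * ?h n) * u x) / ?h n)
        = (\<lambda>x. ((Q (?h n) u x - u x) / ?h n + \<kappa> * u x) - ((exp (- \<kappa> * ?h n) - 1) / ?h n + \<kappa>) * u x)"
      by (simp add: fun_eq_iff algebra_simps)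
    also have "nm \<dots> \<le> nm (\<lambda>x. (Q (?h n) u x - u x) / ?h n + \<kappa> * u x)
        + nm (\<lambda>x. ((exp (- \<kappa> * ?h n) - 1) / ?h n + \<kappa>) * u x)"
      using L by (intro L2_norm_diff_le L2_add L2_mult L2_divide L2_diff Q_L2)
    finally show ?thesis
      using bound[of n] by (simp only: L2_norm_mult) (meson exp_ge_zero mult_left_mono order_trans)
  qed
  have "(\<lambda>n. exp \<theta> * (nm (\<lambda>x. (Q (?h n) u x - u x) / ?h n + \<kappa> * u x)
      + \<bar>(exp (- \<kappa> * ?h n) - 1) / ?h n + \<kappa>\<bar> * nm u)) \<longlonglongrightarrow> exp \<theta> * (0 + \<bar>- \<kappa> + \<kappa>\<bar> * nm u)"
    by (intro tendsto_intros tendsto_dyadic_difference_quotient filterlim_compose[OF A_tendsto[OF u] filterlim_dyadic]) simp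
  then have "d 1 \<le> exp \<theta> * (0 + \<bar>- \<kappa> + \<kappa>\<bar> * nm u)"
    by (rule LIMSEQ_le_const) (use le in blast)
  moreover have "0 \<le> d 1" by (simp add: d_def)
  ultimately have "d 1 = 0" by simp
  then have "nm (\<lambda>x. Q 1 u x - exp (- \<kappa>) * u x) = 0" by (simp add: d_def)
  then have "AE x in \<mu>. Q 1 u x - exp (- \<kappa>) * u x = 0" using L by (subst (asm) L2_norm_eq_0_iff) auto
  then show ?thesis by eventually_elim simp
qed

text \<open>Square roots are unambiguous: with \<open>c = exp (- \<kappa> * h)\<close> and
  \<open>w = Q h u - c * u\<close>, the relation at \<open>h + h\<close> reads
  \<open>Q h w + c * w = 0\<close>. As \<open>ip (Q h w) w \<ge> 0\<close> and \<open>c > 0\<close>,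
  this forces \<open>w = 0\<close>. Differentiation at 0 along the dyadic times then gives the
  adjoint relation.\<close>

lemma eigenfunction_from_Q:
  assumes u: "u \<in> L2 \<mu>" "nm (\<lambda>x. Q 1 u x - exp (- \<kappa>) * u x) = 0"
  shows "(u, \<lambda>x. \<kappa> * u x) \<in> A"
proof (rule A_adjointI)
  let ?h = "\<lambda>n::nat. 1 / 2 ^ n :: real"
  have dyadic: "nm (\<lambda>x. Q (?h n) u x - exp (- \<kappa> * ?h n) * u x) = 0" for n
  proof (induction n)
    case (Suc n)
    define h where "h = ?h (Suc n)"
    have h: "h > 0" "?h n = h + h" by (auto simp: h_def)
    define w where "w x = Q h u x - exp (- \<kappa> * h) * u x" for x
    have w: "w \<in> L2 \<mu>" unfolding w_def[abs_def] using u by simp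
    have E: "exp (- \<kappa> * (h + h)) = exp (- \<kappa> * h) * exp (- \<kappa> * h)" unfolding distrib_left exp_add ..
    have Q2: "Q (h + h) u = Q h (Q h u)" using h(1) u(1) by (intro Q_semigroup)
    have "Q h w = (\<lambda>x. Q h (Q h u) x - exp (- \<kappa> * h) * Q h u x)"
      unfolding w_def[abs_def] using h u by (simp add: Q_diff Q_mult)
    then have "(\<lambda>x. Q (h + h) u x - exp (- \<kappa> * (h + h)) * u x) = (\<lambda>x. Q h w x + exp (- \<kappa> * h) * w x)"
      unfolding Q2 E by (simp add: w_def algebra_simps)
    with Suc have z: "nm (\<lambda>x. Q h w x + exp (- \<kappa> * h) * w x) = 0" unfolding h(2) by simp
    have "\<bar>ip (\<lambda>x. Q h w x + exp (- \<kappa> * h) * w x) w\<bar> \<le> nm (\<lambda>x. Q h w x + exp (- \<kappa> * h) * w x) * nm w"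
      using w by (intro L2_Cauchy_Schwarz) auto
    then have "ip (Q h w) w + exp (- \<kappa> * h) * ip w w = 0"
      using z w by (simp add: L2_inner_add_left)
    moreover have "0 \<le> ip (Q h w) w" using Q_half_norm_sq[OF h(1) w] by (metis zero_le_power2)
    moreover have "0 \<le> exp (- \<kappa> * h) * ip w w" by simp
    ultimately have "exp (- \<kappa> * h) * ip w w = 0" by linarith
    then have "nm w = 0" by (simp add: L2_norm_def)
    then show ?case unfolding w_def[abs_def] h_def .
  qed (use u in simp)
  fix v v' assume v: "(v, v') \<in> A"
  have L: "v \<in> L2 \<mu>" "v' \<in> L2 \<mu>" using A_L2 v by auto
  have "(\<lambda>n. ip (\<lambda>x. (Q (?h n) v x - v x) / ?h n + v' x) u) \<longlonglongrightarrow> ip (\<lambda>x. 0) u"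
  proof (rule tendsto_L2_inner)
    show "(\<lambda>n. nm (\<lambda>x. (Q (?h n) v x - v x) / ?h n + v' x - 0)) \<longlonglongrightarrow> 0"
      using filterlim_compose[OF A_tendsto[OF v] filterlim_dyadic[of 1]] by simp
  qed (intro L2_zero L u(1) L2_add L2_divide L2_diff Q_L2)+
  moreover have "ip (\<lambda>x. (Q (?h n) v x - v x) / ?h n + v' x) u
      = (exp (- \<kappa> * ?h n) - 1) / ?h n * ip v u + ip v' u" for n
  proof -
    have "AE x in \<mu>. Q (?h n) u x - exp (- \<kappa> * ?h n) * u x = 0"
      using dyadic[of n] u by (subst (asm) L2_norm_eq_0_iff) auto
    then have "AE x in \<mu>. Q (?h n) u x = exp (- \<kappa> * ?h n) * u x" by eventually_elim simp
    then have "ip v (Q (?h n) u) = ip v (\<lambda>x. exp (- \<kappa> * ?h n) * u x)"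
      using L u by (intro L2_inner_cong_AE) (auto simp: L2_measurable)
    then have "ip (Q (?h n) v) u = exp (- \<kappa> * ?h n) * ip v u"
      using Q_symmetric[of "?h n" v u] L u by simp
    then show ?thesis
      using L u by (simp only: L2_inner_add_left L2_inner_diff_left L2_inner_divide_left L2_diff L2_divide Q_L2
          left_diff_distrib diff_divide_distrib times_divide_eq_left mult_1_left)
  qed
  moreover have "(\<lambda>n. (exp (- \<kappa> * ?h n) - 1) / ?h n * ip v u + ip v' u) \<longlonglongrightarrow> - \<kappa> * ip v u + ip v' u"
    by (intro tendsto_intros tendsto_dyadic_difference_quotient)
  ultimately have "- \<kappa> * ip v u + ip v' u = 0"
    using LIMSEQ_unique by (simp only: L2_inner_zero_left) blast
  then show "ip v' u = ip v (\<lambda>x. \<kappa> * u x)" by simp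
qed (use u in auto)


section \<open>The optimal growth rate and a nonnegative eigenfunction for it\<close>

lemma optimal_growth:
  obtains \<kappa> where "\<And>f. f \<in> L2 \<mu> \<Longrightarrow> nm (Q 1 f) \<le> exp (- \<kappa>) * nm f"
    and "\<And>\<omega>. (\<And>f. f \<in> L2 \<mu> \<Longrightarrow> nm (Q 1 f) \<le> exp \<omega> * nm f) \<Longrightarrow> - \<kappa> \<le> \<omega>"
proof -
  define W where "W = {\<omega>. \<forall>f\<in>L2 \<mu>. nm (Q 1 f) \<le> exp \<omega> * nm f}"
  obtain \<omega> where "\<And>f. f \<in> L2 \<mu> \<Longrightarrow> nm (Q 1 f) \<le> exp (\<omega> * 1) * nm f"
    using Q_exp_norm_bound[of 1] by auto
  then have "\<omega> \<in> W" by (simp add: W_def)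
  then have ne: "W \<noteq> {}" by blast
  have "W = (\<Inter>f\<in>L2 \<mu>. {\<omega>. nm (Q 1 f) \<le> exp \<omega> * nm f})" by (auto simp: W_def)
  then have closed: "closed W" by (auto intro!: closed_INT closed_Collect_le continuous_intros)
  \<comment> \<open>The constant function has a nonzero image by injectivity, so admissible rates
    cannot go to minus infinity; closedness of \<open>W\<close> makes the infimum
    admissible.\<close>
  have pos: "0 < nm (\<lambda>x. 1)" "0 < nm (Q 1 (\<lambda>x. 1))"
    using one_not_null Q_injective[of 1 "\<lambda>x. 1"] L2_norm_nonneg[of \<mu>] by (auto simp: order_less_le)
  have bdd: "bdd_below W"
  proof (rule bdd_belowI)
    fix \<omega> assume "\<omega> \<in> W"
    then have "nm (Q 1 (\<lambda>x. 1)) \<le> exp \<omega> * nm (\<lambda>x. 1)" unfolding W_def using L2_const by blast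
    then have "nm (Q 1 (\<lambda>x. 1)) / nm (\<lambda>x. 1) \<le> exp \<omega>" using pos by (simp add: field_simps)
    then have "ln (nm (Q 1 (\<lambda>x. 1)) / nm (\<lambda>x. 1)) \<le> ln (exp \<omega>)"
      using pos by (subst ln_le_cancel_iff) auto
    then show "ln (nm (Q 1 (\<lambda>x. 1)) / nm (\<lambda>x. 1)) \<le> \<omega>" by simp
  qed
  have "Inf W \<in> W" using closed_contains_Inf[OF ne bdd closed] .
  moreover have "Inf W \<le> \<omega>" if "\<omega> \<in> W" for \<omega> using cInf_lower[OF that bdd] .
  ultimately show thesis using that[of "- Inf W"] by (simp add: W_def)
qed

lemma Q_nat_norm_bound:
  assumes "\<And>f. f \<in> L2 \<mu> \<Longrightarrow> nm (Q 1 f) \<le> exp (- \<kappa>) * nm f" "f \<in> L2 \<mu>"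
  shows "nm (Q (real (Suc n)) f) \<le> exp (- \<kappa> * real (Suc n)) * nm f"
proof (induction n)
  case (Suc n)
  have "Q (real (Suc (Suc n))) f = Q 1 (Q (real (Suc n)) f)"
    using Q_semigroup[of 1 "real (Suc n)" f] assms(2) by simp
  then have "nm (Q (real (Suc (Suc n))) f) \<le> exp (- \<kappa>) * nm (Q (real (Suc n)) f)" using assms by simp
  also have "\<dots> \<le> exp (- \<kappa>) * (exp (- \<kappa> * real (Suc n)) * nm f)" using Suc by (intro mult_left_mono) auto
  also have "\<dots> = exp (- \<kappa> + - \<kappa> * real (Suc n)) * nm f" by (simp only: exp_add mult.assoc)
  also have "- \<kappa> + - \<kappa> * real (Suc n) = - \<kappa> * real (Suc (Suc n))" by (simp add: algebra_simps)
  finally show ?case .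
qed (use assms in simp)

text \<open>Since \<open>\<parallel>e\<^sup>\<kappa>\<^sup>n Q n f\<parallel>\<^sup>2\<close> and \<open>\<langle>e\<^sup>\<kappa>\<^sup>n Q n f, f\<rangle>\<close> are decreasing in \<open>n\<close>, the rescaled orbit is
  Cauchy; its limit is the projection of \<open>f\<close> to the eigenspace.\<close>

lemma rescaled_orbit_limit:
  assumes bound: "\<And>f. f \<in> L2 \<mu> \<Longrightarrow> nm (Q 1 f) \<le> exp (- \<kappa>) * nm f" and f: "f \<in> L2 \<mu>"
  obtains u where "u \<in> L2 \<mu>" "nm (\<lambda>x. Q 1 u x - exp (- \<kappa>) * u x) = 0"
    and "(\<lambda>n. nm (\<lambda>x. exp (\<kappa> * real (Suc n)) * Q (real (Suc n)) f x - u x)) \<longlonglongrightarrow> 0"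
proof -
  define p where "p n x = exp (\<kappa> * real (Suc n)) * Q (real (Suc n)) f x" for n x
  have p: "p n \<in> L2 \<mu>" for n unfolding p_def[abs_def] by simp
  define a where "a n = exp (\<kappa> * real (Suc n)) * ip (Q (real (Suc n)) f) f" for n
  \<comment> \<open>Index \<open>n\<close> stands for time \<open>n + 1\<close>, so the times add up
    to \<open>m + n + 2\<close>, which has index \<open>Suc (m + n)\<close>.\<close>
  have ipp: "ip (p m) (p n) = a (Suc (m + n))" for m n
  proof -
    have "ip (Q (real (Suc m)) f) (Q (real (Suc n)) f) = ip (Q (real (Suc n)) (Q (real (Suc m)) f)) f"
      using Q_symmetric[of "real (Suc n)" "Q (real (Suc m)) f" f] f by simp
    also have "\<dots> = ip (Q (real (Suc n) + real (Suc m)) f) f" using f by (simp only: Q_semigroup of_nat_0_less_iff zero_less_Suc)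
    also have "real (Suc n) + real (Suc m) = real (Suc (Suc (m + n)))" by simp
    finally have 1: "ip (Q (real (Suc m)) f) (Q (real (Suc n)) f) = ip (Q (real (Suc (Suc (m + n)))) f) f" .
    have 2: "exp (\<kappa> * real (Suc m)) * exp (\<kappa> * real (Suc n)) = exp (\<kappa> * real (Suc (Suc (m + n))))"
      unfolding exp_add[symmetric] by (simp add: algebra_simps)
    show ?thesis
      unfolding p_def[abs_def] a_def L2_inner_mult_left L2_inner_mult_right 1 mult.assoc[symmetric] 2 ..
  qed
  have half: "nm (Q (1 / 2) g) \<le> exp (- \<kappa> / 2) * nm g" if "g \<in> L2 \<mu>" for g
    using Q_half_norm_bound[of 1 "- \<kappa>" g] bound that by simp
  have a_sq: "a n = exp (\<kappa> * real (Suc n)) * (nm (Q (real (Suc n) / 2) f))\<^sup>2" for n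
    using Q_half_norm_sq[of "real (Suc n)" f] f by (simp add: a_def)
  have dec: "decseq a"
  proof (rule decseq_SucI)
    fix n
    have "Q (real (Suc (Suc n)) / 2) f = Q (1 / 2) (Q (real (Suc n) / 2) f)"
      using Q_semigroup[of "1 / 2" "real (Suc n) / 2" f] f by (simp add: add_divide_distrib)
    then have "(nm (Q (real (Suc (Suc n)) / 2) f))\<^sup>2 \<le> (exp (- \<kappa> / 2) * nm (Q (real (Suc n) / 2) f))\<^sup>2"
      using half by (intro power_mono) auto
    then have "a (Suc n) \<le> exp (\<kappa> * real (Suc (Suc n))) * (exp (- \<kappa> / 2) * nm (Q (real (Suc n) / 2) f))\<^sup>2"
      unfolding a_sq by (intro mult_left_mono) auto
    also have "\<dots> = (exp (\<kappa> * real (Suc (Suc n))) * exp (- \<kappa>)) * (nm (Q (real (Suc n) / 2) f))\<^sup>2"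
      by (simp add: power_mult_distrib flip: exp_double)
    also have "exp (\<kappa> * real (Suc (Suc n))) * exp (- \<kappa>) = exp (\<kappa> * real (Suc n))"
      unfolding exp_add[symmetric] by (simp add: algebra_simps)
    finally show "a (Suc n) \<le> a n" by (simp only: a_sq)
  qed
  have "0 \<le> a n" for n unfolding a_sq by simp
  then obtain l where l: "a \<longlonglongrightarrow> l" "\<And>n. l \<le> a n" using decseq_convergent[OF dec, of 0] by blast
  have Cauchy: "\<exists>N. \<forall>m\<ge>N. \<forall>n\<ge>N. nm (\<lambda>x. p m x - p n x) < e" if "e > 0" for e
  proof -
    obtain N where N: "\<And>n. n \<ge> N \<Longrightarrow> \<bar>a n - l\<bar> < e\<^sup>2 / 2"
      using LIMSEQ_D[OF l(1), of "e\<^sup>2 / 2"] \<open>e > 0\<close> by auto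
    have "nm (\<lambda>x. p m x - p n x) < e" if "m \<ge> N" "n \<ge> N" for m n
    proof (rule power2_less_imp_less)
      \<comment> \<open>The three terms all approach \<open>l\<close>, and the subtracted one never
        falls below \<open>l\<close>.\<close>
      have "(nm (\<lambda>x. p m x - p n x))\<^sup>2 = a (Suc (m + m)) + a (Suc (n + n)) - 2 * a (Suc (m + n))"
        using p[of m] p[of n] by (simp add: L2_norm_sq L2_inner_diff_left L2_inner_diff_right ipp add.commute[of n m])
      also have "\<dots> < e\<^sup>2"
        using N[of "Suc (m + m)"] N[of "Suc (n + n)"] l(2)[of "Suc (m + n)"] that by linarith
      finally show "(nm (\<lambda>x. p m x - p n x))\<^sup>2 < e\<^sup>2" .
    qed (use \<open>e > 0\<close> in simp)
    then show ?thesis by blast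
  qed
  obtain u where u: "u \<in> L2 \<mu>" "(\<lambda>n. nm (\<lambda>x. p n x - u x)) \<longlonglongrightarrow> 0"
    using L2_complete[OF p Cauchy] by blast
  have "nm (\<lambda>x. Q 1 u x - exp (- \<kappa>) * u x) \<le> 0"
  proof (rule LIMSEQ_le_const)
    show "(\<lambda>n. exp (- \<kappa>) * nm (\<lambda>x. p n x - u x) + exp (- \<kappa>) * nm (\<lambda>x. p (Suc n) x - u x)) \<longlonglongrightarrow> 0"
      using tendsto_add[OF tendsto_mult_left[OF u(2)] tendsto_mult_left[OF LIMSEQ_Suc[OF u(2)]], of "exp (- \<kappa>)" "exp (- \<kappa>)"]
      by simp
    have "nm (\<lambda>x. Q 1 u x - exp (- \<kappa>) * u x) \<le> exp (- \<kappa>) * nm (\<lambda>x. p n x - u x) + exp (- \<kappa>) * nm (\<lambda>x. p (Suc n) x - u x)" for n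
    proof -
      have "exp (- \<kappa>) * exp (\<kappa> * real (Suc (Suc n))) = exp (\<kappa> * real (Suc n))"
        unfolding exp_add[symmetric] by (simp add: algebra_simps)
      moreover have "Q 1 (Q (real (Suc n)) f) = Q (real (Suc (Suc n))) f"
        using Q_semigroup[of 1 "real (Suc n)" f] f by simp
      ultimately have Qp: "Q 1 (p n) = (\<lambda>x. exp (- \<kappa>) * p (Suc n) x)"
        unfolding p_def[abs_def] by (simp only: Q_mult zero_less_one Q_L2 mult.assoc[symmetric])
      have "nm (\<lambda>x. Q 1 u x - exp (- \<kappa>) * u x)
          \<le> nm (\<lambda>x. Q 1 u x - Q 1 (p n) x) + nm (\<lambda>x. Q 1 (p n) x - exp (- \<kappa>) * u x)"
        using u(1) by (intro L2_norm_triangle_sub) auto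
      also have "nm (\<lambda>x. Q 1 u x - Q 1 (p n) x) \<le> exp (- \<kappa>) * nm (\<lambda>x. p n x - u x)"
        using bound[of "\<lambda>x. u x - p n x"] u(1) p[of n] L2_norm_minus_commute[of \<mu> u "p n"] by (simp add: Q_diff)
      also have "nm (\<lambda>x. Q 1 (p n) x - exp (- \<kappa>) * u x) = exp (- \<kappa>) * nm (\<lambda>x. p (Suc n) x - u x)"
        using L2_norm_mult[of \<mu> "exp (- \<kappa>)" "\<lambda>x. p (Suc n) x - u x"] by (simp add: Qp right_diff_distrib)
      finally show ?thesis by simp
    qed
    then show "\<exists>N. \<forall>n\<ge>N. nm (\<lambda>x. Q 1 u x - exp (- \<kappa>) * u x)
        \<le> exp (- \<kappa>) * nm (\<lambda>x. p n x - u x) + exp (- \<kappa>) * nm (\<lambda>x. p (Suc n) x - u x)" by blast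
  qed
  then have "nm (\<lambda>x. Q 1 u x - exp (- \<kappa>) * u x) = 0"
    using L2_norm_nonneg[of \<mu> "\<lambda>x. Q 1 u x - exp (- \<kappa>) * u x"] by linarith
  with u show thesis using that unfolding p_def by blast
qed

text \<open>If the rescaled orbits of all kernel functions tended to \<open>0\<close>, then \<open>e\<^sup>\<kappa>\<^sup>t Q t f\<close> would tend to
  \<open>0\<close> pointwise and boundedly, uniformly in \<open>f\<close> from the unit ball, although these operators have
  norm \<open>1\<close> for \<open>t = 2\<^sup>j\<close>.\<close>

lemma positive_eigenfunction:
  obtains \<kappa> u where "\<And>f. f \<in> L2 \<mu> \<Longrightarrow> nm (Q 1 f) \<le> exp (- \<kappa>) * nm f"
    and "L2_eigenfunction \<mu> A \<kappa> u" "AE x in \<mu>. 0 \<le> u x"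
proof -
  obtain \<kappa> where bound: "\<And>f. f \<in> L2 \<mu> \<Longrightarrow> nm (Q 1 f) \<le> exp (- \<kappa>) * nm f"
    and opt: "\<And>\<omega>. (\<And>f. f \<in> L2 \<mu> \<Longrightarrow> nm (Q 1 f) \<le> exp \<omega> * nm f) \<Longrightarrow> - \<kappa> \<le> \<omega>"
    using optimal_growth by blast
  obtain C where C: "0 \<le> C" "\<And>f x. f \<in> L2 \<mu> \<Longrightarrow> \<bar>Q 1 f x\<bar> \<le> C * nm f"
    using Q_sup_bound[of 1] by auto
  have "\<forall>x. \<exists>k. k \<in> L2 \<mu> \<and> (\<forall>f\<in>L2 \<mu>. ip k f = Q 1 f x) \<and> (AE y in \<mu>. 0 \<le> k y)"
    using kernel[of 1] by (metis zero_less_one)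
  then obtain k where k: "\<And>x. k x \<in> L2 \<mu>" "\<And>x f. f \<in> L2 \<mu> \<Longrightarrow> ip (k x) f = Q 1 f x"
    "\<And>x. AE y in \<mu>. 0 \<le> k x y" by metis
  define p where "p n f x = exp (\<kappa> * real (Suc n)) * Q (real (Suc n)) f x" for n f x
  have p: "p n f \<in> L2 \<mu>" for n f unfolding p_def[abs_def] by simp
  have p_nm: "nm (p n f) \<le> nm f" if "f \<in> L2 \<mu>" for n f
  proof -
    have "nm (p n f) = exp (\<kappa> * real (Suc n)) * nm (Q (real (Suc n)) f)"
      unfolding p_def[abs_def] L2_norm_mult by simp
    also have "\<dots> \<le> exp (\<kappa> * real (Suc n)) * (exp (- \<kappa> * real (Suc n)) * nm f)"
      by (intro mult_left_mono Q_nat_norm_bound bound that) simp_all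
    also have "\<dots> = nm f" by (simp flip: exp_add mult.assoc)
    finally show ?thesis .
  qed
  have p_Suc: "p (Suc n) f x = exp \<kappa> * Q 1 (p n f) x" if "f \<in> L2 \<mu>" for n f x
  proof -
    have "Q 1 (Q (real (Suc n)) f) = Q (real (Suc (Suc n))) f"
      using Q_semigroup[of 1 "real (Suc n)" f] that by simp
    then have "Q 1 (p n f) x = exp (\<kappa> * real (Suc n)) * Q (real (Suc (Suc n))) f x"
      unfolding p_def[abs_def] by (simp only: Q_mult zero_less_one Q_L2)
    moreover have "exp \<kappa> * exp (\<kappa> * real (Suc n)) = exp (\<kappa> * real (Suc (Suc n)))"
      unfolding exp_add[symmetric] by (simp add: algebra_simps)
    ultimately show ?thesis by (simp only: p_def mult.assoc[symmetric])
  qed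
  have ex: "\<exists>x. \<not> (\<lambda>n. nm (p n (k x))) \<longlonglongrightarrow> 0"
  proof (rule ccontr)
    assume "\<not> ?thesis"
    then have lim: "\<And>x. (\<lambda>n. nm (p n (k x))) \<longlonglongrightarrow> 0" by blast
    have "\<exists>f. f \<in> L2 \<mu> \<and> nm f = 1 \<and> 1 / 2 \<le> nm (p (2 ^ j - 1) f)" for j
    proof -
      have "\<exists>f\<in>L2 \<mu>. nm (Q (2 ^ j) f) > exp (- \<kappa> * 2 ^ j) / 2 * nm f"
      proof (rule ccontr)
        assume contra: "\<not> ?thesis"
        \<comment> \<open>If \<open>Q (2 ^ j)\<close> lost a factor 2 against the optimal rate,
          halving the time \<open>j\<close> times would give the better rate \<open>\<omega>\<close>
          at time 1.\<close>
        define \<omega> where "\<omega> = - \<kappa> - ln 2 / 2 ^ j"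
        have \<omega>: "exp (\<omega> * 2 ^ j) = exp (- \<kappa> * 2 ^ j) / 2"
          by (simp add: \<omega>_def left_diff_distrib exp_diff)
        have "nm (Q (2 ^ j) f) \<le> exp (\<omega> * 2 ^ j) * nm f" if "f \<in> L2 \<mu>" for f
          unfolding \<omega> using contra that by (meson not_less)
        then have "nm (Q 1 f) \<le> exp \<omega> * nm f" if "f \<in> L2 \<mu>" for f
          using Q_dyadic_norm_bound[of "2 ^ j" \<omega> f j] that by simp
        then have "- \<kappa> \<le> \<omega>" by (rule opt)
        moreover have "0 < ln 2 / (2 ^ j :: real)" by simp
        ultimately show False by (simp add: \<omega>_def)
      qed
      then obtain f where f: "f \<in> L2 \<mu>" "nm (Q (2 ^ j) f) > exp (- \<kappa> * 2 ^ j) / 2 * nm f" by blast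
      obtain B where B: "\<And>f. f \<in> L2 \<mu> \<Longrightarrow> nm (Q (2 ^ j) f) \<le> B * nm f"
        using Q_norm_bound[of "2 ^ j"] by auto
      have nz: "nm f \<noteq> 0" using B[OF f(1)] f(2) by auto
      then have pos: "0 < nm f" using L2_norm_nonneg[of \<mu> f] by linarith
      define g where "g x = f x / nm f" for x
      have g: "g \<in> L2 \<mu>" "nm g = 1"
        unfolding g_def[abs_def] using f(1) pos by (simp_all add: L2_norm_divide)
      have e: "real (Suc (2 ^ j - 1)) = 2 ^ j" by simp
      have "nm (p (2 ^ j - 1) g) = exp (\<kappa> * 2 ^ j) * (nm (Q (2 ^ j) f) / nm f)"
        unfolding p_def[abs_def] e g_def[abs_def] using f(1) pos by (simp add: L2_norm_mult Q_divide L2_norm_divide)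
      also have "\<dots> \<ge> exp (\<kappa> * 2 ^ j) * (exp (- \<kappa> * 2 ^ j) / 2)"
        using f(2) pos by (intro mult_left_mono) (auto simp: field_simps)
      also have "exp (\<kappa> * 2 ^ j) * (exp (- \<kappa> * 2 ^ j) / 2) = 1 / 2" by (simp flip: exp_add)
      finally show ?thesis using g by blast
    qed
    then obtain f where f: "\<And>j. f j \<in> L2 \<mu>" "\<And>j. nm (f j) = 1" "\<And>j. 1 / 2 \<le> nm (p (2 ^ j - 1) (f j))" by metis
    \<comment> \<open>The time \<open>2 ^ Suc j\<close> splits into a last step of length 1, giving
      pointwise control, and a remainder of index \<open>r j\<close>. Starting at
      \<open>Suc j\<close> ensures that the remainder has positive time.\<close>
    define r where "r j = (2 :: nat) ^ Suc j - 2" for j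
    have r: "2 ^ Suc j - 1 = Suc (r j)" for j
    proof -
      have "(1::nat) \<le> 2 ^ j" by simp
      then show ?thesis unfolding r_def power_Suc by linarith
    qed
    define F where "F j = p (Suc (r j)) (f (Suc j))" for j
    have F_L2: "F j \<in> L2 \<mu>" for j by (simp add: F_def p)
    have F_bound: "\<bar>F j x\<bar> \<le> exp \<kappa> * C" for j x
    proof -
      have "\<bar>Q 1 (p (r j) (f (Suc j))) x\<bar> \<le> C * nm (p (r j) (f (Suc j)))" by (rule C(2)[OF p])
      also have "\<dots> \<le> C * 1" using p_nm[OF f(1), of "r j" "Suc j"] f(2) C(1) by (intro mult_left_mono) auto
      finally show ?thesis by (simp add: F_def p_Suc[OF f(1)] abs_mult)
    qed
    have F_lim: "(\<lambda>j. F j x) \<longlonglongrightarrow> 0" for x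
    proof (rule Lim_null_comparison)
      have "filterlim r at_top sequentially"
      proof (rule filterlim_at_top_mono[OF filterlim_ident])
        have "j \<le> r j" for j
        proof (induction j)
          case (Suc j)
          moreover have "(1::nat) \<le> 2 ^ j" by simp
          ultimately show ?case unfolding r_def power_Suc by linarith
        qed simp
        then show "\<forall>\<^sub>F j in sequentially. j \<le> r j" by simp
      qed
      from filterlim_compose[OF lim this] have "(\<lambda>j. nm (p (r j) (k x))) \<longlonglongrightarrow> 0" .
      then show "(\<lambda>j. exp \<kappa> * nm (p (r j) (k x))) \<longlonglongrightarrow> 0" by (intro tendsto_mult_right_zero)
      have "\<bar>F j x\<bar> \<le> exp \<kappa> * nm (p (r j) (k x))" for j
      proof -
        \<comment> \<open>Symmetry shifts the orbit from the varying unit vectors to the fixed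
          kernel function at \<open>x\<close>, whose orbit tends to 0 by assumption.\<close>
        have "Q 1 (p (r j) (f (Suc j))) x = ip (k x) (p (r j) (f (Suc j)))" by (simp add: k(2) p)
        also have "\<dots> = ip (p (r j) (k x)) (f (Suc j))"
          unfolding p_def[abs_def] using Q_symmetric[OF _ k(1) f(1), of "real (Suc (r j))"] by simp
        finally have "\<bar>Q 1 (p (r j) (f (Suc j))) x\<bar> \<le> nm (p (r j) (k x)) * nm (f (Suc j))"
          using L2_Cauchy_Schwarz[OF p f(1)] by simp
        then show ?thesis by (simp add: F_def p_Suc[OF f(1)] abs_mult f(2))
      qed
      then show "\<forall>\<^sub>F j in sequentially. norm (F j x) \<le> exp \<kappa> * nm (p (r j) (k x))" by simp
    qed
    have "(\<lambda>j. \<integral>x. (F j x)\<^sup>2 \<partial>\<mu>) \<longlonglongrightarrow> (\<integral>x. 0 \<partial>\<mu>)"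
    proof (rule integral_dominated_convergence[where w = "\<lambda>x. (exp \<kappa> * C)\<^sup>2"])
      show "AE x in \<mu>. (\<lambda>j. (F j x)\<^sup>2) \<longlonglongrightarrow> 0"
        using tendsto_power[OF F_lim, of _ 2] by simp
      show "AE x in \<mu>. norm ((F j x)\<^sup>2) \<le> (exp \<kappa> * C)\<^sup>2" for j
        using F_bound C(1) by (intro AE_I2) (auto simp: abs_le_square_iff[symmetric] abs_mult)
    qed (use L2_measurable[OF F_L2] in simp_all)
    then have lim_F: "(\<lambda>j. (nm (F j))\<^sup>2) \<longlonglongrightarrow> 0" by (simp add: L2_norm_sq_integral)
    have "(1 / 2)\<^sup>2 \<le> (nm (F j))\<^sup>2" for j
      using f(3)[of "Suc j"] unfolding F_def r by (intro power_mono) auto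
    then have "(1 / 2 :: real)\<^sup>2 \<le> 0" by (intro LIMSEQ_le_const[OF lim_F]) blast
    then show False by simp
  qed
  then obtain x where x: "\<not> (\<lambda>n. nm (p n (k x))) \<longlonglongrightarrow> 0" by blast
  obtain u where u: "u \<in> L2 \<mu>" "nm (\<lambda>x. Q 1 u x - exp (- \<kappa>) * u x) = 0"
      "(\<lambda>n. nm (\<lambda>y. p n (k x) y - u y)) \<longlonglongrightarrow> 0"
    using rescaled_orbit_limit[OF bound k(1)[of x]] unfolding p_def by blast
  have "nm u \<noteq> 0" using tendsto_L2_norm[OF u(1) p u(3)] x by auto
  then have "L2_eigenfunction \<mu> A \<kappa> u"
    using eigenfunction_from_Q[OF u(1,2)] L2_norm_eq_0_iff[OF u(1)] by (simp add: L2_eigenfunction_def)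
  moreover have "AE y in \<mu>. 0 \<le> u y"
  proof (rule L2_limit_nonneg[OF u(1) p _ u(3)])
    show "AE y in \<mu>. 0 \<le> p n (k x) y" for n
      unfolding p_def using Q_nonneg[OF _ k(1) k(3)] by (intro AE_I2 mult_nonneg_nonneg) auto
  qed
  ultimately show thesis using that bound by blast
qed


section \<open>Continuous representatives of eigenfunctions and conditions (ii), (iii)\<close>

lemma cont_rep_eigenfunction:
  assumes "(u, \<lambda>x. \<kappa> * u x) \<in> A"
  shows "apply_bcontfun (cont_rep \<mu> u) = (\<lambda>x. exp \<kappa> * Q 1 u x)"
proof -
  obtain F :: "'a \<Rightarrow>\<^sub>C real" where F: "apply_bcontfun F = (\<lambda>x. exp \<kappa> * Q 1 u x)"
    by (rule continuous_bcontfun[of "\<lambda>x. exp \<kappa> * Q 1 u x"]) (auto intro!: continuous_intros)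
  have "AE x in \<mu>. apply_bcontfun F x = u x"
    using eigenfunction_Q[OF assms] by eventually_elim (simp add: F flip: exp_add mult.assoc)
  from cont_rep_eqI[OF this] F show ?thesis by simp
qed

lemma Q_Q_eigenfunction:
  assumes "(u, \<lambda>x. \<kappa> * u x) \<in> A"
  shows "Q 1 (Q 1 u) x = exp (- \<kappa>) * Q 1 u x"
proof -
  have u: "u \<in> L2 \<mu>" using A_L2 assms by blast
  have "Q 1 (Q 1 u) = Q 1 (\<lambda>x. exp (- \<kappa>) * u x)"
    using u eigenfunction_Q[OF assms] by (intro Q_cong_AE) auto
  then show ?thesis using u by (simp add: Q_mult)
qed

lemma eigenfunction_imp_nondegenerate:
  assumes u: "L2_eigenfunction \<mu> A \<kappa> u" and pos: "0 < apply_bcontfun (cont_rep \<mu> u) x"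
  shows "\<exists>t>0. \<exists>f. apply_bcontfun (C_part \<mu> S t f) x \<noteq> 0"
proof -
  have uA: "(u, \<lambda>x. \<kappa> * u x) \<in> A" using u by (simp add: L2_eigenfunction_def)
  have "Q 1 u x \<noteq> 0" using pos by (auto simp: cont_rep_eigenfunction[OF uA])
  then have "Q 1 (Q 1 u) x \<noteq> 0" by (simp add: Q_Q_eigenfunction[OF uA])
  then have "apply_bcontfun (C_part \<mu> S 1 (cont_rep \<mu> (S 1 u))) x \<noteq> 0"
    by (simp add: C_part_apply Q_def[of 1 u, symmetric])
  then show ?thesis using zero_less_one by blast
qed

lemma strictly_positive_imp_eigenfunction:
  assumes iv: "\<And>f t x. (\<And>x. 0 \<le> apply_bcontfun f x) \<Longrightarrow> f \<noteq> 0 \<Longrightarrow> 0 < t \<Longrightarrow>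
      0 < apply_bcontfun (C_part \<mu> S t f) x"
  obtains \<delta> \<kappa> u where "0 < \<delta>" "\<kappa> \<in> L2_spectrum \<mu> A" "\<And>\<nu>. \<nu> \<in> L2_spectrum \<mu> A \<Longrightarrow> \<kappa> \<le> \<nu>"
    "L2_eigenfunction \<mu> A \<kappa> u" "AE x in \<mu>. 0 \<le> u x" "\<And>x. \<delta> \<le> apply_bcontfun (cont_rep \<mu> u) x"
proof -
  obtain \<kappa> u where bound: "\<And>f. f \<in> L2 \<mu> \<Longrightarrow> nm (Q 1 f) \<le> exp (- \<kappa>) * nm f"
    and u: "L2_eigenfunction \<mu> A \<kappa> u" "AE x in \<mu>. 0 \<le> u x"
    using positive_eigenfunction by blast
  have uA: "(u, \<lambda>x. \<kappa> * u x) \<in> A" using u(1) by (simp add: L2_eigenfunction_def)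
  then have uL: "u \<in> L2 \<mu>" using A_L2 by blast
  \<comment> \<open>Condition (iv) speaks of continuous functions, so it is applied to
    \<open>Q 1 u\<close> instead of \<open>u\<close>; a second application of \<open>Q 1\<close>
    only multiplies by \<open>exp (- \<kappa>)\<close>.\<close>
  let ?F = "cont_rep \<mu> (S 1 u)"
  have F: "apply_bcontfun ?F = Q 1 u" by (simp add: Q_def)
  have "nm u \<noteq> 0" using u(1) L2_norm_eq_0_iff[OF uL] by (simp add: L2_eigenfunction_def)
  then have "nm (Q 1 u) \<noteq> 0" using Q_injective[of 1 u] uL by auto
  have "?F \<noteq> 0"
  proof
    assume "?F = 0"
    then have "Q 1 u = (\<lambda>x. 0)" unfolding F[symmetric] by (simp add: zero_bcontfun.rep_eq)
    with \<open>nm (Q 1 u) \<noteq> 0\<close> show False by simp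
  qed
  moreover have "0 \<le> apply_bcontfun ?F x" for x unfolding F by (intro Q_nonneg uL u(2)) simp
  ultimately have "0 < apply_bcontfun (C_part \<mu> S 1 ?F) x" for x by (intro iv) auto
  then have pos: "0 < Q 1 u x" for x
    by (simp add: C_part_apply F Q_Q_eigenfunction[OF uA] zero_less_mult_iff)
  obtain z where "\<And>x. Q 1 u z \<le> Q 1 u x"
    using continuous_attains_inf[OF compact_space _ Q_continuous[of UNIV 1 u]] by auto
  then have "exp \<kappa> * Q 1 u z \<le> apply_bcontfun (cont_rep \<mu> u) x" for x
    by (simp add: cont_rep_eigenfunction[OF uA])
  moreover have "\<kappa> \<le> \<nu>" if "\<nu> \<in> L2_spectrum \<mu> A" for \<nu>
    using below_in_resolvent_set[OF bound, of \<nu>] that by (force simp: L2_spectrum_def)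
  ultimately show thesis
    using that[of "exp \<kappa> * Q 1 u z" \<kappa> u] pos[of z] eigenvalue_in_spectrum[OF u(1)] u by simp
qed

end


theorem proposition2p4:
  fixes \<mu> :: "'a::metric_space measure"
    and S :: "real \<Rightarrow> ('a \<Rightarrow> real) \<Rightarrow> ('a \<Rightarrow> real)"
    and A :: "'a L2_graph"
  assumes "compact (UNIV :: 'a set)" and "connected (UNIV :: 'a set)"
    and "sets \<mu> = sets borel" and "finite_measure \<mu>" and "full_support \<mu>"
    and "L2_C0_semigroup \<mu> S" and "L2_positive_semigroup \<mu> S"
    and "L2_generator \<mu> S = {(f, \<lambda>x. - g x) | f g. (f, g) \<in> A}"
    and "L2_selfadjoint \<mu> A"
    and "\<forall>t>0. \<forall>f\<in>L2 \<mu>. \<exists>g :: 'a \<Rightarrow>\<^sub>C real. AE x in \<mu>. apply_bcontfun g x = S t f x"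
  shows
    "let Sc = C_part \<mu> S;
         i = C_irreducible Sc;
         ii = (\<forall>x. \<exists>t>0. \<exists>f. apply_bcontfun (Sc t f) x \<noteq> 0);
         iii = (\<exists>\<delta>>0. \<exists>\<kappa> u1.
           \<kappa> \<in> L2_spectrum \<mu> A \<and> (\<forall>\<nu>\<in>L2_spectrum \<mu> A. \<kappa> \<le> \<nu>) \<and>
           L2_eigenfunction \<mu> A \<kappa> u1 \<and> (AE x in \<mu>. u1 x \<ge> 0) \<and>
           (\<forall>x. apply_bcontfun (cont_rep \<mu> u1) x \<ge> \<delta>));
         iv = (\<forall>f :: 'a \<Rightarrow>\<^sub>C real. (\<forall>x. apply_bcontfun f x \<ge> 0) \<and> f \<noteq> 0 \<longrightarrow>
           (\<forall>t>0. \<forall>x. apply_bcontfun (Sc t f) x > 0))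
     in (i \<longleftrightarrow> ii) \<and> (i \<longleftrightarrow> iii) \<and> (i \<longleftrightarrow> iv)"
proof -
  interpret selfadjoint_C_semigroup \<mu> S A
    using assms by (simp add: selfadjoint_C_semigroup_def selfadjoint_C_semigroup_axioms_def)
  let ?i = "C_irreducible (C_part \<mu> S)"
  let ?ii = "\<forall>x. \<exists>t>0. \<exists>f. apply_bcontfun (C_part \<mu> S t f) x \<noteq> 0"
  let ?iii = "\<exists>\<delta>>0. \<exists>\<kappa> u1.
           \<kappa> \<in> L2_spectrum \<mu> A \<and> (\<forall>\<nu>\<in>L2_spectrum \<mu> A. \<kappa> \<le> \<nu>) \<and>
           L2_eigenfunction \<mu> A \<kappa> u1 \<and> (AE x in \<mu>. u1 x \<ge> 0) \<and>
           (\<forall>x. apply_bcontfun (cont_rep \<mu> u1) x \<ge> \<delta>)"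
  let ?iv = "\<forall>f :: 'a \<Rightarrow>\<^sub>C real. (\<forall>x. apply_bcontfun f x \<ge> 0) \<and> f \<noteq> 0 \<longrightarrow>
           (\<forall>t>0. \<forall>x. apply_bcontfun (C_part \<mu> S t f) x > 0)"
  have "?i \<Longrightarrow> ?iv" using irreducible_imp_strictly_positive by blast
  moreover have "?iv \<Longrightarrow> ?iii"
  proof (rule strictly_positive_imp_eigenfunction)
    fix \<delta> \<kappa> u
    assume "0 < \<delta>" "\<kappa> \<in> L2_spectrum \<mu> A" "\<And>\<nu>. \<nu> \<in> L2_spectrum \<mu> A \<Longrightarrow> \<kappa> \<le> \<nu>"
      "L2_eigenfunction \<mu> A \<kappa> u" "AE x in \<mu>. 0 \<le> u x" "\<And>x. \<delta> \<le> apply_bcontfun (cont_rep \<mu> u) x"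
    then show ?iii by blast
  qed blast
  moreover have "?iii \<Longrightarrow> ?ii"
  proof (elim exE conjE, rule allI)
    fix \<delta> \<kappa> u x
    assume "0 < \<delta>" "L2_eigenfunction \<mu> A \<kappa> u" "\<forall>x. \<delta> \<le> apply_bcontfun (cont_rep \<mu> u) x"
    then show "\<exists>t>0. \<exists>f. apply_bcontfun (C_part \<mu> S t f) x \<noteq> 0"
      by (intro eigenfunction_imp_nondegenerate[of \<kappa> u x]) (auto intro: less_le_trans)
  qed
  moreover have "?ii \<Longrightarrow> ?i" by (intro nondegenerate_imp_irreducible assms(2)) blast
  ultimately show ?thesis unfolding Let_def by blast
qed

end
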